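(* Every graph that is isomorphic to an induced subgraph of some unigraph is apex-perfect. Consequently, every such graph $G$ satisfies $\chi(G)\le\omega(G)+1$.
   Context: All graphs are finite and simple; $\omega$ denotes the clique number and $\chi$ the chromatic number. A unigraph is a graph $G$ such that every graph with the same degree sequence as $G$ is isomorphic to $G$. A graph $G$ is apex-perfect if there exists a vertex $v\in V(G)$ such that $G-\{v\}$ is perfect. *)

theory Defs
  imports "Graph_Theory.Graph_Theory" "HOL-Library.Multiset"
begin

text \<open>
  Finite simple graphs are the digraphs satisfying the locale predicate \<open>graph\<close>: finite,
  loop-free, without parallel arcs, and symmetric, so that an edge is a pair of opposite arcs.
  The graph with no vertices is included. In such a graph the degree of a vertex is its
  out-degree (equivalently, its in-degree).
\<close>

definition degree_sequence :: "('a,'b) pre_digraph \<Rightarrow> nat list" where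
  "degree_sequence G =
     rev (sorted_list_of_multiset (image_mset (out_degree G) (mset_set (verts G))))"

text \<open>
  Graphs with equal degree sequences have equally many vertices and equally many arcs, so
  nothing is lost by letting the competitor \<open>H\<close> range over graphs with the same vertex and
  arc types as \<open>G\<close>; see \<open>unigraph_iso_any_type\<close> below.
\<close>

definition unigraph :: "('a,'b) pre_digraph \<Rightarrow> bool" where
  "unigraph G \<longleftrightarrow> graph G \<and>
     (\<forall>H :: ('a,'b) pre_digraph.
        graph H \<and> degree_sequence H = degree_sequence G \<longrightarrow> digraph_iso H G)"

definition clique :: "('a,'b) pre_digraph \<Rightarrow> 'a set \<Rightarrow> bool" where
  "clique G C \<longleftrightarrow> C \<subseteq> verts G \<and> (\<forall>u\<in>C. \<forall>v\<in>C. u \<noteq> v \<longrightarrow> u \<rightarrow>\<^bsub>G\<^esub> v)"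

definition clique_number :: "('a,'b) pre_digraph \<Rightarrow> nat" where
  "clique_number G = Max (card ` {C. clique G C})"

definition proper_colouring :: "('a,'b) pre_digraph \<Rightarrow> nat \<Rightarrow> ('a \<Rightarrow> nat) \<Rightarrow> bool" where
  "proper_colouring G k c \<longleftrightarrow>
     (\<forall>v\<in>verts G. c v < k) \<and> (\<forall>u v. u \<rightarrow>\<^bsub>G\<^esub> v \<longrightarrow> c u \<noteq> c v)"

definition chromatic_number :: "('a,'b) pre_digraph \<Rightarrow> nat" where
  "chromatic_number G = (LEAST k. \<exists>c. proper_colouring G k c)"

definition perfect_graph :: "('a,'b) pre_digraph \<Rightarrow> bool" where
  "perfect_graph G \<longleftrightarrow> graph G \<and>
     (\<forall>H. induced_subgraph H G \<longrightarrow> chromatic_number H = clique_number H)"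

definition apex_perfect :: "('a,'b) pre_digraph \<Rightarrow> bool" where
  "apex_perfect G \<longleftrightarrow> graph G \<and> (\<exists>v\<in>verts G. perfect_graph (pre_digraph.del_vert G v))"

lemma degree_sequence_eq_iff:
  "degree_sequence G = degree_sequence H \<longleftrightarrow>
     image_mset (out_degree G) (mset_set (verts G)) = image_mset (out_degree H) (mset_set (verts H))"
  unfolding degree_sequence_def by (metis mset_sorted_list_of_multiset rev_rev_ident)

lemma card_arcs_eq_sum_out_degree:
  assumes "fin_digraph G"
  shows "card (arcs G) = (\<Sum>v\<in>verts G. out_degree G v)"
proof -
  interpret fin_digraph G by fact
  have "arcs G = (\<Union>v\<in>verts G. out_arcs G v)"
    by (auto simp: out_arcs_def)
  also have "card \<dots> = (\<Sum>v\<in>verts G. card (out_arcs G v))"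
    by (rule card_UN_disjoint) (auto simp: out_arcs_def)
  finally show ?thesis by (simp add: out_degree_def)
qed

lemma graph_copy:
  fixes K :: "('a,'b) pre_digraph" and V :: "'c set" and A :: "'d set"
  assumes "graph K" "finite V" "finite A" "card V = card (verts K)" "card A = card (arcs K)"
  obtains K' :: "('c,'d) pre_digraph"
  where "graph K'" "degree_sequence K' = degree_sequence K" "digraph_iso K K'"
proof -
  interpret graph K by fact
  obtain f where f: "bij_betw f (verts K) V"
    using assms(2,4) finite_verts by (metis finite_same_card_bij)
  obtain g where g: "bij_betw g (arcs K) A"
    using assms(3,5) finite_arcs by (metis finite_same_card_bij)
  define h where "h = the_inv_into (arcs K) g"
  have h: "h (g a) = a" if "a \<in> arcs K" for a
    using g that unfolding h_def bij_betw_def by (simp add: the_inv_into_f_f)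
  define i where "i = \<lparr>iso_verts = f, iso_arcs = g, iso_head = f \<circ> head K \<circ> h, iso_tail = f \<circ> tail K \<circ> h\<rparr>"
  have i: "digraph_isomorphism i"
    unfolding digraph_isomorphism_def i_def using f g h wf_digraph_axioms
    by (auto simp: bij_betw_def)
  let ?K = "app_iso i K"
  have iso: "digraph_iso K ?K" using i unfolding digraph_iso_def by blast
  have gr: "graph ?K"
  proof -
    interpret L: wf_digraph ?K using i by (rule wf_digraphI_app_iso)
    have f_eq: "f u = f v \<longleftrightarrow> u = v" if "u \<in> verts K" "v \<in> verts K" for u v
      using f that by (auto simp: bij_betw_def inj_on_def)
    have ends: "arcs_ends ?K = (\<lambda>(u,v). (f u, f v)) ` arcs_ends K"
      unfolding arcs_ends_def arc_to_ends_def image_image by (auto simp: i_def h image_iff)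
    show ?thesis
    proof
      show "finite (verts ?K)" "finite (arcs ?K)" by simp_all
      show "tail ?K e \<noteq> head ?K e" if "e \<in> arcs ?K" for e
        using that no_loops f_eq by (auto simp: i_def h)
      show "e1 = e2" if "e1 \<in> arcs ?K" "e2 \<in> arcs ?K" "arc_to_ends ?K e1 = arc_to_ends ?K e2" for e1 e2
        using that f_eq
        by (auto simp: i_def h arc_to_ends_def intro!: arg_cong[where f = g] no_multi_arcs)
      show "symmetric ?K"
        using sym_arcs unfolding symmetric_def ends sym_def by force
    qed
  qed
  have deg: "out_degree ?K (f v) = out_degree K v" if "v \<in> verts K" for v
  proof -
    have "out_arcs ?K (f v) = g ` out_arcs K v"
      using that f by (auto simp: out_arcs_def i_def h bij_betw_def inj_on_def)
    moreover have "inj_on g (out_arcs K v)"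
      using g by (auto simp: bij_betw_def out_arcs_def intro: inj_on_subset)
    ultimately show ?thesis by (simp add: out_degree_def card_image)
  qed
  have "mset_set (verts ?K) = image_mset f (mset_set (verts K))"
    using f by (simp add: i_def image_mset_mset_set bij_betw_def)
  then have "degree_sequence ?K = degree_sequence K"
    unfolding degree_sequence_eq_iff
    by (auto simp: multiset.map_comp deg intro!: image_mset_cong)
  with gr iso that show thesis by blast
qed

lemma unigraph_iso_any_type:
  fixes G :: "('a,'b) pre_digraph" and H :: "('c,'d) pre_digraph"
  assumes "unigraph G" "graph H" "degree_sequence H = degree_sequence G"
  shows "digraph_iso H G"
proof -
  interpret G: graph G using assms(1) by (simp add: unigraph_def)
  interpret H: graph H by fact
  have eq: "image_mset (out_degree H) (mset_set (verts H)) = image_mset (out_degree G) (mset_set (verts G))"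
    using assms(3) by (simp add: degree_sequence_eq_iff)
  have "card (verts G) = card (verts H)"
    using arg_cong[OF eq, of size] by simp
  moreover have "card (arcs G) = card (arcs H)"
    using arg_cong[OF eq, of sum_mset]
    by (simp add: card_arcs_eq_sum_out_degree G.fin_digraph_axioms H.fin_digraph_axioms sum_unfold_sum_mset)
  ultimately obtain K :: "('a,'b) pre_digraph"
    where "graph K" "degree_sequence K = degree_sequence H" "digraph_iso H K"
    using graph_copy[OF assms(2) G.finite_verts G.finite_arcs] by metis
  moreover from this have "digraph_iso K G"
    using assms(1,3) by (simp add: unigraph_def)
  ultimately show ?thesis by (blast intro: digraph_iso_trans)
qed

end

theory Submission
  imports Defs "HOL-Combinatorics.Transposition" "HOL-Library.Disjoint_Sets" "HOL-Library.Z2"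
begin

text \<open>
  All realizations of the degree sequence of a unigraph are isomorphic, so a 2-switch preserves
  every isomorphism invariant. Comparing sums over adjacent vertices of functions of the degrees
  shows that each alternating 4-cycle has an opposite pair of equal degrees, and that two
  vertices of equal degree have almost the same number of neighbours of each degree. If every
  degree class is a clique or stable, it follows that the graph has no induced \<open>2K\<^sub>2\<close>, \<open>C\<^sub>4\<close> or
  \<open>C\<^sub>5\<close> and hence is a split graph. Otherwise some degree class, alone or together with a single
  further vertex, is a core \<open>C\<close> such that the remaining vertices form a clique complete to \<open>C\<close>
  and a stable set anticomplete to \<open>C\<close>.

  The core is itself a unigraph, and all of its vertices but at most one have the same degree. It is
  therefore isomorphic to any convenient realization of its degrees: a bipartite graph with one more
  vertex, or a graph of a similar shape, or the complement of such a graph. Deleting one vertex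
  leaves a perfect graph, and adding back the clique and the stable set preserves perfection.
\<close>

section \<open>Graphs as adjacency relations\<close>

locale simple_graph =
  fixes V :: "'a set" and E :: "'a \<Rightarrow> 'a \<Rightarrow> bool"
  assumes finite_V: "finite V"
    and adj_left: "E u v \<Longrightarrow> u \<in> V"
    and adj_irrefl: "\<not> E v v"
    and adj_sym: "E u v \<Longrightarrow> E v u"
begin

lemma adj_right: "E u v \<Longrightarrow> v \<in> V"
  using adj_left adj_sym by blast

lemma adj_commute: "E u v \<longleftrightarrow> E v u"
  using adj_sym by blast

lemma finite_nbrs: "finite {w. E v w}"
  by (rule finite_subset[OF _ finite_V]) (use adj_right in blast)

lemma finite_nbrs_Collect: "finite {w. E v w \<and> P w}"
  by (rule finite_subset[OF _ finite_nbrs]) blast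

end

definition deg :: "('a \<Rightarrow> 'a \<Rightarrow> bool) \<Rightarrow> 'a \<Rightarrow> nat" where
  "deg E v = card {w. E v w}"

definition class_deg :: "('a \<Rightarrow> 'a \<Rightarrow> bool) \<Rightarrow> nat \<Rightarrow> 'a \<Rightarrow> nat" where
  "class_deg E s v = card {w. E v w \<and> deg E w = s}"

definition deg_class :: "'a set \<Rightarrow> ('a \<Rightarrow> 'a \<Rightarrow> bool) \<Rightarrow> nat \<Rightarrow> 'a set" where
  "deg_class V E t = {v \<in> V. deg E v = t}"

definition nbr_sum :: "('a \<Rightarrow> 'a \<Rightarrow> bool) \<Rightarrow> (nat \<Rightarrow> int) \<Rightarrow> 'a \<Rightarrow> int" where
  "nbr_sum E h v = (\<Sum>w | E v w. h (deg E w))"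

definition private_nbrs :: "('a \<Rightarrow> 'a \<Rightarrow> bool) \<Rightarrow> 'a \<Rightarrow> 'a \<Rightarrow> 'a set" where
  "private_nbrs E a d = {w. E a w \<and> \<not> E d w \<and> w \<noteq> d}"

definition compl_on :: "'a set \<Rightarrow> ('a \<Rightarrow> 'a \<Rightarrow> bool) \<Rightarrow> 'a \<Rightarrow> 'a \<Rightarrow> bool" where
  "compl_on V E u v \<longleftrightarrow> u \<in> V \<and> v \<in> V \<and> u \<noteq> v \<and> \<not> E u v"

definition restrict_on :: "'a set \<Rightarrow> ('a \<Rightarrow> 'a \<Rightarrow> bool) \<Rightarrow> 'a \<Rightarrow> 'a \<Rightarrow> bool" where
  "restrict_on C E u v \<longleftrightarrow> u \<in> C \<and> v \<in> C \<and> E u v"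

definition is_clique :: "('a \<Rightarrow> 'a \<Rightarrow> bool) \<Rightarrow> 'a set \<Rightarrow> bool" where
  "is_clique E A \<longleftrightarrow> (\<forall>u\<in>A. \<forall>v\<in>A. u \<noteq> v \<longrightarrow> E u v)"

definition is_stable :: "('a \<Rightarrow> 'a \<Rightarrow> bool) \<Rightarrow> 'a set \<Rightarrow> bool" where
  "is_stable E A \<longleftrightarrow> (\<forall>u\<in>A. \<forall>v\<in>A. \<not> E u v)"

lemma in_private_nbrs: "b \<in> private_nbrs E a d \<longleftrightarrow> E a b \<and> \<not> E d b \<and> b \<noteq> d"
  by (simp add: private_nbrs_def)

lemma in_deg_class: "v \<in> deg_class V E t \<longleftrightarrow> v \<in> V \<and> deg E v = t"
  by (simp add: deg_class_def)

context simple_graph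
begin

lemma deg_outside: "v \<notin> V \<Longrightarrow> deg E v = 0"
  using adj_left by (metis Collect_empty_eq card.empty deg_def)

lemma deg_pos_iff: "deg E v > 0 \<longleftrightarrow> (\<exists>w. E v w)"
  using finite_nbrs by (auto simp: deg_def card_gt_0_iff)

lemma class_deg_pos_iff: "class_deg E t v > 0 \<longleftrightarrow> (\<exists>w. E v w \<and> deg E w = t)"
  using finite_nbrs_Collect by (auto simp: class_deg_def card_gt_0_iff)

lemma finite_deg_class: "finite (deg_class V E t)"
  using finite_V by (simp add: deg_class_def)

lemma class_deg_eq_card_deg_class: "class_deg E t v = card {w \<in> deg_class V E t. E v w}"
  unfolding class_deg_def deg_class_def using adj_right by (intro arg_cong[of _ _ card]) blast

lemma nbr_sum_of_bool: "nbr_sum E (\<lambda>x. of_bool (x = s)) v = int (class_deg E s v)"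
  using finite_nbrs by (simp add: nbr_sum_def class_deg_def of_bool_def sum.If_cases Int_def)

lemma deg_eq_card_inside_outside: "deg E v = card {w \<in> C. E v w} + card {w. E v w \<and> w \<notin> C}"
proof -
  have "card ({w. E v w} \<inter> C) + card ({w. E v w} - C) = deg E v"
    unfolding deg_def using finite_nbrs by (metis card_Int_Diff)
  then show ?thesis
    by (simp add: Int_def set_diff_eq conj_commute)
qed

lemma card_private_nbrs:
  assumes "Q a \<longleftrightarrow> Q d"
  shows "card {w. E a w \<and> Q w} + card {w \<in> private_nbrs E d a. Q w} =
    card {w. E d w \<and> Q w} + card {w \<in> private_nbrs E a d. Q w}"
proof -
  define common where "common = {w. E a w \<and> E d w \<and> Q w}"
  have split: "card {w. E x w \<and> Q w} =
      card {w \<in> private_nbrs E x y. Q w} + card common + of_bool (E a d \<and> Q d)"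
    if "(x, y) = (a, d) \<or> (x, y) = (d, a)" for x y
  proof -
    let ?P = "{w \<in> private_nbrs E x y. Q w}" and ?R = "if E a d \<and> Q d then {y} else {}"
    have "{w. E x w \<and> Q w} = (?P \<union> common) \<union> ?R"
      using that assms adj_irrefl adj_commute[of a d]
      by (auto simp: in_private_nbrs common_def split: if_splits)
    moreover have "finite ?P" "finite common"
      by (rule finite_subset[OF _ finite_nbrs[of x]],
          use that in \<open>auto simp: in_private_nbrs common_def\<close>)+
    moreover have "?P \<inter> common = {}" "(?P \<union> common) \<inter> ?R = {}"
      using that adj_irrefl by (auto simp: in_private_nbrs common_def)
    ultimately show ?thesis by (simp add: card_Un_disjoint)
  qed
  show ?thesis using split[of a d] split[of d a] by simp
qed

lemma card_private_nbrs_class: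
  assumes "deg E a = deg E d"
  shows "class_deg E s a + card {w \<in> private_nbrs E d a. deg E w = s} =
    class_deg E s d + card {w \<in> private_nbrs E a d. deg E w = s}"
  unfolding class_deg_def by (rule card_private_nbrs) (simp add: assms)

lemma card_private_nbrs_eq:
  assumes "deg E a = deg E d"
  shows "card (private_nbrs E a d) = card (private_nbrs E d a)"
  using card_private_nbrs[of "\<lambda>_. True" a d] assms by (simp add: deg_def)

lemma finite_private_nbrs: "finite (private_nbrs E a d)"
  by (rule finite_subset[OF _ finite_nbrs[of a]]) (auto simp: in_private_nbrs)

lemma private_nbr_if_class_deg_less:
  assumes "deg E a = deg E d" "class_deg E s d < class_deg E s a"
  obtains b where "b \<in> private_nbrs E a d" "deg E b = s"
proof -
  have "card {w \<in> private_nbrs E a d. deg E w = s} > 0"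
    using card_private_nbrs_class[OF assms(1), of s] assms(2) by linarith
  then have "{w \<in> private_nbrs E a d. deg E w = s} \<noteq> {}" by (metis card.empty less_irrefl)
  with that show thesis by blast
qed

lemma private_nbr_exchange:
  assumes "deg E a = deg E d" "class_deg E (deg E y) d \<le> class_deg E (deg E y) a"
    and "y \<in> private_nbrs E d a"
  obtains u where "u \<in> private_nbrs E a d" "deg E u = deg E y"
proof -
  have "card {w \<in> private_nbrs E d a. deg E w = deg E y} > 0"
    using assms(3) finite_private_nbrs by (auto simp: card_gt_0_iff)
  then have "card {w \<in> private_nbrs E a d. deg E w = deg E y} > 0"
    using card_private_nbrs_class[OF assms(1), of "deg E y"] assms(2) by linarith
  then have "{w \<in> private_nbrs E a d. deg E w = deg E y} \<noteq> {}" by (metis card.empty less_irrefl)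
  with that show thesis by blast
qed

end

subsection \<open>Complements\<close>

context simple_graph
begin

lemma simple_graph_compl: "simple_graph V (compl_on V E)"
  using finite_V adj_sym by unfold_locales (auto simp: compl_on_def)

lemma compl_on_compl_on: "compl_on V (compl_on V E) = E"
  using adj_left adj_right adj_irrefl by (auto simp: compl_on_def fun_eq_iff)

lemma deg_compl:
  assumes "v \<in> V"
  shows "deg E v + deg (compl_on V E) v + 1 = card V"
proof -
  have "{w. compl_on V E v w} = V - {v} - {w. E v w}"
    using assms by (auto simp: compl_on_def)
  moreover have sub: "{w. E v w} \<subseteq> V - {v}"
    using adj_right adj_irrefl by auto
  ultimately have "card {w. compl_on V E v w} = card (V - {v}) - card {w. E v w}"
    using finite_nbrs by (simp add: card_Diff_subset)
  moreover have "card {w. E v w} \<le> card (V - {v})"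
    using sub finite_V by (intro card_mono) auto
  moreover have "card (V - {v}) + 1 = card V"
    using card_Suc_Diff1[OF finite_V assms] by simp
  ultimately show ?thesis by (simp add: deg_def)
qed

lemma deg_less_card: "v \<in> V \<Longrightarrow> deg E v < card V"
  using deg_compl[of v] by linarith

lemma deg_class_compl:
  assumes "t < card V"
  shows "deg_class V (compl_on V E) (card V - 1 - t) = deg_class V E t"
proof -
  have "deg (compl_on V E) v = card V - 1 - t \<longleftrightarrow> deg E v = t" if "v \<in> V" for v
    using deg_compl[OF that] assms by linarith
  then show ?thesis by (auto simp: in_deg_class)
qed

lemma class_deg_compl:
  assumes "t < card V" "v \<in> V"
  shows "class_deg (compl_on V E) (card V - 1 - t) v + class_deg E t v + of_bool (deg E v = t) =
    card (deg_class V E t)"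
proof -
  interpret C: simple_graph V "compl_on V E" by (rule simple_graph_compl)
  let ?M = "deg_class V E t"
  let ?A = "{w \<in> ?M. compl_on V E v w}" and ?B = "{w \<in> ?M. E v w}"
    and ?R = "if deg E v = t then {v} else {}"
  have "card ?M = card ((?A \<union> ?B) \<union> ?R)"
    using assms(2) by (intro arg_cong[of _ _ card]) (auto simp: compl_on_def in_deg_class)
  also have "\<dots> = card (?A \<union> ?B) + card ?R"
    using adj_irrefl finite_deg_class by (intro card_Un_disjoint) (auto simp: compl_on_def)
  also have "card (?A \<union> ?B) = card ?A + card ?B"
    using finite_deg_class by (intro card_Un_disjoint) (auto simp: compl_on_def)
  finally have "card ?M = card ?A + card ?B + card ?R" .
  then show ?thesis
    unfolding C.class_deg_eq_card_deg_class class_deg_eq_card_deg_class deg_class_compl[OF assms(1)]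
    by auto
qed

lemma private_nbrs_compl:
  "a \<in> V \<Longrightarrow> d \<in> V \<Longrightarrow> private_nbrs (compl_on V E) a d = private_nbrs E d a"
  using adj_right adj_irrefl by (auto simp: in_private_nbrs compl_on_def)

lemma is_clique_compl: "is_stable E A \<Longrightarrow> A \<subseteq> V \<Longrightarrow> is_clique (compl_on V E) A"
  by (auto simp: is_stable_def is_clique_def compl_on_def)

end

subsection \<open>Isomorphisms and realizations\<close>

locale graph_isomorphism = G: simple_graph V E + H: simple_graph W F
  for V :: "'a set" and E and W :: "'b set" and F +
  fixes f :: "'a \<Rightarrow> 'b"
  assumes bij: "bij_betw f V W"
    and adj_iff: "u \<in> V \<Longrightarrow> v \<in> V \<Longrightarrow> E u v \<longleftrightarrow> F (f u) (f v)"
begin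

lemma image_in: "v \<in> V \<Longrightarrow> f v \<in> W"
  using bij bij_betwE by blast

lemma eq_iff: "u \<in> V \<Longrightarrow> v \<in> V \<Longrightarrow> f u = f v \<longleftrightarrow> u = v"
  using bij by (auto simp: bij_betw_def inj_on_def)

lemma obtain_preimage:
  assumes "x \<in> W" obtains v where "v \<in> V" "f v = x"
  using assms bij by (auto simp: bij_betw_def)

lemma bij_betw_nbrs:
  assumes "v \<in> V"
  shows "bij_betw f {w. E v w} {w. F (f v) w}"
proof (rule bij_betw_subset[OF bij])
  show "{w. E v w} \<subseteq> V" using G.adj_right by blast
  show "f ` {w. E v w} = {w. F (f v) w}"
  proof
    show "f ` {w. E v w} \<subseteq> {w. F (f v) w}" using adj_iff assms G.adj_right by blast
    show "{w. F (f v) w} \<subseteq> f ` {w. E v w}"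
    proof
      fix x assume x: "x \<in> {w. F (f v) w}"
      then obtain w where "w \<in> V" "f w = x" using H.adj_right obtain_preimage by blast
      with x adj_iff assms show "x \<in> f ` {w. E v w}" by auto
    qed
  qed
qed

lemma deg_eq: "v \<in> V \<Longrightarrow> deg F (f v) = deg E v"
  unfolding deg_def using bij_betw_same_card[OF bij_betw_nbrs] by metis

lemma nbr_sum_eq:
  assumes "v \<in> V"
  shows "nbr_sum F h (f v) = nbr_sum E h v"
proof -
  have "nbr_sum E h v = (\<Sum>w | E v w. h (deg F (f w)))"
    unfolding nbr_sum_def using deg_eq G.adj_right by (intro sum.cong) auto
  also have "\<dots> = nbr_sum F h (f v)"
    unfolding nbr_sum_def by (rule sum.reindex_bij_betw[OF bij_betw_nbrs[OF assms]])
  finally show ?thesis by simp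
qed

lemma sum_deg_nbr_sum_eq:
  "(\<Sum>v\<in>V. \<Phi> (deg E v) (nbr_sum E h v) (nbr_sum E k v)) =
   (\<Sum>v\<in>W. \<Phi> (deg F v) (nbr_sum F h v) (nbr_sum F k v))"
proof -
  have "(\<Sum>v\<in>V. \<Phi> (deg E v) (nbr_sum E h v) (nbr_sum E k v)) =
      (\<Sum>v\<in>V. \<Phi> (deg F (f v)) (nbr_sum F h (f v)) (nbr_sum F k (f v)))"
    using deg_eq nbr_sum_eq by (intro sum.cong) auto
  also have "\<dots> = (\<Sum>v\<in>W. \<Phi> (deg F v) (nbr_sum F h v) (nbr_sum F k v))"
    by (rule sum.reindex_bij_betw[OF bij])
  finally show ?thesis .
qed

lemma graph_isomorphism_inv: "graph_isomorphism W F V E (the_inv_into V f)"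
proof
  show "bij_betw (the_inv_into V f) W V" using bij by (rule bij_betw_the_inv_into)
  then have inv: "the_inv_into V f x \<in> V" if "x \<in> W" for x using that bij_betwE by blast
  have "f (the_inv_into V f x) = x" if "x \<in> W" for x
    using bij that by (auto simp: bij_betw_def intro: f_the_inv_into_f)
  then show "F u v \<longleftrightarrow> E (the_inv_into V f u) (the_inv_into V f v)" if "u \<in> W" "v \<in> W" for u v
    using adj_iff inv that by simp
qed

lemma graph_isomorphism_compl: "graph_isomorphism V (compl_on V E) W (compl_on W F) f"
proof (intro graph_isomorphism.intro graph_isomorphism_axioms.intro)
  show "simple_graph V (compl_on V E)" "simple_graph W (compl_on W F)"
    using G.simple_graph_compl H.simple_graph_compl .
  show "compl_on V E u v \<longleftrightarrow> compl_on W F (f u) (f v)" if "u \<in> V" "v \<in> V" for u v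
    using that by (auto simp: compl_on_def adj_iff eq_iff image_in)
qed (rule bij)

end

lemma graph_isomorphism_trans:
  assumes "graph_isomorphism V E W F f" "graph_isomorphism W F X G g"
  shows "graph_isomorphism V E X G (g \<circ> f)"
proof -
  interpret f: graph_isomorphism V E W F f by fact
  interpret g: graph_isomorphism W F X G g by fact
  show ?thesis
    using bij_betw_trans[OF f.bij g.bij] f.adj_iff g.adj_iff f.image_in
    by unfold_locales simp_all
qed

text \<open>
  A realization has the prescribed degree at each vertex; this is stronger than having the same
  degree sequence.
\<close>

definition realizes :: "'a set \<Rightarrow> ('a \<Rightarrow> 'a \<Rightarrow> bool) \<Rightarrow> ('a \<Rightarrow> 'a \<Rightarrow> bool) \<Rightarrow> bool" where
  "realizes V E E' \<longleftrightarrow> simple_graph V E' \<and> (\<forall>v. deg E' v = deg E v)"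

lemma (in simple_graph) realizesI:
  assumes "simple_graph V E'" "\<And>v. v \<in> V \<Longrightarrow> deg E' v = deg E v"
  shows "realizes V E E'"
  using assms deg_outside simple_graph.deg_outside[OF assms(1)]
  unfolding realizes_def by metis

locale unigraph_on = simple_graph +
  assumes realizes_isomorphic: "realizes V E E' \<Longrightarrow> \<exists>f. graph_isomorphism V E' V E f"
begin

lemma unigraph_on_realizes:
  assumes "realizes V E E'"
  shows "unigraph_on V E'"
proof (intro unigraph_on.intro unigraph_on_axioms.intro)
  show "simple_graph V E'" using assms by (simp add: realizes_def)
  fix E'' assume "realizes V E' E''"
  then have "realizes V E E''" using assms by (simp add: realizes_def)
  then show "\<exists>f. graph_isomorphism V E'' V E' f"
    using assms realizes_isomorphic graph_isomorphism.graph_isomorphism_inv graph_isomorphism_trans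
    by metis
qed

lemma unigraph_on_compl: "unigraph_on V (compl_on V E)"
proof (intro unigraph_on.intro unigraph_on_axioms.intro)
  show "simple_graph V (compl_on V E)" by (rule simple_graph_compl)
  fix F assume F: "realizes V (compl_on V E) F"
  then interpret F: simple_graph V F by (simp add: realizes_def)
  have "deg (compl_on V F) v = deg E v" if "v \<in> V" for v
    using deg_compl[OF that] F.deg_compl[OF that] F by (simp add: realizes_def)
  then have "realizes V E (compl_on V F)"
    using F.simple_graph_compl by (intro realizesI)
  then obtain f where "graph_isomorphism V (compl_on V F) V E f"
    using realizes_isomorphic by blast
  then show "\<exists>f. graph_isomorphism V F V (compl_on V E) f"
    using graph_isomorphism.graph_isomorphism_compl F.compl_on_compl_on by metis
qed

end

subsection \<open>Switches\<close>

text \<open>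
  In the alternating 4-cycle with edges \<open>ab\<close>, \<open>cd\<close> and non-edges \<open>ac\<close>, \<open>bd\<close>, the opposite pairs are
  \<open>a, d\<close> and \<open>b, c\<close>.
\<close>

definition switch :: "('a \<Rightarrow> 'a \<Rightarrow> bool) \<Rightarrow> 'a \<Rightarrow> 'a \<Rightarrow> 'a \<Rightarrow> 'a \<Rightarrow> 'a \<Rightarrow> 'a \<Rightarrow> bool" where
  "switch E a b c d u v \<longleftrightarrow>
     {u, v} \<in> {{a, c}, {b, d}} \<or> E u v \<and> {u, v} \<notin> {{a, b}, {c, d}}"

locale alternating_cycle = simple_graph +
  fixes a b c d
  assumes ab: "E a b" and cd: "E c d" and not_ac: "\<not> E a c" and not_bd: "\<not> E b d"
    and a_neq_c: "a \<noteq> c" and b_neq_d: "b \<noteq> d"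
begin

abbreviation "E' \<equiv> switch E a b c d"

lemma distinct_vertices: "distinct [a, b, c, d]"
  using ab cd not_ac not_bd a_neq_c b_neq_d adj_irrefl adj_sym by auto

lemma vertices_in_V: "{a, b, c, d} \<subseteq> V"
  using ab cd adj_left adj_right by blast

lemma nbrs_switch:
  "{w. E' a w} = insert c ({w. E a w} - {b})"
  "{w. E' b w} = insert d ({w. E b w} - {a})"
  "{w. E' c w} = insert a ({w. E c w} - {d})"
  "{w. E' d w} = insert b ({w. E d w} - {c})"
  "v \<notin> {a, b, c, d} \<Longrightarrow> {w. E' v w} = {w. E v w}"
  using distinct_vertices by (auto simp: switch_def doubleton_eq_iff)

lemma simple_graph_switch: "simple_graph V E'"
proof
  show "u \<in> V" if "E' u v" for u v
    using that vertices_in_V adj_left by (auto simp: switch_def doubleton_eq_iff)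
  show "\<not> E' v v" for v
    using distinct_vertices adj_irrefl by (auto simp: switch_def doubleton_eq_iff)
  show "E' v u" if "E' u v" for u v
    using that adj_sym by (auto simp: switch_def doubleton_eq_iff)
qed (rule finite_V)

lemma sum_nbrs_switch:
  fixes g :: "'a \<Rightarrow> int"
  shows "(\<Sum>w | E' a w. g w) = (\<Sum>w | E a w. g w) - g b + g c"
    and "(\<Sum>w | E' b w. g w) = (\<Sum>w | E b w. g w) - g a + g d"
    and "(\<Sum>w | E' c w. g w) = (\<Sum>w | E c w. g w) - g d + g a"
    and "(\<Sum>w | E' d w. g w) = (\<Sum>w | E d w. g w) - g c + g b"
  using ab cd not_ac not_bd adj_commute[of b a] adj_commute[of d c] adj_commute[of c a]
    adj_commute[of d b] distinct_vertices
  by (simp_all only: nbrs_switch) (simp_all add: finite_nbrs sum_diff1)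

lemma deg_switch: "deg E' v = deg E v"
proof -
  have "int (deg F v) = (\<Sum>w | F v w. 1)" for F by (simp add: deg_def)
  then have "int (deg E' v) = int (deg E v)"
    using sum_nbrs_switch[of "\<lambda>_. 1"] nbrs_switch(5)[of v] by (cases "v \<in> {a, b, c, d}") auto
  then show ?thesis by simp
qed

lemma realizes_switch: "realizes V E E'"
  using simple_graph_switch deg_switch by (simp add: realizes_def)

lemma nbr_sum_switch:
  "nbr_sum E' h a = nbr_sum E h a - h (deg E b) + h (deg E c)"
  "nbr_sum E' h b = nbr_sum E h b - h (deg E a) + h (deg E d)"
  "nbr_sum E' h c = nbr_sum E h c - h (deg E d) + h (deg E a)"
  "nbr_sum E' h d = nbr_sum E h d - h (deg E c) + h (deg E b)"
  "v \<notin> {a, b, c, d} \<Longrightarrow> nbr_sum E' h v = nbr_sum E h v"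
  unfolding nbr_sum_def deg_switch using nbrs_switch(5)[of v]
  by (simp_all only: sum_nbrs_switch not_False_eq_True)

lemma sum_eq_sum_four:
  fixes f g :: "'a \<Rightarrow> int"
  assumes "\<And>v. v \<notin> {a, b, c, d} \<Longrightarrow> f v = g v" "sum f V = sum g V"
  shows "(f a - g a) + (f b - g b) + (f c - g c) + (f d - g d) = 0"
proof -
  have "(\<Sum>v\<in>V. f v - g v) = (\<Sum>v\<in>{a, b, c, d}. f v - g v)"
    using vertices_in_V assms(1) finite_V by (intro sum.mono_neutral_right) auto
  then show ?thesis using assms(2) distinct_vertices by (simp add: sum_subtractf)
qed

lemma class_deg_switch:
  assumes "deg E a = deg E d" "deg E b = deg E c"
  shows "class_deg E' s v = class_deg E s v"
proof -
  interpret E': simple_graph V E' by (rule simple_graph_switch)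
  have "int (class_deg E' s v) = int (class_deg E s v)"
    using nbr_sum_switch[where h = "\<lambda>x. of_bool (x = s)"] assms
    unfolding nbr_sum_of_bool[symmetric] E'.nbr_sum_of_bool[symmetric]
    by (cases "v \<in> {a, b, c, d}") auto
  then show ?thesis by simp
qed

end

section \<open>Unigraphs under switches\<close>

locale unigraph_alternating_cycle = unigraph_on + alternating_cycle
begin

lemma sum_switch:
  "(\<Sum>v\<in>V. \<Phi> (deg E' v) (nbr_sum E' h v) (nbr_sum E' k v)) =
   (\<Sum>v\<in>V. \<Phi> (deg E v) (nbr_sum E h v) (nbr_sum E k v))"
  using realizes_isomorphic[OF realizes_switch] graph_isomorphism.sum_deg_nbr_sum_eq by blast

text \<open>
  The switch preserves the number of edges, weighted by the product of the degrees of their ends.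
\<close>

lemma opposite_pair_deg_eq: "deg E a = deg E d \<or> deg E b = deg E c"
proof -
  let ?f = "\<lambda>F v. int (deg F v) * nbr_sum F int v"
  have "sum (?f E') V = sum (?f E) V"
    by (rule sum_switch[of "\<lambda>x p q. int x * p"])
  then have "(?f E' a - ?f E a) + (?f E' b - ?f E b) + (?f E' c - ?f E c) + (?f E' d - ?f E d) = 0"
    by (intro sum_eq_sum_four) (simp add: deg_switch nbr_sum_switch(5))
  then have "2 * (int (deg E b) - int (deg E c)) * (int (deg E a) - int (deg E d)) = 0"
    unfolding nbr_sum_switch deg_switch by algebra
  then show ?thesis by auto
qed

text \<open>
  The switch preserves the number of walks of length 2 from a vertex of degree \<open>deg E c\<close> through one
  of degree \<open>deg E a\<close> to one of degree \<open>s\<close>.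
\<close>

lemma class_deg_trade:
  assumes "deg E a = deg E d" "deg E b \<noteq> deg E c"
  shows "class_deg E s d + of_bool (s = deg E b) = class_deg E s a + of_bool (s = deg E c)"
proof -
  define n where "n s v = int (class_deg E s v)" for s v
  define \<epsilon> :: "nat \<Rightarrow> int" where "\<epsilon> s = of_bool (s = deg E c) - of_bool (s = deg E b)" for s
  let ?r = "deg E c" and ?h = "\<lambda>s x. of_bool (x = s) :: int"
  have n_eq: "n s d - n s a = \<epsilon> s * (n ?r a - n ?r d + 2)" for s
  proof -
    let ?f = "\<lambda>F v. of_bool (deg F v = deg E a) * nbr_sum F (?h ?r) v * nbr_sum F (?h s) v"
    have "sum (?f E') V = sum (?f E) V"
      by (rule sum_switch[of "\<lambda>x p q. of_bool (x = deg E a) * p * q"])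
    then have "(?f E' a - ?f E a) + (?f E' b - ?f E b) + (?f E' c - ?f E c) +
        (?f E' d - ?f E d) = 0"
      by (intro sum_eq_sum_four) (simp add: deg_switch nbr_sum_switch(5))
    then have "(n ?r a + 1) * (n s a + \<epsilon> s) - n ?r a * n s a
        + (n ?r d - 1) * (n s d - \<epsilon> s) - n ?r d * n s d = 0"
      using assms unfolding deg_switch nbr_sum_switch nbr_sum_of_bool n_def[symmetric] \<epsilon>_def
      by (auto simp: algebra_simps)
    then show ?thesis by algebra
  qed
  have "n ?r a - n ?r d + 2 = 1"
    using n_eq[of ?r] assms(2) by (simp add: \<epsilon>_def)
  then have "n s d - n s a = \<epsilon> s" using n_eq[of s] by simp
  then show ?thesis by (simp add: n_def \<epsilon>_def of_bool_def split: if_splits)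
qed

end

definition class_equiv :: "'a set \<Rightarrow> ('a \<Rightarrow> 'a \<Rightarrow> bool) \<Rightarrow> ('a \<Rightarrow> 'a \<Rightarrow> bool) \<Rightarrow> bool" where
  "class_equiv V E E' \<longleftrightarrow> realizes V E E' \<and> (\<forall>s v. class_deg E' s v = class_deg E s v)"

lemma class_equivD:
  assumes "class_equiv V E F"
  shows "realizes V E F" "simple_graph V F" "deg F v = deg E v" "class_deg F s v = class_deg E s v"
    "deg_class V F t = deg_class V E t"
  using assms by (simp_all add: class_equiv_def realizes_def deg_class_def)

text \<open>
  The profile of \<open>d\<close>, its numbers of neighbours in the degree classes, arises from that of \<open>a\<close> by
  trading a neighbour of degree \<open>q\<close> for one of degree \<open>r\<close>.
\<close>

definition traded :: "('a \<Rightarrow> 'a \<Rightarrow> bool) \<Rightarrow> 'a \<Rightarrow> 'a \<Rightarrow> nat \<Rightarrow> nat \<Rightarrow> bool" where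
  "traded E a d q r \<longleftrightarrow>
     (\<forall>s. class_deg E s d + of_bool (s = q) = class_deg E s a + of_bool (s = r))"

lemma tradedD:
  "traded E a d q r \<Longrightarrow> class_deg E s d + of_bool (s = q) = class_deg E s a + of_bool (s = r)"
  by (simp add: traded_def)

lemma (in simple_graph) traded_compl:
  assumes "traded E a d q r" "deg E a = deg E d" "a \<in> V" "d \<in> V" "q < card V" "r < card V"
  shows "traded (compl_on V E) d a (card V - 1 - q) (card V - 1 - r)"
  unfolding traded_def
proof
  interpret C: simple_graph V "compl_on V E" by (rule simple_graph_compl)
  fix s
  show "class_deg (compl_on V E) s a + of_bool (s = card V - 1 - q) =
    class_deg (compl_on V E) s d + of_bool (s = card V - 1 - r)"
  proof (cases "s < card V")
    case True
    define u where "u = card V - 1 - s"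
    have u: "u < card V" "s = card V - 1 - u" using True by (auto simp: u_def)
    moreover have "s = card V - 1 - q \<longleftrightarrow> u = q" "s = card V - 1 - r \<longleftrightarrow> u = r"
      using u assms(5,6) by auto
    ultimately show ?thesis
      using class_deg_compl[OF u(1) assms(3)] class_deg_compl[OF u(1) assms(4)] assms(2)
        tradedD[OF assms(1), of u] by simp
  next
    case False
    then have "class_deg (compl_on V E) s v = 0" for v
      using C.class_deg_pos_iff C.adj_right C.deg_less_card by (metis not_gr_zero)
    then show ?thesis using False assms(5,6) by auto
  qed
qed

context unigraph_on
begin

lemma opposite_deg_eq:
  assumes "E a b" "E c d" "\<not> E a c" "\<not> E b d" "a \<noteq> c" "b \<noteq> d"
  shows "deg E a = deg E d \<or> deg E b = deg E c"
proof -
  interpret unigraph_alternating_cycle V E a b c d using assms by unfold_locales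
  show ?thesis by (rule opposite_pair_deg_eq)
qed

lemma unigraph_on_class_equiv: "class_equiv V E F \<Longrightarrow> unigraph_on V F"
  using unigraph_on_realizes by (simp add: class_equiv_def)

lemma class_equiv_switch:
  assumes "E a b" "E c d" "\<not> E a c" "\<not> E b d" "a \<noteq> c" "b \<noteq> d"
    and "deg E a = deg E d" "deg E b = deg E c"
  shows "class_equiv V E (switch E a b c d)"
proof -
  interpret alternating_cycle V E a b c d using assms by unfold_locales
  show ?thesis using realizes_switch class_deg_switch assms(7,8) by (simp add: class_equiv_def)
qed

lemma traded_private_nbrs:
  assumes "deg E a = deg E d" "b \<in> private_nbrs E a d" "c \<in> private_nbrs E d a"
    and "deg E b \<noteq> deg E c"
  shows "traded E a d (deg E b) (deg E c)"
proof -
  interpret unigraph_alternating_cycle V E a b c d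
    using assms adj_sym by unfold_locales (auto simp: in_private_nbrs)
  show ?thesis using class_deg_trade assms by (simp add: traded_def)
qed

lemma private_nbrs_if_class_deg_neq:
  assumes "deg E a = deg E d" "class_deg E s a \<noteq> class_deg E s d"
  obtains b c where "b \<in> private_nbrs E a d" "c \<in> private_nbrs E d a" "deg E b \<noteq> deg E c"
proof -
  have private_pair: "\<exists>b\<in>private_nbrs E x y. \<exists>c\<in>private_nbrs E y x. deg E b \<noteq> deg E c"
    if xy: "deg E x = deg E y" "class_deg E s y < class_deg E s x" for x y
  proof (rule ccontr)
    assume contrary: "\<not> ?thesis"
    obtain b where b: "b \<in> private_nbrs E x y" "deg E b = s"
      by (rule private_nbr_if_class_deg_less[OF xy])
    then have only_s: "{w \<in> private_nbrs E y x. deg E w = s} = private_nbrs E y x"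
      using contrary by auto
    have "card {w \<in> private_nbrs E x y. deg E w = s} \<le> card (private_nbrs E x y)"
      using finite_private_nbrs by (intro card_mono) auto
    then show False
      using card_private_nbrs_class[OF xy(1), of s] card_private_nbrs_eq[OF xy(1)] xy(2) only_s
      by simp
  qed
  consider "class_deg E s d < class_deg E s a" | "class_deg E s a < class_deg E s d"
    using assms(2) by linarith
  then show thesis using private_pair[of a d] private_pair[of d a] assms(1) that by cases metis+
qed

lemma private_nbrs_if_traded:
  assumes "deg E a = deg E d" "traded E a d q r" "q \<noteq> r"
  obtains b c where "b \<in> private_nbrs E a d" "deg E b = q" "c \<in> private_nbrs E d a" "deg E c = r"
proof -
  have "class_deg E q d < class_deg E q a" "class_deg E r a < class_deg E r d"
    using tradedD[OF assms(2), of q] tradedD[OF assms(2), of r] assms(3) by auto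
  then show thesis
    using private_nbr_if_class_deg_less assms(1) that by metis
qed

lemma adj_iff_if_traded:
  assumes "deg E a = deg E d" "traded E a d q r" "q \<noteq> r"
    and x: "deg E x \<noteq> q" "deg E x \<noteq> r" "x \<noteq> a" "x \<noteq> d"
  shows "E a x \<longleftrightarrow> E d x"
proof (rule ccontr)
  obtain b c where bc: "b \<in> private_nbrs E a d" "deg E b = q" "c \<in> private_nbrs E d a" "deg E c = r"
    by (rule private_nbrs_if_traded[OF assms(1-3)])
  assume "\<not> ?thesis"
  then consider (at_a) "x \<in> private_nbrs E a d" | (at_d) "x \<in> private_nbrs E d a"
    using x by (auto simp: in_private_nbrs)
  then show False
  proof cases
    case at_a
    then have "traded E a d (deg E x) r"
      using traded_private_nbrs[OF assms(1) _ bc(3)] bc(4) x(2) by metis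
    then show False
      using tradedD[of E a d "deg E x" r "deg E x"] tradedD[OF assms(2), of "deg E x"] x by simp
  next
    case at_d
    then have "traded E a d q (deg E x)"
      using traded_private_nbrs[OF assms(1) bc(1)] bc(2) x(1) by metis
    then show False
      using tradedD[of E a d q "deg E x" "deg E x"] tradedD[OF assms(2), of "deg E x"] x by simp
  qed
qed

lemma traded_if_class_deg_neq:
  assumes "deg E a = deg E d" "class_deg E s a \<noteq> class_deg E s d"
  obtains q r where "q \<noteq> r" "traded E a d q r"
  using private_nbrs_if_class_deg_neq[OF assms] traded_private_nbrs[OF assms(1)] by metis

lemma class_deg_le_Suc:
  assumes "deg E a = deg E d"
  shows "class_deg E s a \<le> class_deg E s d + 1"
proof (cases "class_deg E s a = class_deg E s d")
  case False
  then obtain q r where "traded E a d q r" using traded_if_class_deg_neq[OF assms] by metis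
  then show ?thesis using tradedD[of E a d q r s] by (simp add: of_bool_def split: if_splits)
qed simp

lemma adj_iff_if_class_deg_eq:
  assumes "deg E a = deg E d" "class_deg E s a \<noteq> class_deg E s d"
    and "class_deg E (deg E x) a = class_deg E (deg E x) d" "x \<noteq> a" "x \<noteq> d"
  shows "E a x \<longleftrightarrow> E d x"
proof -
  obtain q r where qr: "q \<noteq> r" "traded E a d q r" by (rule traded_if_class_deg_neq[OF assms(1,2)])
  then have "deg E x \<noteq> q" "deg E x \<noteq> r"
    using tradedD[OF qr(2), of "deg E x"] assms(3) by (auto simp: of_bool_def split: if_splits)
  then show ?thesis using adj_iff_if_traded assms qr by blast
qed

end

subsection \<open>Rearranging the edges inside a set of vertices\<close>

definition replace_inside ::
    "'a set \<Rightarrow> ('a \<Rightarrow> 'a \<Rightarrow> bool) \<Rightarrow> ('a \<Rightarrow> 'a \<Rightarrow> bool) \<Rightarrow> 'a \<Rightarrow> 'a \<Rightarrow> bool" where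
  "replace_inside C G E u v \<longleftrightarrow> (if u \<in> C \<and> v \<in> C then G u v else E u v)"

context simple_graph
begin

lemma simple_graph_restrict_on: "C \<subseteq> V \<Longrightarrow> simple_graph C (restrict_on C E)"
  using finite_subset[OF _ finite_V] adj_irrefl adj_sym
  by unfold_locales (auto simp: restrict_on_def)

lemma simple_graph_replace_inside:
  assumes "simple_graph C G" "C \<subseteq> V"
  shows "simple_graph V (replace_inside C G E)"
proof -
  interpret G: simple_graph C G by fact
  show ?thesis
    using finite_V adj_left adj_irrefl adj_sym G.adj_irrefl G.adj_sym assms(2)
    by unfold_locales (auto simp: replace_inside_def split: if_splits)
qed

lemma deg_replace_inside:
  assumes G: "simple_graph C G" "C \<subseteq> V"
    and deg: "\<And>v. v \<in> C \<Longrightarrow> deg G v = deg (restrict_on C E) v"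
  shows "deg (replace_inside C G E) v = deg E v"
proof (cases "v \<in> C")
  case True
  interpret G: simple_graph C G by fact
  interpret F: simple_graph V "replace_inside C G E" by (rule simple_graph_replace_inside[OF G])
  have "{w \<in> C. replace_inside C G E v w} = {w. G v w}" "{w \<in> C. E v w} = {w. restrict_on C E v w}"
    "{w. replace_inside C G E v w \<and> w \<notin> C} = {w. E v w \<and> w \<notin> C}"
    using True G.adj_right by (auto simp: replace_inside_def restrict_on_def)
  then show ?thesis
    using deg[OF True] F.deg_eq_card_inside_outside[of v C] deg_eq_card_inside_outside[of v C]
    by (simp add: deg_def)
qed (simp add: deg_def replace_inside_def)

lemma realizes_replace_inside:
  assumes "simple_graph C G" "C \<subseteq> V" "\<And>v. v \<in> C \<Longrightarrow> deg G v = deg (restrict_on C E) v"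
  shows "realizes V E (replace_inside C G E)"
  using simple_graph_replace_inside deg_replace_inside assms by (simp add: realizes_def)

lemma class_deg_eq_deg_restrict_on:
  assumes "v \<in> deg_class V E t"
  shows "class_deg E t v = deg (restrict_on (deg_class V E t) E) v"
  unfolding class_deg_eq_card_deg_class deg_def
  using assms by (intro arg_cong[of _ _ card]) (auto simp: restrict_on_def)

lemma class_equiv_replace_inside:
  fixes t
  defines "M \<equiv> deg_class V E t"
  assumes G: "simple_graph M G" and deg: "\<And>v. v \<in> M \<Longrightarrow> deg G v = deg (restrict_on M E) v"
  shows "class_equiv V E (replace_inside M G E)"
proof -
  let ?F = "replace_inside M G E"
  have "M \<subseteq> V" by (auto simp: M_def in_deg_class)
  interpret G: simple_graph M G by fact
  interpret F: simple_graph V ?F by (rule simple_graph_replace_inside[OF G \<open>M \<subseteq> V\<close>])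
  have deg_F: "deg ?F v = deg E v" for v by (rule deg_replace_inside[OF G \<open>M \<subseteq> V\<close> deg])
  then have M_F: "deg_class V ?F t = M" by (simp add: deg_class_def M_def)
  have "class_deg ?F s v = class_deg E s v" for s v
  proof (cases "v \<in> M \<and> s = t")
    case True
    have "{w \<in> M. ?F v w} = {w. G v w}"
      using True G.adj_right by (auto simp: replace_inside_def)
    then show ?thesis
      using True deg[of v] class_deg_eq_deg_restrict_on[of v t]
        F.class_deg_eq_card_deg_class[of t v]
      by (simp add: M_F deg_def[of G] M_def[symmetric])
  next
    case False
    then have "{w. ?F v w \<and> deg ?F w = s} = {w. E v w \<and> deg E w = s}"
      unfolding deg_F by (auto simp: replace_inside_def M_def in_deg_class)
    then show ?thesis by (simp add: class_deg_def)
  qed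
  then show ?thesis
    using realizes_replace_inside[OF G \<open>M \<subseteq> V\<close> deg] by (simp add: class_equiv_def)
qed

lemma class_equiv_permute_deg_class:
  fixes t
  defines "M \<equiv> deg_class V E t"
  assumes \<pi>: "bij_betw \<pi> M M" "\<And>v. v \<in> M \<Longrightarrow> class_deg E t (\<pi> v) = class_deg E t v"
  shows "class_equiv V E (replace_inside M (\<lambda>u v. restrict_on M E (\<pi> u) (\<pi> v)) E)"
proof -
  let ?G = "\<lambda>u v. u \<in> M \<and> v \<in> M \<and> E (\<pi> u) (\<pi> v)"
  have "M \<subseteq> V" by (auto simp: M_def in_deg_class)
  interpret M: simple_graph M "restrict_on M E" by (rule simple_graph_restrict_on[OF \<open>M \<subseteq> V\<close>])
  have "\<pi> v \<in> M" if "v \<in> M" for v using that \<pi>(1) bij_betwE by blast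
  then interpret \<pi>: graph_isomorphism M ?G M "restrict_on M E" \<pi>
    using M.finite_V adj_irrefl adj_sym \<pi>(1)
    by unfold_locales (auto simp: restrict_on_def)
  have "deg ?G v = deg (restrict_on M E) v" if "v \<in> M" for v
    using \<pi>.deg_eq[OF that] \<pi>(2)[OF that] that \<pi>.image_in[OF that]
    by (simp add: class_deg_eq_deg_restrict_on M_def)
  then have "class_equiv V E (replace_inside M ?G E)"
    unfolding M_def using \<pi>.G.simple_graph_axioms
    by (intro class_equiv_replace_inside) (simp_all add: M_def)
  moreover have "replace_inside M ?G E = replace_inside M (\<lambda>u v. restrict_on M E (\<pi> u) (\<pi> v)) E"
    using \<pi>.image_in by (auto simp: replace_inside_def restrict_on_def fun_eq_iff)
  ultimately show ?thesis by simp
qed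

lemma class_equiv_move_pair:
  fixes t
  defines "M \<equiv> deg_class V E t"
  assumes M: "a \<in> M" "b \<in> M" "x \<in> M" "y \<in> M" and neq: "a \<noteq> b" "x \<noteq> y"
    and inner: "class_deg E t a = class_deg E t x" "class_deg E t b = class_deg E t y"
  obtains F where "class_equiv V E F" "F a b \<longleftrightarrow> E x y"
    "\<And>u v. u \<notin> M \<or> v \<notin> M \<Longrightarrow> F u v \<longleftrightarrow> E u v"
proof -
  define b' where "b' = transpose a x b"
  define \<pi> where "\<pi> = transpose b' y \<circ> transpose a x"
  have b': "b' \<in> M" "b' \<noteq> x" "class_deg E t b' = class_deg E t y"
    using M neq inner by (auto simp: b'_def transpose_def)
  then have image: "\<pi> a = x" "\<pi> b = y"
    using neq by (auto simp: \<pi>_def b'_def transpose_def)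
  have bij: "bij_betw (transpose p q) M M" if "p \<in> M" "q \<in> M" for p q
    by (rule bij_betw_byWitness[where f' = "transpose p q"])
      (use that in \<open>auto simp: transpose_def\<close>)
  have "bij_betw \<pi> M M"
    unfolding \<pi>_def by (rule bij_betw_trans[OF bij bij]) (use M b' in auto)
  moreover have "class_deg E t (transpose p q v) = class_deg E t v"
    if "class_deg E t p = class_deg E t q" for p q v
    using that by (simp add: transpose_def)
  then have "class_deg E t (\<pi> v) = class_deg E t v" for v
    using inner(1) b'(3) by (simp add: \<pi>_def)
  ultimately have "class_equiv V E (replace_inside M (\<lambda>u v. restrict_on M E (\<pi> u) (\<pi> v)) E)"
    unfolding M_def by (intro class_equiv_permute_deg_class)
  then show thesis
    by (rule that) (use M image in \<open>auto simp: replace_inside_def restrict_on_def\<close>)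
qed

end

lemma (in unigraph_on) unigraph_on_restrict_on:
  assumes "C \<subseteq> V" and closed: "\<And>v x. v \<in> C \<Longrightarrow> x \<in> V \<Longrightarrow> deg E x = deg E v \<Longrightarrow> x \<in> C"
  shows "unigraph_on C (restrict_on C E)"
proof (intro unigraph_on.intro unigraph_on_axioms.intro)
  show C: "simple_graph C (restrict_on C E)" by (rule simple_graph_restrict_on[OF assms(1)])
  fix G assume "realizes C (restrict_on C E) G"
  then have G: "simple_graph C G" "\<And>v. deg G v = deg (restrict_on C E) v"
    by (simp_all add: realizes_def)
  let ?F = "replace_inside C G E"
  obtain f where "graph_isomorphism V ?F V E f"
    using realizes_isomorphic realizes_replace_inside[OF G(1) assms(1) G(2)] by blast
  then interpret f: graph_isomorphism V ?F V E f .
  have "deg E (f v) = deg E v" if "v \<in> V" for v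
    using f.deg_eq[OF that] deg_replace_inside[OF G(1) assms(1) G(2)] by simp
  then have "f ` C \<subseteq> C" using closed f.image_in assms(1) by blast
  moreover have inj: "inj_on f C"
    using f.bij assms(1) by (auto simp: bij_betw_def intro: inj_on_subset)
  ultimately have "bij_betw f C C"
    using finite_subset[OF assms(1) finite_V] by (simp add: bij_betw_def endo_inj_surj)
  moreover have "G u v \<longleftrightarrow> restrict_on C E (f u) (f v)" if "u \<in> C" "v \<in> C" for u v
    using f.adj_iff[of u v] that assms(1) \<open>f ` C \<subseteq> C\<close>
    by (auto simp: replace_inside_def restrict_on_def)
  ultimately have "graph_isomorphism C G C (restrict_on C E) f"
    using G(1) C by (intro graph_isomorphism.intro graph_isomorphism_axioms.intro)
  then show "\<exists>f. graph_isomorphism C G C (restrict_on C E) f" by blast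
qed

section \<open>Mixed degree classes\<close>

definition mixed :: "'a set \<Rightarrow> ('a \<Rightarrow> 'a \<Rightarrow> bool) \<Rightarrow> nat \<Rightarrow> bool" where
  "mixed V E t \<longleftrightarrow> \<not> is_clique E (deg_class V E t) \<and> \<not> is_stable E (deg_class V E t)"

subsection \<open>Crossed pairs\<close>

text \<open>
  Two vertices of the same degree with a private neighbour each, both of other degrees. The
  adjacency of \<open>a\<close> and \<open>d\<close> is determined by that of \<open>b\<close> and \<open>c\<close>, whereas it can be changed by
  rearranging the degree class of \<open>a\<close> and \<open>d\<close>.
\<close>

locale crossed_pair = unigraph_on +
  fixes a d b c t
  assumes deg_a: "deg E a = t" and deg_d: "deg E d = t"
    and b: "b \<in> private_nbrs E a d" and c: "c \<in> private_nbrs E d a"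
    and deg_b: "deg E b \<noteq> t" and deg_c: "deg E c \<noteq> t"
begin

lemma adj: "E a b" "\<not> E d b" "E d c" "\<not> E a c" "b \<noteq> d" "c \<noteq> a"
  using b c by (simp_all add: in_private_nbrs)

lemma in_V: "a \<in> V" "d \<in> V" "b \<in> V" "c \<in> V"
  using adj adj_left adj_right by blast+

lemma neq: "a \<noteq> d" "b \<noteq> c"
  using adj by auto

lemma a_d_in_class: "a \<in> deg_class V E t" "d \<in> deg_class V E t"
  using in_V deg_a deg_d by (simp_all add: in_deg_class)

lemma crossed_adj_iff: "E a d \<longleftrightarrow> \<not> E b c"
proof
  show "\<not> E b c" if "E a d"
    using opposite_deg_eq[of a d c b] that adj adj_sym[of b c] deg_a deg_d deg_b deg_c by auto
  show "E a d" if "\<not> E b c"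
    using opposite_deg_eq[of a b d c] that adj neq deg_a deg_d deg_b deg_c by auto
qed

lemma crossed_pair_class_equiv:
  assumes "class_equiv V E F"
    and "\<And>u v. u \<notin> deg_class V E t \<or> v \<notin> deg_class V E t \<Longrightarrow> F u v \<longleftrightarrow> E u v"
  shows "crossed_pair V F a d b c t"
proof -
  interpret F: unigraph_on V F by (rule unigraph_on_class_equiv[OF assms(1)])
  have "b \<notin> deg_class V E t" "c \<notin> deg_class V E t"
    using deg_b deg_c by (simp_all add: in_deg_class)
  then show ?thesis
    using deg_a deg_d deg_b deg_c adj assms(2)
    by unfold_locales (simp_all add: class_equivD[OF assms(1)] in_private_nbrs)
qed

lemma crossed_pair_compl: "crossed_pair V (compl_on V E) a d c b (card V - 1 - t)"
proof -
  interpret C: unigraph_on V "compl_on V E" by (rule unigraph_on_compl)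
  show ?thesis
    using in_V b c deg_a deg_d deg_b deg_c
      deg_compl[of a] deg_compl[of d] deg_compl[of b] deg_compl[of c]
    by unfold_locales (simp_all add: private_nbrs_compl)
qed

lemma adj_iff_if_inner_deg_eq:
  assumes "x \<in> deg_class V E t" "y \<in> deg_class V E t" "x \<noteq> y"
    and "class_deg E t x = class_deg E t a" "class_deg E t y = class_deg E t d"
  shows "E x y \<longleftrightarrow> E a d"
proof -
  obtain F where F: "class_equiv V E F" "F a d \<longleftrightarrow> E x y"
    "\<And>u v. u \<notin> deg_class V E t \<or> v \<notin> deg_class V E t \<Longrightarrow> F u v \<longleftrightarrow> E u v"
    by (rule class_equiv_move_pair[OF a_d_in_class assms(1,2) neq(1) assms(3)])
      (use assms(4,5) in simp_all)
  interpret F: crossed_pair V F a d b c t by (rule crossed_pair_class_equiv[OF F(1,3)])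
  have "F b c \<longleftrightarrow> E b c" using F(3) deg_b by (simp add: in_deg_class)
  then show ?thesis using F(2) F.crossed_adj_iff crossed_adj_iff by blast
qed

lemma adj_iff_class_equiv:
  assumes F: "class_equiv V E F"
      "\<And>u v. u \<notin> deg_class V E t \<or> v \<notin> deg_class V E t \<Longrightarrow> F u v \<longleftrightarrow> E u v"
    and "x \<in> deg_class V E t" "y \<in> deg_class V E t" "x \<noteq> y"
    and "class_deg E t x = class_deg E t a" "class_deg E t y = class_deg E t d"
  shows "F x y \<longleftrightarrow> E a d"
proof -
  interpret F: crossed_pair V F a d b c t by (rule crossed_pair_class_equiv[OF F])
  have "F b c \<longleftrightarrow> E b c" using F(2) deg_b by (simp add: in_deg_class)
  then show ?thesis
    using F.adj_iff_if_inner_deg_eq[of x y] F.crossed_adj_iff crossed_adj_iff assms(3-7)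
    by (simp add: class_equivD[OF F(1)])
qed

end

subsection \<open>Neighbour counts in a mixed class\<close>

text \<open>
  A crossed pair whose profiles differ does not occur in a mixed class: all vertices of the class
  turn out to have the same number of neighbours in the class, and then the class is a clique
  or stable.
\<close>

locale traded_pair = crossed_pair +
  assumes deg_b_neq_deg_c: "deg E b \<noteq> deg E c"
begin

lemma traded_a_d: "traded E a d (deg E b) (deg E c)"
  using traded_private_nbrs b c deg_b_neq_deg_c deg_a deg_d by metis

lemma inner_deg_eq: "class_deg E t a = class_deg E t d"
  using tradedD[OF traded_a_d, of t] deg_b deg_c by simp

lemma traded_pair_compl: "traded_pair V (compl_on V E) a d c b (card V - 1 - t)"
proof -
  interpret C: crossed_pair V "compl_on V E" a d c b "card V - 1 - t" by (rule crossed_pair_compl)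
  show ?thesis
    using deg_b_neq_deg_c deg_compl[of b] deg_compl[of c] in_V by unfold_locales simp
qed

lemma adj_iff_a_d:
  assumes "deg E x = t" "x \<noteq> a" "x \<noteq> d"
  shows "E a x \<longleftrightarrow> E d x"
  using adj_iff_if_traded[OF _ traded_a_d deg_b_neq_deg_c] assms deg_a deg_d deg_b deg_c by metis

lemma adj_iff_in_level:
  assumes "x \<in> deg_class V E t" "y \<in> deg_class V E t" "x \<noteq> y"
    and "class_deg E t x = class_deg E t a" "class_deg E t y = class_deg E t a"
  shows "E x y \<longleftrightarrow> E a d"
  using adj_iff_if_inner_deg_eq assms inner_deg_eq by metis

lemma obtain_nonadj_of_greater_inner_deg:
  assumes "E a d" "z \<in> deg_class V E t" "class_deg E t a < class_deg E t z"
  obtains y where "y \<in> deg_class V E t" "class_deg E t a < class_deg E t y" "\<not> E a y"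
proof (cases "E a z")
  case False
  then show thesis using that assms(2,3) by simp
next
  case True
  obtain y where y: "y \<in> private_nbrs E z a" "deg E y = t"
    using private_nbr_if_class_deg_less[of z a t] assms(2,3) deg_a by (auto simp: in_deg_class)
  then have y_class: "y \<in> deg_class V E t" "\<not> E a y" "y \<noteq> a"
    using adj_right by (auto simp: in_private_nbrs in_deg_class)
  then have "class_deg E t y \<noteq> class_deg E t a"
    using adj_iff_in_level[of a y] a_d_in_class assms(1) by auto
  moreover have "class_deg E t z \<le> class_deg E t y + 1"
    using class_deg_le_Suc assms(2) y_class(1) by (simp add: in_deg_class)
  ultimately show thesis using that y_class assms(3) by simp
qed

lemma class_nbrs_subset_if_nonadj:
  assumes "E a d" "y \<in> deg_class V E t" "y \<noteq> a" "y \<noteq> d" "\<not> E a y" "\<not> E d y"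
  shows "{w. E y w \<and> deg E w = t} \<subseteq> {w. E d w \<and> deg E w = t}"
proof (intro subsetI, rule ccontr)
  fix w assume w: "w \<in> {w. E y w \<and> deg E w = t}" "w \<notin> {w. E d w \<and> deg E w = t}"
  then have w_neq: "w \<noteq> d" "w \<noteq> a" using assms(5,6) adj_sym by blast+
  let ?F = "switch E a d y w"
  have "class_equiv V E ?F"
    by (rule class_equiv_switch)
      (use assms w w_neq deg_a deg_d in \<open>auto simp: in_deg_class\<close>)
  moreover have "?F u v \<longleftrightarrow> E u v" if "u \<notin> deg_class V E t \<or> v \<notin> deg_class V E t" for u v
    using that w assms(2) a_d_in_class adj_right w_neq
    by (auto simp: switch_def doubleton_eq_iff in_deg_class)
  ultimately have "?F a d \<longleftrightarrow> E a d"
    using adj_iff_class_equiv a_d_in_class neq(1) by blast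
  then show False
    using assms w_neq by (auto simp: switch_def doubleton_eq_iff)
qed

lemma inner_deg_not_greater_if_adj:
  assumes "E a d" "z \<in> deg_class V E t"
  shows "class_deg E t z \<le> class_deg E t a"
proof (rule ccontr)
  assume "\<not> ?thesis"
  then obtain y where y: "y \<in> deg_class V E t" "class_deg E t a < class_deg E t y" "\<not> E a y"
    using obtain_nonadj_of_greater_inner_deg[OF assms] by (metis not_le)
  then have y_neq: "y \<noteq> a" "y \<noteq> d" using inner_deg_eq by auto
  then have "\<not> E d y" using y adj_iff_a_d by (simp add: in_deg_class)
  then have "{w. E y w \<and> deg E w = t} \<subseteq> {w. E d w \<and> deg E w = t}"
    using class_nbrs_subset_if_nonadj assms(1) y y_neq by blast
  moreover have "a \<in> {w. E d w \<and> deg E w = t}" "a \<notin> {w. E y w \<and> deg E w = t}"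
    using assms(1) deg_a y(3) adj_sym by auto
  ultimately have "class_deg E t y < class_deg E t d"
    unfolding class_deg_def using finite_nbrs_Collect by (intro psubset_card_mono) auto
  then show False using y(2) inner_deg_eq by simp
qed

lemma not_adj_b_c_if_inner_deg_Suc:
  assumes "deg E y = t" "class_deg E t y = class_deg E t a + 1"
  shows "\<not> E y b" "\<not> E y c"
proof -
  have deg_y: "deg E a = deg E y" "deg E d = deg E y" using assms(1) deg_a deg_d by auto
  have neq: "class_deg E t a \<noteq> class_deg E t y" "class_deg E t d \<noteq> class_deg E t y"
    using assms(2) inner_deg_eq by auto
  obtain q r where qr: "q \<noteq> r" "traded E a y q r"
    by (rule traded_if_class_deg_neq[OF deg_y(1) neq(1)])
  obtain q' r' where qr': "q' \<noteq> r'" "traded E d y q' r'"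
    by (rule traded_if_class_deg_neq[OF deg_y(2) neq(2)])
  have "r = t" "r' = t"
    using tradedD[OF qr(2), of t] tradedD[OF qr'(2), of t] assms(2) inner_deg_eq
    by (auto simp: of_bool_def split: if_splits)
  moreover have "q = deg E b" "q' = deg E c"
    using tradedD[OF qr(2), of "deg E b"] tradedD[OF qr'(2), of "deg E b"]
      tradedD[OF qr(2), of "deg E c"] tradedD[OF qr'(2), of "deg E c"]
      tradedD[OF traded_a_d, of "deg E b"] tradedD[OF traded_a_d, of "deg E c"]
      calculation deg_b deg_c deg_b_neq_deg_c
    by (auto simp: of_bool_def split: if_splits)
  moreover have "b \<noteq> a" "c \<noteq> d" "b \<noteq> y" "c \<noteq> y"
    using deg_a deg_d deg_b deg_c assms(1) by auto
  ultimately show "\<not> E y b" "\<not> E y c"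
    using adj_iff_if_traded[OF deg_y(1) qr(2,1), of c] adj_iff_if_traded[OF deg_y(2) qr'(2,1), of b]
      adj deg_b deg_c deg_b_neq_deg_c by auto
qed

lemma inner_deg_not_greater_if_not_adj:
  assumes "\<not> E a d" "z \<in> deg_class V E t"
  shows "class_deg E t z \<le> class_deg E t a"
proof (rule ccontr)
  assume "\<not> ?thesis"
  moreover have deg_z: "deg E z = t" using assms(2) by (simp add: in_deg_class)
  ultimately have inner_z: "class_deg E t z = class_deg E t a + 1"
    using class_deg_le_Suc[of z a t] deg_a by simp
  have "E b c" using crossed_adj_iff assms(1) by blast
  have adj_both: "E x b \<and> E x c" if "E z x" "deg E x = t" for x
    using opposite_deg_eq[of z x b c] opposite_deg_eq[of z x c b] \<open>E b c\<close> that
      not_adj_b_c_if_inner_deg_Suc[OF deg_z inner_z] adj_sym[OF \<open>E b c\<close>] deg_z deg_b deg_c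
    by auto
  obtain x where x: "E z x" "deg E x = t" using inner_z class_deg_pos_iff by fastforce
  have "class_deg E t x \<le> class_deg E t a + 1" "class_deg E t z \<le> class_deg E t x + 1"
    using class_deg_le_Suc deg_a deg_z x(2) by simp_all
  then have inner_x: "class_deg E t x = class_deg E t a"
    using not_adj_b_c_if_inner_deg_Suc[OF x(2)] adj_both[OF x] inner_z by linarith
  have "class_deg E (deg E b) a \<noteq> class_deg E (deg E b) d"
    using tradedD[OF traded_a_d, of "deg E b"] deg_b_neq_deg_c by simp
  then have "\<exists>e\<in>{a, d}. class_deg E (deg E b) x \<noteq> class_deg E (deg E b) e" by auto
  then obtain e where e: "e \<in> {a, d}" "class_deg E (deg E b) x \<noteq> class_deg E (deg E b) e"
    by blast
  have "E x z \<longleftrightarrow> E e z"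
    by (rule adj_iff_if_class_deg_eq[OF _ e(2)])
      (use e(1) x inner_x inner_z inner_deg_eq deg_z deg_a deg_d adj_irrefl in auto)
  then have "E e b \<and> E e c" using adj_both[of e] e(1) x(1) deg_a deg_d adj_sym by blast
  then show False using e(1) adj by blast
qed

lemma inner_deg_not_greater:
  "z \<in> deg_class V E t \<Longrightarrow> class_deg E t z \<le> class_deg E t a"
  using inner_deg_not_greater_if_adj inner_deg_not_greater_if_not_adj by blast

lemma not_mixed: "\<not> mixed V E t"
proof -
  interpret C: traded_pair V "compl_on V E" a d c b "card V - 1 - t" by (rule traded_pair_compl)
  have t: "t < card V" using deg_less_card[OF in_V(1)] deg_a by simp
  have "class_deg E t z = class_deg E t a" if "z \<in> deg_class V E t" for z
  proof (rule antisym[OF inner_deg_not_greater[OF that]])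
    have "class_deg (compl_on V E) (card V - 1 - t) z \<le> class_deg (compl_on V E) (card V - 1 - t) a"
      using C.inner_deg_not_greater that by (simp only: deg_class_compl[OF t])
    then show "class_deg E t a \<le> class_deg E t z"
      using class_deg_compl[OF t, of a] class_deg_compl[OF t, of z] that in_V(1) deg_a
      by (simp add: in_deg_class)
  qed
  then have "E x y \<longleftrightarrow> E a d" if "x \<in> deg_class V E t" "y \<in> deg_class V E t" "x \<noteq> y" for x y
    using adj_iff_in_level that by blast
  then show ?thesis using adj_irrefl unfolding mixed_def is_clique_def is_stable_def by metis
qed

end

context unigraph_on
begin

lemma class_deg_eq_if_inner_deg_eq:
  assumes "mixed V E t" "a \<in> deg_class V E t" "d \<in> deg_class V E t"
    and "class_deg E t a = class_deg E t d"
  shows "class_deg E s a = class_deg E s d"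
proof (rule ccontr)
  have deg: "deg E a = t" "deg E d = t" using assms(2,3) by (simp_all add: in_deg_class)
  assume "\<not> ?thesis"
  then obtain b c where bc: "b \<in> private_nbrs E a d" "c \<in> private_nbrs E d a" "deg E b \<noteq> deg E c"
    using private_nbrs_if_class_deg_neq deg by metis
  then have "traded E a d (deg E b) (deg E c)" using traded_private_nbrs deg by metis
  then have "deg E b \<noteq> t" "deg E c \<noteq> t"
    using tradedD[of E a d "deg E b" "deg E c" t] bc(3) assms(4)
    by (auto simp: of_bool_def split: if_splits)
  then interpret traded_pair V E a d b c t
    using bc deg by unfold_locales
  show False using not_mixed assms(1) by blast
qed

lemma adj_uniform_if_class_deg_uniform:
  assumes "mixed V E t" "a \<in> deg_class V E t" "b \<in> deg_class V E t" "deg E y \<noteq> t" "E y a"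
    and uniform: "\<And>u v s. u \<in> deg_class V E t \<Longrightarrow> v \<in> deg_class V E t \<Longrightarrow>
      class_deg E s u = class_deg E s v"
  shows "E y b"
proof (rule ccontr)
  assume "\<not> E y b"
  have deg: "deg E a = t" "deg E b = t" using assms(2,3) by (simp_all add: in_deg_class)
  have y: "y \<in> private_nbrs E a b"
    using assms(3-5) \<open>\<not> E y b\<close> adj_commute by (auto simp: in_private_nbrs in_deg_class)
  obtain y' where "y' \<in> private_nbrs E b a" "deg E y' = deg E y"
    by (rule private_nbr_exchange[of b a y]) (use deg uniform[OF assms(3,2)] y in auto)
  then interpret crossed_pair V E a b y y' t
    using deg y assms(4) by unfold_locales auto
  have "E u v \<longleftrightarrow> E a b" if "u \<in> deg_class V E t" "v \<in> deg_class V E t" "u \<noteq> v" for u v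
    using adj_iff_if_inner_deg_eq uniform that a_d_in_class by blast
  then show False
    using assms(1) adj_irrefl unfolding mixed_def is_clique_def is_stable_def by metis
qed

end

subsection \<open>Mixed classes with two profiles\<close>

locale two_level_class = unigraph_on +
  fixes t s :: nat and H L
  assumes t_neq_s: "t \<noteq> s"
    and class_eq: "deg_class V E t = H \<union> L"
    and H_nonempty: "H \<noteq> {}" and L_nonempty: "L \<noteq> {}"
    and traded: "h \<in> H \<Longrightarrow> l \<in> L \<Longrightarrow> traded E h l t s"
begin

lemma in_class:
  assumes "v \<in> H \<or> v \<in> L"
  shows "v \<in> V" "deg E v = t" "v \<in> deg_class V E t"
  using assms class_eq by (auto simp: in_deg_class)

lemma inner_deg_high: "h \<in> H \<Longrightarrow> l \<in> L \<Longrightarrow> class_deg E t h = class_deg E t l + 1"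
  using tradedD[OF traded, of h l t] t_neq_s by simp

lemma class_deg_s_low: "h \<in> H \<Longrightarrow> l \<in> L \<Longrightarrow> class_deg E s l = class_deg E s h + 1"
  using tradedD[OF traded, of h l s] t_neq_s by simp

lemma disjoint: "h \<in> H \<Longrightarrow> h \<notin> L"
  using inner_deg_high by force

lemma class_deg_eq_high:
  assumes "h \<in> H" "h' \<in> H"
  shows "class_deg E x h = class_deg E x h'"
proof -
  obtain l where "l \<in> L" using L_nonempty by blast
  then show ?thesis
    using tradedD[OF traded[OF assms(1)], of l x] tradedD[OF traded[OF assms(2)], of l x] by simp
qed

lemma class_deg_eq_low:
  assumes "l \<in> L" "l' \<in> L"
  shows "class_deg E x l = class_deg E x l'"
proof -
  obtain h where "h \<in> H" using H_nonempty by blast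
  then show ?thesis
    using tradedD[OF traded[OF _ assms(1)], of h x] tradedD[OF traded[OF _ assms(2)], of h x]
    by simp
qed

lemma obtain_s_nbr:
  assumes "l \<in> L"
  obtains y where "E l y" "deg E y = s"
proof -
  obtain h where "h \<in> H" using H_nonempty by blast
  then have "class_deg E s l > 0" using class_deg_s_low assms by simp
  then show thesis using that class_deg_pos_iff by blast
qed

lemma obtain_high_nbr:
  assumes "h \<in> H"
  obtains x where "x \<in> deg_class V E t" "E h x"
proof -
  obtain l where "l \<in> L" using L_nonempty by blast
  then have "class_deg E t h > 0" using inner_deg_high assms by simp
  then show thesis using that class_deg_pos_iff adj_right by (auto simp: in_deg_class)
qed

lemma obtain_low_nonnbr:
  assumes "l \<in> L"
  obtains x where "x \<in> deg_class V E t" "x \<noteq> l" "\<not> E l x"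
proof -
  obtain h where h: "h \<in> H" using H_nonempty by blast
  have "\<exists>x\<in>deg_class V E t. x \<noteq> l \<and> \<not> E l x"
  proof (rule ccontr)
    assume "\<not> ?thesis"
    then have "{w \<in> deg_class V E t. E l w} = deg_class V E t - {l}" using adj_irrefl by auto
    then have "class_deg E t l = card (deg_class V E t) - 1"
      using in_class(3) assms finite_deg_class by (simp add: class_deg_eq_card_deg_class)
    moreover have "class_deg E t h < card (deg_class V E t)"
      unfolding class_deg_eq_card_deg_class
      using finite_deg_class in_class(3) h adj_irrefl by (intro psubset_card_mono) auto
    ultimately show False using inner_deg_high[OF h assms] by simp
  qed
  with that show thesis by blast
qed

lemma two_level_class_equiv:
  assumes "class_equiv V E F"
  shows "two_level_class V F t s H L"
proof -
  interpret F: unigraph_on V F by (rule unigraph_on_class_equiv[OF assms])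
  show ?thesis
    using t_neq_s class_eq H_nonempty L_nonempty traded
    by unfold_locales (simp_all add: class_equivD[OF assms] traded_def)
qed

lemma degrees_less_card: "t < card V" "s < card V"
proof -
  obtain l where l: "l \<in> L" using L_nonempty by blast
  then show "t < card V" using in_class deg_less_card by metis
  show "s < card V" using obtain_s_nbr[OF l] adj_right deg_less_card by metis
qed

lemma two_level_class_compl:
  "two_level_class V (compl_on V E) (card V - 1 - t) (card V - 1 - s) L H"
proof -
  interpret C: unigraph_on V "compl_on V E" by (rule unigraph_on_compl)
  show ?thesis
  proof
    show "card V - 1 - t \<noteq> card V - 1 - s" using t_neq_s degrees_less_card by linarith
    show "deg_class V (compl_on V E) (card V - 1 - t) = L \<union> H"
      using class_eq degrees_less_card by (simp only: deg_class_compl Un_commute)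
    show "traded (compl_on V E) h l (card V - 1 - t) (card V - 1 - s)" if "h \<in> L" "l \<in> H" for h l
      using traded_compl[OF traded[OF that(2,1)]] in_class that degrees_less_card by simp
  qed (rule L_nonempty, rule H_nonempty)
qed

lemma crossed_pair_high_low:
  assumes "h \<in> H" "l \<in> L" "y \<in> private_nbrs E h l" "y' \<in> private_nbrs E l h"
    and "deg E y = s" "deg E y' = s"
  shows "crossed_pair V E h l y y' t"
  using in_class assms t_neq_s by unfold_locales auto

lemma two_private_nbrs_low:
  assumes "h \<in> H" "l \<in> L" "y \<in> private_nbrs E h l" "deg E y = s"
  obtains y1 y2 where "y1 \<in> private_nbrs E l h" "y2 \<in> private_nbrs E l h" "y1 \<noteq> y2"
    "deg E y1 = s" "deg E y2 = s"
proof -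
  let ?P = "{w \<in> private_nbrs E l h. deg E w = s}" and ?Q = "{w \<in> private_nbrs E h l. deg E w = s}"
  have "card ?Q > 0" using assms(3,4) finite_private_nbrs by (auto simp: card_gt_0_iff)
  then have "card ?P \<ge> 2"
    using card_private_nbrs_class[of h l s] class_deg_s_low in_class assms(1,2) by simp
  then have "\<not> card ?P \<le> Suc 0" by simp
  moreover have "finite ?P" using finite_private_nbrs by simp
  ultimately obtain y1 y2 where "y1 \<in> ?P" "y2 \<in> ?P" "y1 \<noteq> y2"
    using card_le_Suc0_iff_eq by blast
  then show thesis using that by blast
qed

lemma adj_private_nbrs_low:
  assumes h: "h \<in> H" and l: "l \<in> L" and y: "y \<in> private_nbrs E h l" "deg E y = s"
    and nonadj: "\<not> E h l"
    and y12: "y1 \<in> private_nbrs E l h" "y2 \<in> private_nbrs E l h" "y1 \<noteq> y2"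
      "deg E y1 = s" "deg E y2 = s"
  shows "E y1 y2"
proof -
  have distinct: "h \<noteq> l" "h \<noteq> y" "h \<noteq> y1" "h \<noteq> y2" "l \<noteq> y" "l \<noteq> y1" "l \<noteq> y2" "y \<noteq> y1" "y \<noteq> y2"
    using h l in_class disjoint t_neq_s y y12 by (auto simp: in_private_nbrs)
  let ?F = "switch E h y y1 l"
  have F: "class_equiv V E ?F"
    by (rule class_equiv_switch)
      (use y y12 in_class h l adj_commute[of y l] adj_commute[of y1 l] distinct
        in \<open>auto simp: in_private_nbrs\<close>)
  interpret F: two_level_class V ?F t s H L by (rule two_level_class_equiv[OF F])
  interpret F: crossed_pair V ?F h l y1 y2 t
    by (rule F.crossed_pair_high_low[OF h l])
      (use y12 distinct in
        \<open>auto simp: class_equivD[OF F] in_private_nbrs switch_def doubleton_eq_iff\<close>)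
  have "?F h l \<longleftrightarrow> E h l" "?F y1 y2 \<longleftrightarrow> E y1 y2"
    using distinct y12(3) by (auto simp: switch_def doubleton_eq_iff)
  then show ?thesis using F.crossed_adj_iff nonadj by blast
qed

lemma s_edge_meets_high_nbrs:
  assumes h: "h \<in> H" and z: "z \<in> H" "E h z" and y: "E y1 y2" "deg E y1 = s" "deg E y2 = s"
  shows "E h y1 \<or> E h y2"
proof (rule ccontr)
  assume contrary: "\<not> ?thesis"
  have deg: "deg E h = t" "deg E z = t" using in_class(2) h z by blast+
  then have neq: "h \<noteq> y1" "h \<noteq> y2" "z \<noteq> y1" "z \<noteq> y2" using y t_neq_s by auto
  have z_adj: "E z y1" "E z y2"
    using opposite_deg_eq[of h z y2 y1] opposite_deg_eq[of h z y1 y2] z(2) y adj_sym[OF y(1)]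
      contrary neq deg t_neq_s by auto
  then have "y1 \<in> private_nbrs E z h" using contrary neq by (auto simp: in_private_nbrs)
  then obtain x where "x \<in> private_nbrs E h z" "deg E x = deg E y1"
    using private_nbr_exchange[of h z y1] deg class_deg_eq_high[OF z(1) h] by (metis order_refl)
  then have x: "E h x" "\<not> E z x" "x \<noteq> z" "deg E x = s" using y(2) by (auto simp: in_private_nbrs)
  have distinct: "x \<noteq> y1" "x \<noteq> y2" "x \<noteq> h" "z \<noteq> h"
    using x contrary deg t_neq_s z(2) adj_irrefl by auto
  let ?F = "switch E h x y1 z"
  have F: "class_equiv V E ?F"
    by (rule class_equiv_switch)
      (use x y z_adj contrary neq deg in \<open>auto simp: adj_commute[of y1 z] adj_commute[of x z]\<close>)
  interpret F: unigraph_on V ?F by (rule unigraph_on_class_equiv[OF F])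
  have "y1 \<noteq> y2" using y(1) adj_irrefl by blast
  then have "?F h z" "?F y2 y1" "\<not> ?F h y2" "\<not> ?F z y1"
    using z(2) adj_sym[OF y(1)] contrary neq distinct x(3)
    by (auto simp: switch_def doubleton_eq_iff)
  then show False
    using F.opposite_deg_eq[of h z y2 y1] neq deg y t_neq_s by (simp add: class_equivD(3)[OF F])
qed

lemma s_nbr_high_imp_low_if_not_adj:
  assumes h: "h \<in> H" and l: "l \<in> L" and y: "E h y" "deg E y = s" and nonadj: "\<not> E h l"
  shows "E l y"
proof (rule ccontr)
  assume "\<not> E l y"
  then have y_private: "y \<in> private_nbrs E h l"
    using y l in_class t_neq_s by (auto simp: in_private_nbrs)
  obtain y1 y2 where y12: "y1 \<in> private_nbrs E l h" "y2 \<in> private_nbrs E l h" "y1 \<noteq> y2"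
    "deg E y1 = s" "deg E y2 = s"
    by (rule two_private_nbrs_low[OF h l y_private y(2)])
  interpret hl: crossed_pair V E h l y y1 t
    by (rule crossed_pair_high_low[OF h l y_private y12(1) y(2) y12(4)])
  obtain z where z: "z \<in> deg_class V E t" "E h z" by (rule obtain_high_nbr[OF h])
  have "E h v \<longleftrightarrow> E h l" if "v \<in> L" for v
    using hl.adj_iff_if_inner_deg_eq[of h v] class_deg_eq_low[OF that l] that h disjoint in_class(3)
    by metis
  then have "z \<in> H" using z nonadj class_eq by blast
  then have "E h y1 \<or> E h y2"
    using s_edge_meets_high_nbrs h z(2) adj_private_nbrs_low[OF h l y_private y(2) nonadj y12]
      y12(4,5) by blast
  then show False using y12 by (auto simp: in_private_nbrs)
qed

lemma s_nbr_high_imp_low: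
  assumes "h \<in> H" "l \<in> L" "E h y" "deg E y = s"
  shows "E l y"
proof (cases "E h l")
  case False
  then show ?thesis using s_nbr_high_imp_low_if_not_adj assms by blast
next
  case True
  interpret C: two_level_class V "compl_on V E" "card V - 1 - t" "card V - 1 - s" L H
    by (rule two_level_class_compl)
  have y: "y \<in> V" "y \<noteq> l" using assms adj_right in_class t_neq_s by auto
  have "\<not> compl_on V E l h" using True adj_sym by (auto simp: compl_on_def)
  moreover have "deg (compl_on V E) y = card V - 1 - s"
    using deg_compl[OF y(1)] assms(4) by simp
  ultimately have "compl_on V E l y \<Longrightarrow> compl_on V E h y"
    using C.s_nbr_high_imp_low_if_not_adj assms(1,2) by blast
  then show ?thesis using assms y in_class by (auto simp: compl_on_def)
qed

lemma high_anticomplete_or_low_complete: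
  "(\<forall>h\<in>H. \<forall>y\<in>deg_class V E s. \<not> E h y) \<or> (\<forall>l\<in>L. \<forall>y\<in>deg_class V E s. E l y)"
proof (rule ccontr)
  assume "\<not> ?thesis"
  then obtain h y l z where h: "h \<in> H" "y \<in> deg_class V E s" "E h y"
    and l: "l \<in> L" "z \<in> deg_class V E s" "\<not> E l z" by blast
  then have deg_yz: "deg E y = s" "deg E z = s" by (simp_all add: in_deg_class)
  have "finite L" using finite_deg_class[of t] class_eq by simp
  have "insert h L \<subseteq> {v \<in> deg_class V E t. E y v}"
    using s_nbr_high_imp_low[OF h(1) _ h(3) deg_yz(1)] in_class h adj_sym by blast
  then have "card (insert h L) \<le> class_deg E t y"
    unfolding class_deg_eq_card_deg_class using finite_deg_class by (intro card_mono) auto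
  moreover have "{v \<in> deg_class V E t. E z v} \<subseteq> L - {l}"
    using s_nbr_high_imp_low[OF _ l(1) _ deg_yz(2)] class_eq l(3) adj_sym by blast
  then have "class_deg E t z \<le> card (L - {l})"
    unfolding class_deg_eq_card_deg_class using \<open>finite L\<close> by (intro card_mono) auto
  ultimately have "card L + 1 \<le> class_deg E t y" "class_deg E t z + 1 \<le> card L"
    using card_Suc_Diff1[OF \<open>finite L\<close> l(1)] \<open>finite L\<close> disjoint h(1) by auto
  then show False using class_deg_le_Suc[of y z t] deg_yz by simp
qed

lemma adj_class_uniform:
  assumes "u \<in> deg_class V E t" "v \<in> deg_class V E t" "deg E x \<noteq> t" "deg E x \<noteq> s"
  shows "E u x \<longleftrightarrow> E v x"
proof -
  have "E h x \<longleftrightarrow> E l x" if "h \<in> H" "l \<in> L" for h l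
    using adj_iff_if_traded[OF _ traded[OF that] t_neq_s assms(3,4)] in_class that assms(3) by metis
  then show ?thesis using assms(1,2) class_eq H_nonempty L_nonempty by blast
qed

end

locale sparse_two_level_class = two_level_class +
  assumes high_anticomplete: "h \<in> H \<Longrightarrow> deg E y = s \<Longrightarrow> \<not> E h y"
begin

lemma s_nbr_unique:
  assumes "x \<in> deg_class V E t" "E x y" "E x y'" "deg E y = s" "deg E y' = s"
  shows "y = y'"
proof -
  obtain h where h: "h \<in> H" using H_nonempty by blast
  have "x \<in> L" using assms high_anticomplete class_eq by blast
  moreover have "class_deg E s h = 0" using class_deg_pos_iff high_anticomplete[OF h] by blast
  ultimately have "card {w. E x w \<and> deg E w = s} = 1"
    using class_deg_s_low[OF h] by (simp add: class_deg_def)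
  then obtain w where w: "{w. E x w \<and> deg E w = s} = {w}" by (rule card_1_singletonE)
  have "y \<in> {w. E x w \<and> deg E w = s}" "y' \<in> {w. E x w \<and> deg E w = s}"
    using assms by simp_all
  then show ?thesis unfolding w by simp
qed

lemma s_class_stable:
  assumes "deg E c = s" "deg E e = s"
  shows "\<not> E c e"
proof
  assume "E c e"
  obtain h where h: "h \<in> H" using H_nonempty by blast
  obtain x where x: "x \<in> deg_class V E t" "E h x" by (rule obtain_high_nbr[OF h])
  have "\<not> E x c \<or> \<not> E x e"
    using s_nbr_unique[OF x(1) _ _ assms] \<open>E c e\<close> adj_irrefl by blast
  moreover have "\<not> E h c" "\<not> E h e" using high_anticomplete[OF h] assms by auto
  moreover have "deg E h = t" "deg E x = t" using in_class h x(1) by (simp_all add: in_deg_class)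
  moreover from this have "h \<noteq> c" "h \<noteq> e" "x \<noteq> c" "x \<noteq> e" using assms t_neq_s by auto
  ultimately show False
    using opposite_deg_eq[of h x c e] opposite_deg_eq[of h x e c] x(2) \<open>E c e\<close> adj_sym[OF \<open>E c e\<close>]
      assms t_neq_s by auto
qed

end

text \<open>
  Two vertices of degree \<open>s\<close> with neighbours of degree \<open>t\<close> would force \<open>L\<close> to be a clique in every
  realization reached by switches inside the class, and a suitable switch breaks it.
\<close>

locale two_attached = sparse_two_level_class +
  fixes c e a b
  assumes c_neq_e: "c \<noteq> e" and deg_c_e: "deg E c = s" "deg E e = s"
    and a_b: "a \<in> deg_class V E t" "E a c" "b \<in> deg_class V E t" "E b e"
begin

lemma a_b_low: "a \<in> L" "b \<in> L"
  using a_b class_eq high_anticomplete deg_c_e by blast+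

lemma a_neq_b: "a \<noteq> b"
  using s_nbr_unique a_b deg_c_e c_neq_e by blast

lemma deg_a_b: "deg E a = t" "deg E b = t"
  using a_b by (simp_all add: in_deg_class)

lemma crossed_pair_a_b: "crossed_pair V E a b c e t"
  using a_b deg_a_b deg_c_e c_neq_e t_neq_s s_nbr_unique
  by unfold_locales (auto simp: in_private_nbrs)

lemma low_clique:
  assumes "class_equiv V E F" "\<And>u v. u \<notin> deg_class V E t \<or> v \<notin> deg_class V E t \<Longrightarrow> F u v \<longleftrightarrow> E u v"
    and "x \<in> L" "y \<in> L" "x \<noteq> y"
  shows "F x y"
proof -
  interpret ab: crossed_pair V E a b c e t by (rule crossed_pair_a_b)
  have "F x y \<longleftrightarrow> E a b"
    using ab.adj_iff_class_equiv[OF assms(1,2)] class_deg_eq_low a_b_low assms(3-5) in_class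
    by metis
  then show ?thesis using ab.crossed_adj_iff s_class_stable deg_c_e by blast
qed

lemma low_adj:
  assumes "x \<in> L" "y \<in> L" "x \<noteq> y"
  shows "E x y"
proof (rule low_clique[of E])
  show "class_equiv V E E"
    using simple_graph_axioms by (simp add: class_equiv_def realizes_def)
qed (use assms in auto)

lemma adj_a_or_adj_b:
  assumes zx: "z \<in> deg_class V E t" "x \<in> deg_class V E t" "E z x" "z \<noteq> a" "x \<noteq> b"
  shows "E a z \<or> E b x"
proof (rule ccontr)
  assume contrary: "\<not> ?thesis"
  have ab: "E a b" using low_adj a_b_low a_neq_b by blast
  have deg_zx: "deg E z = t" "deg E x = t" using zx by (simp_all add: in_deg_class)
  let ?F = "switch E a b z x"
  have F: "class_equiv V E ?F"
    by (rule class_equiv_switch) (use ab zx contrary deg_zx deg_a_b in auto)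
  have "?F a b"
    by (rule low_clique[OF F _ a_b_low a_neq_b])
      (use a_b zx in \<open>auto simp: switch_def doubleton_eq_iff\<close>)
  moreover have "z \<noteq> b" "x \<noteq> a" using contrary ab adj_sym by auto
  ultimately show False using zx(4,5) a_neq_b by (auto simp: switch_def doubleton_eq_iff)
qed

lemma two_attached_impossible: False
proof -
  obtain z where z: "z \<in> deg_class V E t" "z \<noteq> a" "\<not> E a z"
    by (rule obtain_low_nonnbr[OF a_b_low(1)])
  then have "z \<in> H" using low_adj[OF a_b_low(1)] class_eq by blast
  then have "z \<noteq> b" using disjoint a_b_low by blast
  have "class_deg E t a < class_deg E t z" using inner_deg_high[OF \<open>z \<in> H\<close> a_b_low(1)] by simp
  then obtain x where x: "x \<in> private_nbrs E z a" "deg E x = t"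
    using private_nbr_if_class_deg_less[of z a t] deg_a_b z(1) by (auto simp: in_deg_class)
  have "E b z"
    using adj_a_or_adj_b[of x z] x adj_right adj_sym z(1) \<open>z \<noteq> b\<close>
    by (auto simp: in_private_nbrs in_deg_class)
  have "{v \<in> deg_class V E t. E z v} \<subseteq> insert b ({v \<in> deg_class V E t. E b v} - {a, z})"
    using adj_a_or_adj_b[OF z(1)] z adj_irrefl adj_sym by blast
  then have "class_deg E t z \<le> card (insert b ({v \<in> deg_class V E t. E b v} - {a, z}))"
    unfolding class_deg_eq_card_deg_class using finite_deg_class by (intro card_mono) auto
  also have "\<dots> \<le> card ({v \<in> deg_class V E t. E b v} - {a, z}) + 1"
    using finite_deg_class by (simp add: card_insert_if)
  also have "card ({v \<in> deg_class V E t. E b v} - {a, z}) = class_deg E t b - 2"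
    unfolding class_deg_eq_card_deg_class
    using finite_deg_class z a_b(1) \<open>E b z\<close> low_adj[OF a_b_low(2,1)] a_neq_b
    by (subst card_Diff_subset) auto
  finally have "class_deg E t z \<le> class_deg E t b - 2 + 1" .
  moreover have "class_deg E t b > 0"
    using class_deg_pos_iff deg_a_b low_adj[OF a_b_low(2,1)] a_neq_b by blast
  ultimately show False using inner_deg_high[OF \<open>z \<in> H\<close> a_b_low(2)] by simp
qed

end

context sparse_two_level_class
begin

lemma at_most_one_attached:
  assumes "deg E c = s" "deg E e = s" "a \<in> deg_class V E t" "E a c" "b \<in> deg_class V E t" "E b e"
  shows "c = e"
proof (rule ccontr)
  assume "c \<noteq> e"
  then interpret two_attached V E t s H L c e a b using assms by unfold_locales
  show False by (rule two_attached_impossible)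
qed

lemma obtain_private_nbr_of_unattached:
  assumes "deg E z = s" "deg E y = s" "class_deg E t z = 0" "class_deg E t y > 0"
  obtains x where "x \<in> private_nbrs E z y" "deg E x \<noteq> t" "deg E x \<noteq> s"
proof -
  obtain q r where qr: "q \<noteq> r" "traded E z y q r"
    using traded_if_class_deg_neq[of z y t] assms by auto
  then have "r = t"
    using tradedD[OF qr(2), of t] assms(3,4) by (auto simp: of_bool_def split: if_splits)
  obtain x where x: "x \<in> private_nbrs E z y" "deg E x = q"
    using private_nbrs_if_traded[OF _ qr(2,1)] assms(1,2) by metis
  then have "deg E x \<noteq> s"
    using s_class_stable[OF assms(1), of x] by (auto simp: in_private_nbrs)
  then show thesis using that x qr(1) \<open>r = t\<close> by blast
qed

lemma s_class_subsingleton: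
  assumes y: "E d y" "d \<in> L" "deg E y = s" and z: "deg E z = s"
  shows "z = y"
proof (rule ccontr)
  assume "z \<noteq> y"
  have d: "d \<in> deg_class V E t" "deg E d = t" using in_class y(2) by auto
  have unattached: "\<not> E v z" if "v \<in> deg_class V E t" for v
    using at_most_one_attached[OF y(3) z d(1) y(1) that] \<open>z \<noteq> y\<close> by blast
  have "\<not> (E z v \<and> deg E v = t)" for v
    using unattached adj_sym adj_right in_deg_class by metis
  then have "class_deg E t z = 0" using class_deg_pos_iff by (metis gr0I)
  moreover have "class_deg E t y > 0" using class_deg_pos_iff adj_sym y(1) d(2) by blast
  ultimately obtain x where "x \<in> private_nbrs E z y" and deg_x: "deg E x \<noteq> t" "deg E x \<noteq> s"
    by (rule obtain_private_nbr_of_unattached[OF z y(3)])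
  then have x: "E z x" "\<not> E y x" "x \<noteq> y" by (simp_all add: in_private_nbrs)
  show False
  proof (cases "E d x")
    case True
    obtain b where b: "b \<in> deg_class V E t" "b \<noteq> d" "\<not> E d b" by (rule obtain_low_nonnbr[OF y(2)])
    have "E x b" using adj_class_uniform[OF b(1) d(1) deg_x] True adj_sym by blast
    then show False
      using opposite_deg_eq[OF adj_sym[OF y(1)] _ x(2) b(3)] x(3) deg_x b y(3) d(2) t_neq_s
      by (auto simp: in_deg_class)
  next
    case False
    obtain h where h: "h \<in> H" using H_nonempty by blast
    obtain v where v: "v \<in> deg_class V E t" "E h v" by (rule obtain_high_nbr[OF h])
    have "\<not> E v x" using adj_class_uniform[OF v(1) d(1) deg_x] False by simp
    moreover have "deg E h = t" "deg E v = t" using in_class h v(1) by (simp_all add: in_deg_class)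
    ultimately show False
      using opposite_deg_eq[OF v(2) x(1)] unattached[OF in_class(3), of h] h deg_x z t_neq_s
      by auto
  qed
qed

lemma sparse_s_class_singleton: "\<exists>y. deg_class V E s = {y}"
proof -
  obtain l where l: "l \<in> L" using L_nonempty by blast
  obtain y where y: "E l y" "deg E y = s" by (rule obtain_s_nbr[OF l])
  then have "y \<in> deg_class V E s" using adj_right by (simp add: in_deg_class)
  moreover have "z = y" if "z \<in> deg_class V E s" for z
    using s_class_subsingleton[OF y(1) l y(2)] that by (simp add: in_deg_class)
  ultimately show ?thesis by blast
qed

end

definition module_of :: "'a set \<Rightarrow> ('a \<Rightarrow> 'a \<Rightarrow> bool) \<Rightarrow> 'a set \<Rightarrow> bool" where
  "module_of V E C \<longleftrightarrow> (\<forall>x\<in>V - C. (\<forall>v\<in>C. E x v) \<or> (\<forall>v\<in>C. \<not> E x v))"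

definition near_regular_core ::
    "'a set \<Rightarrow> ('a \<Rightarrow> 'a \<Rightarrow> bool) \<Rightarrow> 'a set \<Rightarrow> 'a \<Rightarrow> nat \<Rightarrow> bool" where
  "near_regular_core V E C y k \<longleftrightarrow> C \<subseteq> V \<and> y \<in> C \<and>
     (\<forall>v\<in>C. \<forall>x\<in>V. deg E x = deg E v \<longrightarrow> x \<in> C) \<and>
     (\<forall>v\<in>C. v \<noteq> y \<longrightarrow> deg (restrict_on C E) v = k) \<and> module_of V E C"

context two_level_class
begin

lemma s_class_singleton: "\<exists>y. deg_class V E s = {y}"
  using high_anticomplete_or_low_complete
proof
  assume "\<forall>h\<in>H. \<forall>y\<in>deg_class V E s. \<not> E h y"
  then interpret sparse_two_level_class V E t s H L
    by unfold_locales (metis adj_right in_deg_class)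
  show ?thesis by (rule sparse_s_class_singleton)
next
  assume complete: "\<forall>l\<in>L. \<forall>y\<in>deg_class V E s. E l y"
  let ?E = "compl_on V E" and ?s = "card V - 1 - s"
  interpret C: two_level_class V ?E "card V - 1 - t" ?s L H by (rule two_level_class_compl)
  have s_class: "deg_class V ?E ?s = deg_class V E s"
    using deg_class_compl degrees_less_card by blast
  have "\<not> ?E l y" if "l \<in> L" "deg ?E y = ?s" for l y
    using complete that s_class by (auto simp: compl_on_def deg_class_def)
  then interpret C: sparse_two_level_class V ?E "card V - 1 - t" ?s L H by unfold_locales
  show ?thesis using C.sparse_s_class_singleton s_class by simp
qed

lemma obtain_s_vertex:
  obtains y where "deg_class V E s = {y}" "\<And>h. h \<in> H \<Longrightarrow> \<not> E h y" "\<And>l. l \<in> L \<Longrightarrow> E l y"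
proof -
  obtain y where y: "deg_class V E s = {y}" using s_class_singleton by blast
  then have count: "class_deg E s v = of_bool (E v y)" for v
    by (simp add: class_deg_eq_card_deg_class Collect_conv_if)
  have "\<not> E h y \<and> E l y" if "h \<in> H" "l \<in> L" for h l
    using class_deg_s_low[OF that] count[of h] count[of l]
    by (simp add: of_bool_def split: if_splits)
  with y that show thesis using H_nonempty L_nonempty by blast
qed

lemma adj_s_vertex_iff:
  assumes y: "deg E y = s" "\<And>h. h \<in> H \<Longrightarrow> \<not> E h y" "\<And>l. l \<in> L \<Longrightarrow> E l y"
    and l: "l \<in> L" and x: "deg E x \<noteq> t" "deg E x \<noteq> s"
  shows "E x y \<longleftrightarrow> E x l"
proof
  have uniform: "E x v \<longleftrightarrow> E x l" if "v \<in> deg_class V E t" for v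
    using adj_class_uniform[OF that in_class(3) x] l adj_commute by metis
  have deg_l: "deg E l = t" using in_class(2) l by blast
  show "E x y" if "E x l"
  proof (rule ccontr)
    obtain b where b: "b \<in> deg_class V E t" "b \<noteq> l" "\<not> E l b" by (rule obtain_low_nonnbr[OF l])
    then have "E x b" "deg E b = t" using uniform \<open>E x l\<close> by (simp_all add: in_deg_class)
    moreover assume "\<not> E x y"
    ultimately show False
      using opposite_deg_eq[OF \<open>E x b\<close> adj_sym[OF y(3)[OF l]]] b adj_sym[of b l] x y(1) deg_l
        t_neq_s by auto
  qed
  show "E x l" if "E x y"
  proof (rule ccontr)
    obtain h where h: "h \<in> H" using H_nonempty by blast
    obtain b where b: "b \<in> deg_class V E t" "E h b" by (rule obtain_high_nbr[OF h])
    have deg: "deg E b = t" "deg E h = t" using b(1) in_class(2) h by (auto simp: in_deg_class)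
    assume "\<not> E x l"
    then have "\<not> E b x" using uniform b(1) adj_sym by blast
    moreover have "h \<noteq> y" "b \<noteq> x" using x y(1) deg t_neq_s by auto
    ultimately show False
      using opposite_deg_eq[OF b(2) adj_sym[OF \<open>E x y\<close>] y(2)[OF h]] deg x y(1) t_neq_s by auto
  qed
qed

lemma module_of_insert_class:
  assumes y: "deg_class V E s = {y}" "\<And>h. h \<in> H \<Longrightarrow> \<not> E h y" "\<And>l. l \<in> L \<Longrightarrow> E l y"
  shows "module_of V E (insert y (deg_class V E t))"
  unfolding module_of_def
proof
  obtain l where l: "l \<in> L" using L_nonempty by blast
  have "y \<in> deg_class V E s" using y(1) by simp
  then have deg_y: "deg E y = s" by (simp add: in_deg_class)
  fix x assume x: "x \<in> V - insert y (deg_class V E t)"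
  then have "x \<in> V" "x \<notin> deg_class V E t" "x \<notin> deg_class V E s" using y(1) by blast+
  then have deg_x: "deg E x \<noteq> t" "deg E x \<noteq> s" by (auto simp: in_deg_class)
  have "E x v \<longleftrightarrow> E x l" if "v \<in> deg_class V E t" for v
    using adj_class_uniform[OF that in_class(3) deg_x] l adj_commute by metis
  moreover have "E x y \<longleftrightarrow> E x l" by (rule adj_s_vertex_iff[OF deg_y y(2,3) l deg_x])
  ultimately show "(\<forall>v\<in>insert y (deg_class V E t). E x v) \<or>
      (\<forall>v\<in>insert y (deg_class V E t). \<not> E x v)"
    by blast
qed

lemma deg_restrict_on_insert_class:
  assumes y: "deg_class V E s = {y}" "\<And>h. h \<in> H \<Longrightarrow> \<not> E h y" "\<And>l. l \<in> L \<Longrightarrow> E l y"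
    and "h \<in> H" "v \<in> deg_class V E t"
  shows "deg (restrict_on (insert y (deg_class V E t)) E) v = class_deg E t h"
proof -
  let ?M = "deg_class V E t"
  have "y \<notin> ?M" using y(1) t_neq_s by (auto simp: in_deg_class)
  have "deg (restrict_on (insert y ?M) E) v = card ({w \<in> ?M. E v w} \<union> (if E v y then {y} else {}))"
    unfolding deg_def using assms(5) by (intro arg_cong[of _ _ card]) (auto simp: restrict_on_def)
  also have "\<dots> = class_deg E t v + of_bool (E v y)"
    unfolding class_deg_eq_card_deg_class using \<open>y \<notin> ?M\<close> finite_deg_class[of t]
    by (cases "E v y") auto
  also have "\<dots> = class_deg E t h"
  proof (cases "v \<in> H")
    case True
    then show ?thesis using y(2) class_deg_eq_high[OF True assms(4)] by simp
  next
    case False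
    then have "v \<in> L" using assms(5) class_eq by blast
    then show ?thesis using y(3) inner_deg_high[OF assms(4)] by simp
  qed
  finally show ?thesis .
qed

lemma obtain_near_regular_core_insert_class:
  obtains y k where "near_regular_core V E (insert y (deg_class V E t)) y k"
proof -
  obtain y where y: "deg_class V E s = {y}" "\<And>h. h \<in> H \<Longrightarrow> \<not> E h y" "\<And>l. l \<in> L \<Longrightarrow> E l y"
    by (rule obtain_s_vertex) blast
  obtain h where h: "h \<in> H" using H_nonempty by blast
  let ?C = "insert y (deg_class V E t)"
  have "y \<in> deg_class V E s" using y(1) by simp
  then have y_V: "y \<in> V" "deg E y = s" by (simp_all only: in_deg_class)
  have "x \<in> ?C" if "v \<in> ?C" "x \<in> V" "deg E x = deg E v" for v x
  proof -
    have "deg E v = s \<or> deg E v = t" using that(1) y_V(2) by (auto simp: in_deg_class)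
    then have "x \<in> deg_class V E s \<or> x \<in> deg_class V E t" using that(2,3) in_deg_class by metis
    then show ?thesis using y(1) by blast
  qed
  moreover have "deg (restrict_on ?C E) v = class_deg E t h" if "v \<in> ?C" "v \<noteq> y" for v
    by (rule deg_restrict_on_insert_class[OF y h]) (use that in auto)
  moreover have "?C \<subseteq> V" using y_V(1) by (auto simp: in_deg_class)
  moreover have "module_of V E ?C" by (rule module_of_insert_class[OF y])
  ultimately show thesis
    using that[of y "class_deg E t h"] unfolding near_regular_core_def by blast
qed

end

subsection \<open>The core around a mixed class\<close>

context unigraph_on
begin

lemma obtain_two_level_class:
  assumes "mixed V E t" "a \<in> deg_class V E t" "d \<in> deg_class V E t"
    and "class_deg E x a \<noteq> class_deg E x d"
  obtains s H L where "two_level_class V E t s H L"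
proof -
  define M where "M = deg_class V E t"
  obtain a d where ad: "a \<in> M" "d \<in> M" and less: "class_deg E t d < class_deg E t a"
    using class_deg_eq_if_inner_deg_eq[OF assms(1-3)] assms(2-4) unfolding M_def
    by (metis linorder_neqE_nat)
  then have deg: "deg E a = t" "deg E d = t" by (simp_all add: M_def in_deg_class)
  then have inner_a: "class_deg E t a = class_deg E t d + 1"
    using class_deg_le_Suc[of a d t] less by simp
  obtain q s where qs: "q \<noteq> s" "traded E a d q s"
    using traded_if_class_deg_neq[of a d t] deg less by auto
  then have "q = t" using tradedD[OF qs(2), of t] inner_a
    by (auto simp: of_bool_def split: if_splits)
  let ?H = "{v \<in> M. class_deg E t v = class_deg E t a}"
  let ?L = "{v \<in> M. class_deg E t v = class_deg E t d}"
  have "class_deg E t v = class_deg E t a \<or> class_deg E t v = class_deg E t d" if "v \<in> M" for v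
    using class_deg_le_Suc[of v d t] class_deg_le_Suc[of a v t] that deg inner_a
    by (auto simp: M_def in_deg_class)
  then have "M = ?H \<union> ?L" by blast
  moreover have "traded E h l t s" if "h \<in> ?H" "l \<in> ?L" for h l
  proof -
    have "class_deg E x h = class_deg E x a" "class_deg E x l = class_deg E x d" for x
      using class_deg_eq_if_inner_deg_eq[OF assms(1)] that ad unfolding M_def by blast+
    then show ?thesis using qs(2) \<open>q = t\<close> by (simp add: traded_def)
  qed
  ultimately have "two_level_class V E t s ?H ?L"
    using qs(1) \<open>q = t\<close> ad by unfold_locales (auto simp: M_def)
  then show thesis by (rule that)
qed

lemma near_regular_core_if_class_deg_uniform:
  assumes "mixed V E t" and y: "y \<in> deg_class V E t"
    and uniform: "\<And>a d s. a \<in> deg_class V E t \<Longrightarrow> d \<in> deg_class V E t \<Longrightarrow>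
      class_deg E s a = class_deg E s d"
  shows "near_regular_core V E (deg_class V E t) y (class_deg E t y)"
proof -
  let ?M = "deg_class V E t"
  have "module_of V E ?M"
    unfolding module_of_def
  proof
    fix x assume "x \<in> V - ?M"
    then have "deg E x \<noteq> t" by (simp add: in_deg_class)
    then show "(\<forall>v\<in>?M. E x v) \<or> (\<forall>v\<in>?M. \<not> E x v)"
      using adj_uniform_if_class_deg_uniform[OF assms(1)] uniform by blast
  qed
  moreover have "deg (restrict_on ?M E) v = class_deg E t y" if "v \<in> ?M" for v
    using uniform[OF that y] class_deg_eq_deg_restrict_on[OF that] by simp
  ultimately show ?thesis
    unfolding near_regular_core_def using y by (auto simp: in_deg_class)
qed

lemma obtain_near_regular_core:
  assumes "mixed V E t"
  obtains C y k where "deg_class V E t \<subseteq> C" "near_regular_core V E C y k"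
proof (cases "\<forall>a\<in>deg_class V E t. \<forall>d\<in>deg_class V E t. \<forall>s. class_deg E s a = class_deg E s d")
  case True
  obtain y where "y \<in> deg_class V E t" using assms by (auto simp: mixed_def is_stable_def)
  then show thesis
    using that near_regular_core_if_class_deg_uniform[OF assms] True by blast
next
  case False
  then obtain s H L where "two_level_class V E t s H L"
    using obtain_two_level_class[OF assms] by metis
  then interpret two_level_class V E t s H L .
  obtain y k where "near_regular_core V E (insert y (deg_class V E t)) y k"
    by (rule obtain_near_regular_core_insert_class)
  then show thesis by (rule that[rotated]) blast
qed

lemma clique_and_stable_outside:
  assumes "mixed V E t" and M: "deg_class V E t \<subseteq> C"
  shows "is_clique E {x \<in> V - C. \<forall>v\<in>C. E x v}" "is_stable E {x \<in> V - C. \<forall>v\<in>C. \<not> E x v}"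
proof -
  obtain a b c d where ab: "a \<in> deg_class V E t" "b \<in> deg_class V E t" "E a b"
    and cd: "c \<in> deg_class V E t" "d \<in> deg_class V E t" "c \<noteq> d" "\<not> E c d"
    using assms(1) unfolding mixed_def is_clique_def is_stable_def by blast
  then have deg: "deg E a = t" "deg E b = t" "deg E c = t" "deg E d = t"
    by (simp_all add: in_deg_class)
  have deg_outside: "deg E x \<noteq> t" if "x \<in> V - C" for x using that M by (auto simp: in_deg_class)
  show "is_clique E {x \<in> V - C. \<forall>v\<in>C. E x v}"
    unfolding is_clique_def
  proof (intro ballI impI, rule ccontr)
    fix x y assume x: "x \<in> {x \<in> V - C. \<forall>v\<in>C. E x v}" and y: "y \<in> {x \<in> V - C. \<forall>v\<in>C. E x v}"
      and "x \<noteq> y" "\<not> E x y"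
    have "E x c" "E y d" using x y cd M by blast+
    then show False
      using opposite_deg_eq[of x c y d] \<open>x \<noteq> y\<close> \<open>\<not> E x y\<close> cd deg deg_outside x y by auto
  qed
  show "is_stable E {x \<in> V - C. \<forall>v\<in>C. \<not> E x v}"
    unfolding is_stable_def
  proof (intro ballI notI)
    fix x y assume x: "x \<in> {x \<in> V - C. \<forall>v\<in>C. \<not> E x v}" and y: "y \<in> {x \<in> V - C. \<forall>v\<in>C. \<not> E x v}"
      and "E x y"
    have "\<not> E x a" "\<not> E y b" "x \<noteq> a" "y \<noteq> b" using x y ab M by blast+
    then show False
      using opposite_deg_eq[OF \<open>E x y\<close> ab(3)] deg deg_outside x y by auto
  qed
qed

end

section \<open>Split graphs\<close>

locale two_K2_C4_C5_free = simple_graph +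
  assumes two_K2_free: "E a b \<Longrightarrow> E c d \<Longrightarrow> E a c \<or> E a d \<or> E b c \<or> E b d"
    and C4_free: "E a b \<Longrightarrow> E b c \<Longrightarrow> E c d \<Longrightarrow> E d a \<Longrightarrow> a \<noteq> c \<Longrightarrow> b \<noteq> d \<Longrightarrow> E a c \<or> E b d"
    and C5_free: "E a b \<Longrightarrow> E b c \<Longrightarrow> E c d \<Longrightarrow> E d e \<Longrightarrow> E e a \<Longrightarrow>
      E a c \<or> E b d \<or> E c e \<or> E d a \<or> E e b"

lemma is_clique_subset: "is_clique E A \<Longrightarrow> B \<subseteq> A \<Longrightarrow> is_clique E B"
  by (auto simp: is_clique_def)

lemma (in simple_graph) is_clique_insert:
  "is_clique E (insert x A) \<longleftrightarrow> is_clique E A \<and> (\<forall>v\<in>A - {x}. E x v)"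
  using adj_sym by (auto simp: is_clique_def)

text \<open>
  The weights prefer large cliques, and among cliques of equal size those with a large sum of
  degrees.
\<close>

definition (in simple_graph) clique_weight :: "'a set \<Rightarrow> nat" where
  "clique_weight A = (\<Sum>v\<in>A. card V + deg E v)"

locale heaviest_clique = two_K2_C4_C5_free +
  fixes A
  assumes A_subset: "A \<subseteq> V" and clique: "is_clique E A"
    and heaviest: "B \<subseteq> V \<Longrightarrow> is_clique E B \<Longrightarrow> clique_weight B \<le> clique_weight A"
begin

lemma finite_A: "finite A"
  using A_subset finite_V by (rule finite_subset)

lemma nonnbr_in_A:
  assumes "x \<in> V - A"
  obtains u where "u \<in> A" "\<not> E x u"
proof -
  have "\<exists>u\<in>A. \<not> E x u"
  proof (rule ccontr)
    assume "\<not> ?thesis"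
    then have "is_clique E (insert x A)" using clique by (simp add: is_clique_insert)
    then have "clique_weight (insert x A) \<le> clique_weight A"
      using heaviest A_subset assms by blast
    then show False
      using assms finite_A finite_V by (auto simp: clique_weight_def card_gt_0_iff)
  qed
  with that show thesis by blast
qed

lemma nonnbrs_nested:
  assumes "x \<in> V - A" "y \<in> V - A" "E x y"
  shows "(\<forall>w\<in>A. \<not> E x w \<longrightarrow> \<not> E y w) \<or> (\<forall>w\<in>A. \<not> E y w \<longrightarrow> \<not> E x w)"
proof (rule ccontr)
  assume "\<not> ?thesis"
  then obtain u w where uw: "u \<in> A" "\<not> E x u" "E y u" "w \<in> A" "\<not> E y w" "E x w" by blast
  then have "E w u" using clique unfolding is_clique_def by metis
  then show False
    using C4_free[OF uw(6) _ adj_sym[OF uw(3)] adj_sym[OF assms(3)]] adj_sym[of w y] uw assms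
    by auto
qed

end

locale nested_edge = heaviest_clique +
  fixes x y u
  assumes x: "x \<in> V - A" and y: "y \<in> V - A" and xy: "E x y"
    and nested: "w \<in> A \<Longrightarrow> \<not> E x w \<Longrightarrow> \<not> E y w"
    and u: "u \<in> A" "\<not> E x u"
begin

lemma not_adj_y_u: "\<not> E y u"
  using nested u by blast

lemma x_adj:
  assumes "w \<in> A" "w \<noteq> u"
  shows "E x w"
proof (rule ccontr)
  assume "\<not> E x w"
  moreover from this have "\<not> E y w" using nested assms by blast
  moreover have "E u w" using clique u(1) assms unfolding is_clique_def by metis
  ultimately show False using two_K2_free[OF xy, of u w] u(2) not_adj_y_u by simp
qed

lemma clique_Diff: "is_clique E (A - {u})"
  using clique is_clique_subset by blast

lemma clique_weight_A: "clique_weight A = card V + deg E u + clique_weight (A - {u})"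
  unfolding clique_weight_def using finite_A u(1) by (rule sum.remove)

lemma deg_x_le_deg_u: "deg E x \<le> deg E u"
proof -
  have "is_clique E (insert x (A - {u}))" using clique_Diff x_adj by (simp add: is_clique_insert)
  then have "clique_weight (insert x (A - {u})) \<le> clique_weight A"
    using heaviest[of "insert x (A - {u})"] A_subset x by blast
  then show ?thesis
    using clique_weight_A x finite_A by (simp add: clique_weight_def)
qed

lemma obtain_private_nbr_of_u:
  obtains z where "E u z" "\<not> E x z" "z \<noteq> x" "E y z"
proof -
  have "y \<in> private_nbrs E x u"
    using xy not_adj_y_u u y adj_commute[of u y] by (auto simp: in_private_nbrs)
  then have "card (private_nbrs E x u) > 0" using finite_private_nbrs card_gt_0_iff by blast
  then have "private_nbrs E u x \<noteq> {}"
    using card_private_nbrs[of "\<lambda>_. True" x u] deg_x_le_deg_u by (auto simp: deg_def)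
  then obtain z where z: "E u z" "\<not> E x z" "z \<noteq> x" by (auto simp: in_private_nbrs)
  then have "E y z" using two_K2_free[OF xy z(1)] u(2) not_adj_y_u by simp
  with z show thesis by (rule that)
qed

lemma y_adj:
  assumes w: "w \<in> A" "w \<noteq> u"
  shows "E w y"
proof (rule ccontr)
  assume "\<not> E w y"
  obtain z where z: "E u z" "\<not> E x z" "z \<noteq> x" "E y z" by (rule obtain_private_nbr_of_u)
  have "E w u" using clique w u(1) unfolding is_clique_def by metis
  show False
  proof (cases "E w z")
    case True
    then show False
      using C4_free[OF x_adj[OF w] _ adj_sym[OF z(4)] adj_sym[OF xy]] z w y \<open>\<not> E w y\<close> by auto
  next
    case False
    then show False
      using C5_free[OF x_adj[OF w] \<open>E w u\<close> z(1) adj_sym[OF z(4)] adj_sym[OF xy]] u(2) z(2)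
        \<open>\<not> E w y\<close> not_adj_y_u adj_sym[of z x] adj_sym[of u y] adj_sym[of y w] by auto
  qed
qed

lemma no_nested_edge: False
proof -
  let ?B = "insert x (insert y (A - {u}))"
  have "is_clique E ?B"
    using clique_Diff x_adj adj_sym[OF y_adj] xy by (auto simp: is_clique_insert)
  then have "clique_weight ?B \<le> clique_weight A"
    using heaviest[of ?B] A_subset x y by blast
  moreover have "clique_weight ?B = card V + deg E x + (card V + deg E y + clique_weight (A - {u}))"
    unfolding clique_weight_def using x y finite_A xy adj_irrefl by (subst sum.insert; auto)+
  moreover have "deg E x > 0" using deg_pos_iff xy by blast
  moreover have "deg E u < card V" using deg_less_card A_subset u(1) by blast
  ultimately show False using clique_weight_A by linarith
qed

end

context heaviest_clique
begin

lemma not_adj_if_nonnbrs_subset: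
  assumes x: "x \<in> V - A" and y: "y \<in> V - A"
    and nested: "\<And>w. w \<in> A \<Longrightarrow> \<not> E x w \<Longrightarrow> \<not> E y w"
  shows "\<not> E x y"
proof
  assume "E x y"
  obtain u where "u \<in> A" "\<not> E x u" by (rule nonnbr_in_A[OF x])
  with assms \<open>E x y\<close> interpret nested_edge V E A x y u by unfold_locales
  show False by (rule no_nested_edge)
qed

lemma stable_outside: "is_stable E (V - A)"
  unfolding is_stable_def
proof (intro ballI notI)
  fix x y assume xy: "x \<in> V - A" "y \<in> V - A" "E x y"
  then show False
    using nonnbrs_nested[OF xy] not_adj_if_nonnbrs_subset[of x y] not_adj_if_nonnbrs_subset[of y x]
      adj_sym by blast
qed

end

text \<open>The theorem of Foldes and Hammer.\<close>

lemma (in two_K2_C4_C5_free) split_partition: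
  obtains A where "A \<subseteq> V" "is_clique E A" "is_stable E (V - A)"
proof -
  let ?C = "{A. A \<subseteq> V \<and> is_clique E A}"
  have fin: "finite ?C" using finite_V by simp
  moreover have "{} \<in> ?C" by (simp add: is_clique_def)
  ultimately obtain A where A: "A \<in> ?C" "Max (clique_weight ` ?C) = clique_weight A"
    using obtains_MAX[of ?C clique_weight] by blast
  have "clique_weight B \<le> clique_weight A" if "B \<subseteq> V" "is_clique E B" for B
    unfolding A(2)[symmetric] using fin that by (intro Max_ge) auto
  then interpret heaviest_clique V E A
    using A(1) by unfold_locales auto
  show thesis using that A_subset clique stable_outside by blast
qed

locale unmixed_unigraph = unigraph_on +
  assumes unmixed: "\<not> mixed V E t"
begin

lemma no_mixed_triple:
  assumes "E p q" "\<not> E p r" "p \<noteq> r" "r \<in> V" "deg E p = deg E q"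
  shows "deg E r \<noteq> deg E p"
proof
  let ?M = "deg_class V E (deg E p)"
  assume "deg E r = deg E p"
  then have "p \<in> ?M" "q \<in> ?M" "r \<in> ?M"
    using assms adj_left adj_right by (simp_all add: in_deg_class)
  then have "mixed V E (deg E p)"
    using assms(1-3) by (auto simp: mixed_def is_clique_def is_stable_def)
  then show False using unmixed by blast
qed

lemma alternating_path:
  assumes "E p q" "E q r" "E r s" "\<not> E p r" "\<not> E q s" "p \<noteq> r" "q \<noteq> s"
  shows "deg E p = deg E s \<or> deg E q = deg E r"
  using opposite_deg_eq assms by blast

lemma two_K2_free:
  assumes ab: "E a b" and cd: "E c d"
  shows "E a c \<or> E a d \<or> E b c \<or> E b d"
proof (rule ccontr)
  assume chordless: "\<not> ?thesis"
  then have neq: "a \<noteq> c" "a \<noteq> d" "b \<noteq> c" "b \<noteq> d" using ab cd adj_sym by metis+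
  have V: "a \<in> V" "b \<in> V" "c \<in> V" "d \<in> V" using ab cd adj_left adj_right by blast+
  have "deg E a = deg E d \<or> deg E b = deg E c" "deg E a = deg E c \<or> deg E b = deg E d"
    using opposite_deg_eq[of a b c d] opposite_deg_eq[of a b d c] ab cd chordless neq adj_sym
    by auto
  then show False
    using no_mixed_triple[of a b c] no_mixed_triple[of a b d] no_mixed_triple[of c d a]
      no_mixed_triple[of c d b] chordless neq V ab cd adj_commute by metis
qed

lemma C4_free:
  assumes cycle: "E a b" "E b c" "E c d" "E d a" and neq: "a \<noteq> c" "b \<noteq> d"
  shows "E a c \<or> E b d"
proof (rule ccontr)
  assume chordless: "\<not> ?thesis"
  have V: "a \<in> V" "b \<in> V" "c \<in> V" "d \<in> V" using cycle adj_left by blast+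
  have "deg E a = deg E d \<or> deg E b = deg E c" "deg E a = deg E b \<or> deg E d = deg E c"
    using opposite_deg_eq[of a b c d] opposite_deg_eq[of a d c b] cycle chordless neq adj_sym
    by auto
  then show False
    using no_mixed_triple[of a b c] no_mixed_triple[of b c d] no_mixed_triple[of c d a]
      no_mixed_triple[of d a b] no_mixed_triple[of b a d] chordless neq V cycle adj_commute by metis
qed

text \<open>
  The five alternating paths give five different pairs of equal degrees, but any three vertices of
  the cycle span an edge and a non-edge.
\<close>

lemma C5_free:
  assumes cycle: "E a b" "E b c" "E c d" "E d e" "E e a"
  shows "E a c \<or> E b d \<or> E c e \<or> E d a \<or> E e b"
proof (rule ccontr)
  assume chordless: "\<not> ?thesis"
  have V: "a \<in> V" "b \<in> V" "c \<in> V" "d \<in> V" "e \<in> V" using cycle adj_left by blast+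
  have neq: "a \<noteq> c" "b \<noteq> d" "c \<noteq> e" "d \<noteq> a" "e \<noteq> b" using cycle chordless adj_sym by blast+
  have "deg E a = deg E d \<or> deg E b = deg E c" "deg E b = deg E e \<or> deg E c = deg E d"
    "deg E c = deg E a \<or> deg E d = deg E e" "deg E d = deg E b \<or> deg E e = deg E a"
    "deg E e = deg E c \<or> deg E a = deg E b"
    using alternating_path[of a b c d] alternating_path[of b c d e] alternating_path[of c d e a]
      alternating_path[of d e a b] alternating_path[of e a b c] cycle chordless neq by blast+
  moreover have "deg E a = deg E b \<longrightarrow> deg E c \<noteq> deg E a \<and> deg E d \<noteq> deg E a"
    "deg E b = deg E c \<longrightarrow> deg E d \<noteq> deg E b \<and> deg E e \<noteq> deg E b"
    "deg E c = deg E d \<longrightarrow> deg E e \<noteq> deg E c \<and> deg E a \<noteq> deg E c"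
    "deg E d = deg E e \<longrightarrow> deg E a \<noteq> deg E d \<and> deg E b \<noteq> deg E d"
    "deg E e = deg E a \<longrightarrow> deg E b \<noteq> deg E e \<and> deg E c \<noteq> deg E e"
    using no_mixed_triple cycle chordless neq V adj_sym by metis+
  ultimately show False by argo
qed

sublocale two_K2_C4_C5_free
  by unfold_locales (fact two_K2_free C4_free C5_free)+

end

section \<open>Perfection\<close>

definition colouring :: "('a \<Rightarrow> 'a \<Rightarrow> bool) \<Rightarrow> 'a set \<Rightarrow> nat \<Rightarrow> ('a \<Rightarrow> nat) \<Rightarrow> bool" where
  "colouring E W k f \<longleftrightarrow> (\<forall>v\<in>W. f v < k) \<and> (\<forall>u\<in>W. \<forall>v\<in>W. E u v \<longrightarrow> f u \<noteq> f v)"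

definition clique_colourable :: "'a set \<Rightarrow> ('a \<Rightarrow> 'a \<Rightarrow> bool) \<Rightarrow> bool" where
  "clique_colourable W E \<longleftrightarrow> (\<exists>K f. K \<subseteq> W \<and> is_clique E K \<and> colouring E W (card K) f)"

text \<open>
  A colouring with as many colours as some clique has vertices witnesses that the chromatic
  number equals the clique number.
\<close>

definition perfect_on :: "'a set \<Rightarrow> ('a \<Rightarrow> 'a \<Rightarrow> bool) \<Rightarrow> bool" where
  "perfect_on V E \<longleftrightarrow> (\<forall>W\<subseteq>V. clique_colourable W E)"

lemma clique_colourableI:
  assumes "K \<subseteq> W" "is_clique E K" "card K = k" "colouring E W k f"
  shows "clique_colourable W E"
  using assms unfolding clique_colourable_def by blast

lemma clique_colourableE:
  assumes "clique_colourable W E"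
  obtains K f where "K \<subseteq> W" "is_clique E K" "colouring E W (card K) f"
  using assms unfolding clique_colourable_def by blast

lemma perfect_on_subset: "perfect_on V E \<Longrightarrow> W \<subseteq> V \<Longrightarrow> perfect_on W E"
  unfolding perfect_on_def by blast

lemma perfect_on_empty: "perfect_on {} E"
  by (auto simp: perfect_on_def clique_colourable_def colouring_def is_clique_def)

lemma clique_colourable_embedding:
  assumes "clique_colourable (f ` W) E" and inj: "inj_on f W"
    and adj: "\<And>x y. x \<in> W \<Longrightarrow> y \<in> W \<Longrightarrow> F x y \<longleftrightarrow> E (f x) (f y)"
  shows "clique_colourable W F"
proof -
  obtain K g where K: "K \<subseteq> f ` W" "is_clique E K" "colouring E (f ` W) (card K) g"
    using assms(1) by (rule clique_colourableE)
  obtain L where L: "L \<subseteq> W" "K = f ` L" using K(1) by (auto simp: subset_image_iff)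
  show ?thesis
  proof (rule clique_colourableI[OF L(1)])
    show "card L = card K" using L inj by (metis card_image inj_on_subset)
    show "is_clique F L"
      using K(2) L inj adj unfolding is_clique_def inj_on_def by (metis imageI subsetD)
    show "colouring F W (card K) (g \<circ> f)" using K(3) adj by (auto simp: colouring_def)
  qed
qed

lemma perfect_on_embedding:
  assumes "perfect_on V E" "inj_on f U" "f ` U \<subseteq> V"
    and "\<And>x y. x \<in> U \<Longrightarrow> y \<in> U \<Longrightarrow> F x y \<longleftrightarrow> E (f x) (f y)"
  shows "perfect_on U F"
  unfolding perfect_on_def
proof (intro allI impI)
  fix W assume "W \<subseteq> U"
  moreover from this have "clique_colourable (f ` W) E"
    using assms(1,3) unfolding perfect_on_def by (metis image_mono subset_trans)
  ultimately show "clique_colourable W F"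
    using assms(2,4) by (intro clique_colourable_embedding[of f W E F]) (auto intro: inj_on_subset)
qed

lemma perfect_on_cong:
  assumes "\<And>x y. x \<in> V \<Longrightarrow> y \<in> V \<Longrightarrow> F x y \<longleftrightarrow> E x y"
  shows "perfect_on V F \<longleftrightarrow> perfect_on V E"
  using perfect_on_embedding[of V E id V F] perfect_on_embedding[of V F id V E] assms by auto

lemma colouring_extend_stable:
  assumes "colouring E (W - I) k f" "is_stable E I"
  shows "colouring E W (Suc k) (\<lambda>v. if v \<in> I then k else f v)"
  using assms unfolding colouring_def is_stable_def by (auto simp: less_Suc_eq)

lemma colouring_mono: "colouring E W k f \<Longrightarrow> k \<le> l \<Longrightarrow> colouring E W l f"
  unfolding colouring_def by fastforce

subsection \<open>Adding a vertex\<close>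

context simple_graph
begin

lemma colouring_fun_upd:
  assumes "colouring E (W - {y}) k f" "c < k" "c \<notin> f ` {v \<in> W. E y v}"
  shows "colouring E W k (f(y := c))"
  unfolding colouring_def
proof (intro conjI ballI impI)
  show "(f(y := c)) v < k" if "v \<in> W" for v
    using assms(1,2) that by (auto simp: colouring_def)
  show "(f(y := c)) u \<noteq> (f(y := c)) v" if "u \<in> W" "v \<in> W" "E u v" for u v
  proof -
    have "u \<noteq> v" "E v u" using that(3) adj_irrefl adj_sym by blast+
    moreover have "c \<noteq> f x" if "x \<in> W" "E y x" for x using assms(3) that by blast
    ultimately show ?thesis using assms(1) that by (auto simp: colouring_def)
  qed
qed

lemma clique_colourable_cosimplicial:
  assumes "W \<subseteq> V" "y \<in> W" and I: "I = {v \<in> W. \<not> E y v}" "is_stable E I"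
    and "clique_colourable (W - I) E"
  shows "clique_colourable W E"
proof -
  obtain K f where K: "K \<subseteq> W - I" "is_clique E K" "colouring E (W - I) (card K) f"
    using assms(5) by (rule clique_colourableE)
  have "finite K" using K(1) assms(1) finite_V by (meson Diff_subset finite_subset)
  show ?thesis
  proof (rule clique_colourableI)
    show "insert y K \<subseteq> W" "is_clique E (insert y K)"
      using K assms(2) by (auto simp: I is_clique_insert)
    show "card (insert y K) = Suc (card K)"
      using \<open>finite K\<close> K(1) assms(2) adj_irrefl by (subst card_insert_disjoint) (auto simp: I)
    show "colouring E W (Suc (card K)) (\<lambda>v. if v \<in> I then card K else f v)"
      by (rule colouring_extend_stable[OF K(3) I(2)])
  qed
qed

lemma perfect_on_insert_cosimplicial:
  assumes "insert y U \<subseteq> V" "perfect_on U E" and stable: "is_stable E {v \<in> U. \<not> E y v}"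
  shows "perfect_on (insert y U) E"
  unfolding perfect_on_def
proof (intro allI impI)
  fix W assume W: "W \<subseteq> insert y U"
  show "clique_colourable W E"
  proof (cases "y \<in> W")
    case False
    then show ?thesis using W assms(2) unfolding perfect_on_def by blast
  next
    case True
    define I where "I = {v \<in> W. \<not> E y v}"
    have "I \<subseteq> insert y {v \<in> U. \<not> E y v}" using W by (auto simp: I_def)
    moreover have "is_stable E (insert y {v \<in> U. \<not> E y v})"
      using stable adj_irrefl by (auto simp: is_stable_def dest: adj_sym[where v = y])
    ultimately have "is_stable E I" unfolding is_stable_def by blast
    moreover have "W - I \<subseteq> U" using W adj_irrefl by (auto simp: I_def)
    then have "clique_colourable (W - I) E" using assms(2) by (simp add: perfect_on_def)
    ultimately show ?thesis
      using clique_colourable_cosimplicial[OF _ True I_def] W assms(1) by blast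
  qed
qed

lemma clique_colourable_simplicial:
  assumes "W \<subseteq> V" "y \<in> W" and N: "N = {v \<in> W. E y v}" "is_clique E N"
    and "clique_colourable (W - {y}) E"
  shows "clique_colourable W E"
proof -
  obtain K f where K: "K \<subseteq> W - {y}" "is_clique E K" "colouring E (W - {y}) (card K) f"
    using assms(5) by (rule clique_colourableE)
  have fin: "finite N" using assms(1) finite_V N(1) by (auto intro: finite_subset)
  show ?thesis
  proof (cases "card N < card K")
    case True
    then have "card (f ` N) < card {..<card K}" using card_image_le[OF fin, of f] by simp
    then have "\<not> {..<card K} \<subseteq> f ` N"
      using fin card_mono[of "f ` N"] by (metis finite_imageI not_le)
    then obtain c where c: "c < card K" "c \<notin> f ` N" by blast
    then have "colouring E W (card K) (f(y := c))"
      by (intro colouring_fun_upd[OF K(3)]) (simp_all add: N(1))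
    then show ?thesis using K(1,2) by (intro clique_colourableI[of K]) auto
  next
    case False
    have "N \<subseteq> W - {y}" using adj_irrefl by (auto simp: N(1))
    then have "card N \<notin> f ` N" using K(3) False unfolding colouring_def by fastforce
    then have "colouring E W (Suc (card N)) (f(y := card N))"
      using False by (intro colouring_fun_upd colouring_mono[OF K(3)]) (simp_all add: N(1))
    moreover have "card (insert y N) = Suc (card N)" using fin adj_irrefl by (simp add: N(1))
    ultimately show ?thesis
      using assms(2) N by (intro clique_colourableI[of "insert y N"]) (auto simp: is_clique_insert)
  qed
qed

lemma perfect_on_insert_simplicial:
  assumes "insert y U \<subseteq> V" "perfect_on U E" and clique: "is_clique E {v \<in> U. E y v}"
  shows "perfect_on (insert y U) E"
  unfolding perfect_on_def
proof (intro allI impI)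
  fix W assume W: "W \<subseteq> insert y U"
  show "clique_colourable W E"
  proof (cases "y \<in> W")
    case False
    then show ?thesis using W assms(2) unfolding perfect_on_def by blast
  next
    case True
    have "{v \<in> W. E y v} \<subseteq> {v \<in> U. E y v}" using W adj_irrefl by auto
    then have "is_clique E {v \<in> W. E y v}" using clique is_clique_subset by blast
    moreover have "W - {y} \<subseteq> U" using W by blast
    then have "clique_colourable (W - {y}) E" using assms(2) by (simp add: perfect_on_def)
    ultimately show ?thesis
      using clique_colourable_simplicial[OF _ True refl] W assms(1) by blast
  qed
qed

lemma perfect_on_Un_isolated:
  assumes "B \<union> U \<subseteq> V" "perfect_on U E" "is_stable E B"
    and anticomplete: "\<And>b u. b \<in> B \<Longrightarrow> u \<in> U \<Longrightarrow> \<not> E b u"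
  shows "perfect_on (B \<union> U) E"
proof -
  have "finite B" using assms(1) finite_V by (auto intro: finite_subset)
  then show ?thesis using assms(1,3) anticomplete
  proof (induction B)
    case empty
    then show ?case using assms(2) by simp
  next
    case (insert b B)
    have "{v \<in> B \<union> U. E b v} = {}" using insert.prems by (auto simp: is_stable_def)
    then have "is_clique E {v \<in> B \<union> U. E b v}" unfolding is_clique_def by blast
    moreover have "perfect_on (B \<union> U) E"
      using insert.prems by (intro insert.IH) (auto simp: is_stable_def)
    ultimately show ?case
      using perfect_on_insert_simplicial[of b "B \<union> U"] insert.prems(1) by simp
  qed
qed

lemma perfect_on_Un_clique_complete_to:
  assumes "A \<union> B \<union> U \<subseteq> V" "perfect_on (B \<union> U) E" "is_clique E A" "is_stable E B"
    and complete: "\<And>a u. a \<in> A \<Longrightarrow> u \<in> U \<Longrightarrow> E a u"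
  shows "perfect_on (A \<union> B \<union> U) E"
proof -
  have "finite A" using assms(1) finite_V by (auto intro: finite_subset)
  then show ?thesis using assms(1,3) complete
  proof (induction A)
    case empty
    then show ?case using assms(2) by simp
  next
    case (insert a A)
    have "E a v" if "v \<in> A" for v
      using that insert.hyps(2) insert.prems(2) by (auto simp: is_clique_def)
    then have "{v \<in> A \<union> B \<union> U. \<not> E a v} \<subseteq> B" using insert.prems(3) by auto
    then have "is_stable E {v \<in> A \<union> B \<union> U. \<not> E a v}"
      using assms(4) unfolding is_stable_def by blast
    moreover have "perfect_on (A \<union> B \<union> U) E"
      using insert.prems by (intro insert.IH) (auto simp: is_clique_def)
    ultimately show ?case
      using perfect_on_insert_cosimplicial[of a "A \<union> B \<union> U"] insert.prems(1) by simp
  qed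
qed

lemma perfect_on_join:
  assumes "A \<union> B \<union> U \<subseteq> V" "perfect_on U E" "is_clique E A" "is_stable E B"
    and "\<And>a u. a \<in> A \<Longrightarrow> u \<in> U \<Longrightarrow> E a u" "\<And>b u. b \<in> B \<Longrightarrow> u \<in> U \<Longrightarrow> \<not> E b u"
  shows "perfect_on (A \<union> B \<union> U) E"
  using assms by (intro perfect_on_Un_clique_complete_to perfect_on_Un_isolated) auto

subsection \<open>Bipartite graphs and their complements\<close>

lemma perfect_on_bipartite:
  assumes "is_stable E A" "is_stable E B"
  shows "perfect_on (A \<union> B) E"
  unfolding perfect_on_def
proof (intro allI impI)
  fix W assume W: "W \<subseteq> A \<union> B"
  consider (edge) u v where "u \<in> W" "v \<in> W" "E u v"
    | (stable) x where "x \<in> W" "is_stable E W" | (empty) "W = {}"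
    unfolding is_stable_def by blast
  then show "clique_colourable W E"
  proof cases
    case edge
    then have "u \<noteq> v" using adj_irrefl by blast
    have "colouring E W 2 (\<lambda>x. if x \<in> A then 0 else 1)"
      using W assms by (fastforce simp: colouring_def is_stable_def)
    then show ?thesis
      using edge \<open>u \<noteq> v\<close> adj_sym
      by (intro clique_colourableI[of "{u, v}"]) (auto simp: is_clique_def)
  next
    case stable
    then show ?thesis
      by (intro clique_colourableI[of "{x}" _ _ 1 "\<lambda>_. 0"])
        (auto simp: is_clique_def is_stable_def colouring_def)
  next
    case empty
    then show ?thesis using perfect_on_empty[of E] by (simp add: perfect_on_def)
  qed
qed

definition maximum_clique :: "'a set \<Rightarrow> 'a set \<Rightarrow> bool" where
  "maximum_clique W K \<longleftrightarrow>
     K \<subseteq> W \<and> is_clique E K \<and> (\<forall>L\<subseteq>W. is_clique E L \<longrightarrow> card L \<le> card K)"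

lemma maximum_clique_exists:
  assumes "W \<subseteq> V"
  obtains K where "maximum_clique W K"
proof -
  let ?C = "{K. K \<subseteq> W \<and> is_clique E K}"
  have fin: "finite ?C" using finite_subset[OF assms finite_V] by simp
  moreover have "{} \<in> ?C" by (simp add: is_clique_def)
  ultimately obtain K where K: "K \<in> ?C" "Max (card ` ?C) = card K"
    using obtains_MAX[of ?C card] by blast
  have "card L \<le> card K" if "L \<in> ?C" for L
    unfolding K(2)[symmetric] using fin that by (intro Max_ge) auto
  then show thesis using K(1) that unfolding maximum_clique_def by blast
qed

lemma clique_colourable_stable_transversal:
  assumes "W \<subseteq> V" and I: "is_stable E I" "\<And>K. maximum_clique W K \<Longrightarrow> K \<inter> I \<noteq> {}"
    and "clique_colourable (W - I) E"
  shows "clique_colourable W E"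
proof -
  obtain K where K: "maximum_clique W K" by (rule maximum_clique_exists[OF assms(1)])
  obtain L f where L: "L \<subseteq> W - I" "is_clique E L" "colouring E (W - I) (card L) f"
    using assms(4) by (rule clique_colourableE)
  have "card L \<le> card K" using K L unfolding maximum_clique_def by blast
  moreover have "card L \<noteq> card K"
  proof
    assume "card L = card K"
    then have "maximum_clique W L" using K L unfolding maximum_clique_def by auto
    then show False using I(2) L(1) by blast
  qed
  ultimately have "colouring E W (card K) (\<lambda>v. if v \<in> I then card L else f v)"
    using colouring_mono[OF colouring_extend_stable[OF L(3) I(1)]] by simp
  then show ?thesis
    using K by (intro clique_colourableI) (auto simp: maximum_clique_def)
qed

lemma perfect_on_if_stable_transversals:
  assumes U: "U \<subseteq> V"
    and transversal: "\<And>W. W \<subseteq> U \<Longrightarrow> W \<noteq> {} \<Longrightarrow>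
      \<exists>I\<subseteq>W. is_stable E I \<and> (\<forall>K. maximum_clique W K \<longrightarrow> K \<inter> I \<noteq> {})"
  shows "perfect_on U E"
  unfolding perfect_on_def
proof (intro allI impI)
  fix W assume "W \<subseteq> U"
  then show "clique_colourable W E"
  proof (induction "card W" arbitrary: W rule: less_induct)
    case less
    show ?case
    proof (cases "W = {}")
      case True
      then show ?thesis using perfect_on_empty[of E] by (simp add: perfect_on_def)
    next
      case False
      then obtain I where I: "I \<subseteq> W" "is_stable E I" "\<And>K. maximum_clique W K \<Longrightarrow> K \<inter> I \<noteq> {}"
        using transversal[OF less.prems False] by blast
      have "W \<subseteq> V" using less.prems U by blast
      moreover from this obtain K where "maximum_clique W K" by (rule maximum_clique_exists)
      then have "W - I \<subset> W" using I(1) I(3)[of K] by blast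
      then have "card (W - I) < card W"
        using \<open>W \<subseteq> V\<close> finite_V by (intro psubset_card_mono) (auto intro: finite_subset)
      then have "clique_colourable (W - I) E" using less.hyps less.prems by blast
      ultimately show ?thesis using clique_colourable_stable_transversal I(2,3) by blast
    qed
  qed
qed

end

locale cobipartite = simple_graph +
  fixes A B
  assumes disjoint: "A \<inter> B = {}" and cliques: "is_clique E A" "is_clique E B"
    and subset: "A \<union> B \<subseteq> V"
begin

lemma finite_if_subset: "W \<subseteq> A \<union> B \<Longrightarrow> finite W"
  using subset finite_V by (meson finite_subset)

lemma maximum_clique_crossover:
  assumes W: "W \<subseteq> A \<union> B" and K: "maximum_clique W K" and L: "maximum_clique W L"
  shows "maximum_clique W ((K \<union> L) \<inter> A \<union> (K \<inter> L) \<inter> B)"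
proof -
  let ?X = "(K \<union> L) \<inter> A \<union> (K \<inter> L) \<inter> B" and ?Y = "(K \<inter> L) \<inter> A \<union> (K \<union> L) \<inter> B"
  have KL: "K \<subseteq> W" "L \<subseteq> W" "is_clique E K" "is_clique E L"
    using K L by (auto simp: maximum_clique_def)
  have XY: "?X \<subseteq> W" "?Y \<subseteq> W" using KL by auto
  have cliques_XY: "is_clique E ?X" "is_clique E ?Y"
    using KL(3,4) cliques unfolding is_clique_def by blast+
  have fin: "finite ?X" "finite ?Y" "finite K" "finite L"
    using XY KL(1,2) finite_subset[OF _ finite_if_subset[OF W]] by blast+
  have "?X \<union> ?Y = K \<union> L" "?X \<inter> ?Y = K \<inter> L" using KL W disjoint by auto
  then have "card ?X + card ?Y = card K + card L"
    using card_Un_Int[OF fin(1,2)] card_Un_Int[OF fin(3,4)] by simp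
  moreover have "card ?Y \<le> card L" using L XY cliques_XY by (auto simp: maximum_clique_def)
  ultimately have "card K \<le> card ?X" by linarith
  moreover have "card M \<le> card K" if "M \<subseteq> W" "is_clique E M" for M
    using K that by (simp add: maximum_clique_def)
  ultimately show ?thesis using XY(1) cliques_XY(1) le_trans unfolding maximum_clique_def by blast
qed

text \<open>
  Among the maximum cliques avoiding \<open>p\<close>, the crossover yields one with a least trace on \<open>B\<close>. It
  contains a non-neighbour \<open>q\<close> of \<open>p\<close>, and \<open>{p, q}\<close> meets every maximum clique.
\<close>

lemma obtain_least_trace:
  assumes W: "W \<subseteq> A \<union> B" and "p \<in> A" and avoiding: "maximum_clique W M" "p \<notin> M"
  obtains K where "maximum_clique W K" "p \<notin> K"
    "\<And>L. maximum_clique W L \<Longrightarrow> p \<notin> L \<Longrightarrow> K \<inter> B \<subseteq> L"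
proof -
  let ?F = "{K. maximum_clique W K \<and> p \<notin> K}"
  have "?F \<subseteq> Pow W" by (auto simp: maximum_clique_def)
  then have fin: "finite ?F" using finite_if_subset[OF W] finite_subset by blast
  then obtain K where K: "K \<in> ?F" and Min: "Min ((\<lambda>K. card (K \<inter> B)) ` ?F) = card (K \<inter> B)"
    using avoiding obtains_MIN[of ?F "\<lambda>K. card (K \<inter> B)"] by blast
  have "finite K" using K W by (intro finite_if_subset) (auto simp: maximum_clique_def)
  have "K \<inter> B \<subseteq> L" if L: "L \<in> ?F" for L
  proof -
    let ?X = "(K \<union> L) \<inter> A \<union> (K \<inter> L) \<inter> B"
    have "?X \<in> ?F" using maximum_clique_crossover[OF W] K L by blast
    then have "card (K \<inter> B) \<le> card (?X \<inter> B)"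
      unfolding Min[symmetric] using fin by (intro Min_le) auto
    moreover have "?X \<inter> B = K \<inter> L \<inter> B" using disjoint by blast
    ultimately have "K \<inter> L \<inter> B = K \<inter> B" using \<open>finite K\<close> by (intro card_seteq) auto
    then show ?thesis by blast
  qed
  with K that show thesis by blast
qed

lemma nonnbr_in_maximum_clique:
  assumes W: "W \<subseteq> A \<union> B" and p: "p \<in> W" "p \<in> A" and K: "maximum_clique W K" "p \<notin> K"
  obtains q where "q \<in> K" "q \<in> B" "\<not> E p q"
proof -
  have KW: "K \<subseteq> W" "is_clique E K" using K(1) by (auto simp: maximum_clique_def)
  have "\<exists>q\<in>K \<inter> B. \<not> E p q"
  proof (rule ccontr)
    assume adj: "\<not> ?thesis"
    have "E p v" if "v \<in> K - {p}" for v
    proof (cases "v \<in> A")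
      case True
      then show ?thesis using that p(2) cliques(1) unfolding is_clique_def by auto
    next
      case False
      then show ?thesis using that KW(1) W adj by auto
    qed
    then have "is_clique E (insert p K)" using KW(2) by (simp add: is_clique_insert)
    then have "card (insert p K) \<le> card K" using K(1) KW p by (auto simp: maximum_clique_def)
    then show False using K(2) finite_if_subset[OF subset_trans[OF KW(1) W]] by auto
  qed
  with that show thesis by blast
qed

lemma stable_transversal:
  assumes W: "W \<subseteq> A \<union> B" and p: "p \<in> W" "p \<in> A"
  shows "\<exists>I\<subseteq>W. is_stable E I \<and> (\<forall>K. maximum_clique W K \<longrightarrow> K \<inter> I \<noteq> {})"
proof (cases "\<exists>M. maximum_clique W M \<and> p \<notin> M")
  case False
  then show ?thesis using p adj_irrefl by (intro exI[of _ "{p}"]) (auto simp: is_stable_def)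
next
  case True
  then obtain K where K: "maximum_clique W K" "p \<notin> K"
    and least: "\<And>L. maximum_clique W L \<Longrightarrow> p \<notin> L \<Longrightarrow> K \<inter> B \<subseteq> L"
    using obtain_least_trace[OF W p(2)] by metis
  obtain q where q: "q \<in> K" "q \<in> B" "\<not> E p q" by (rule nonnbr_in_maximum_clique[OF W p K])
  have "L \<inter> {p, q} \<noteq> {}" if "maximum_clique W L" for L
    using least[OF that] q(1,2) by (cases "p \<in> L") auto
  moreover have "is_stable E {p, q}"
    using q(3) adj_irrefl adj_commute[of q p] by (simp add: is_stable_def)
  moreover have "{p, q} \<subseteq> W" using q(1) K(1) p(1) by (auto simp: maximum_clique_def)
  ultimately show ?thesis by blast
qed

lemma cobipartite_swap: "cobipartite V E B A"
  using disjoint cliques subset by unfold_locales auto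

lemma perfect_on_cobipartite: "perfect_on (A \<union> B) E"
proof (rule perfect_on_if_stable_transversals[OF subset])
  interpret swap: cobipartite V E B A by (rule cobipartite_swap)
  fix W assume W: "W \<subseteq> A \<union> B" "W \<noteq> {}"
  then consider p where "p \<in> W" "p \<in> A" | p where "p \<in> W" "p \<in> B" by blast
  then show "\<exists>I\<subseteq>W. is_stable E I \<and> (\<forall>K. maximum_clique W K \<longrightarrow> K \<inter> I \<noteq> {})"
    using stable_transversal swap.stable_transversal W(1) by cases (auto simp: Un_commute)
qed

end

subsection \<open>Perfection together with the complement\<close>

definition perfect_with_compl :: "'a set \<Rightarrow> ('a \<Rightarrow> 'a \<Rightarrow> bool) \<Rightarrow> 'a set \<Rightarrow> bool" where
  "perfect_with_compl V E W \<longleftrightarrow> perfect_on W E \<and> perfect_on W (compl_on V E)"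

context simple_graph
begin

lemma perfect_with_compl_bipartite:
  assumes "A \<union> B \<subseteq> V" "A \<inter> B = {}" "is_stable E A" "is_stable E B"
  shows "perfect_with_compl V E (A \<union> B)"
proof -
  interpret C: cobipartite V "compl_on V E" A B
    using simple_graph_compl assms is_clique_compl
    by (intro cobipartite.intro cobipartite_axioms.intro) auto
  show ?thesis
    using perfect_on_bipartite[OF assms(3,4)] C.perfect_on_cobipartite
    by (simp add: perfect_with_compl_def)
qed

lemma perfect_with_compl_bipartite_insert:
  assumes "insert y (A \<union> B) \<subseteq> V" "A \<inter> B = {}" "is_stable E A" "is_stable E B"
    and "\<And>b. b \<in> B \<Longrightarrow> E y b"
  shows "perfect_with_compl V E (insert y (A \<union> B))"
proof -
  interpret C: simple_graph V "compl_on V E" by (rule simple_graph_compl)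
  have perfect: "perfect_on (A \<union> B) E" "perfect_on (A \<union> B) (compl_on V E)"
    using perfect_with_compl_bipartite assms(1-4) by (auto simp: perfect_with_compl_def)
  have "is_stable E {v \<in> A \<union> B. \<not> E y v}" using assms(3,5) by (auto simp: is_stable_def)
  moreover have "is_clique (compl_on V E) {v \<in> A \<union> B. compl_on V E y v}"
    by (rule is_clique_subset[OF is_clique_compl[OF assms(3)]])
      (use assms in \<open>auto simp: compl_on_def\<close>)
  ultimately show ?thesis
    using perfect_on_insert_cosimplicial C.perfect_on_insert_simplicial perfect assms(1)
    by (simp add: perfect_with_compl_def)
qed

end

section \<open>Near-regular graphs\<close>

subsection \<open>Bipartite graphs with almost equal degrees\<close>

lemma bij_betw_initial_segment:
  assumes "finite A" "S \<subseteq> A"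
  obtains \<alpha> where "bij_betw \<alpha> A {..<card A}" "\<And>v. v \<in> A \<Longrightarrow> \<alpha> v < card S \<longleftrightarrow> v \<in> S"
proof -
  have "card S \<le> card A" using assms by (rule card_mono)
  obtain f where f: "bij_betw f S {..<card S}"
    using finite_same_card_bij[of S "{..<card S}"] finite_subset[OF assms(2,1)] by auto
  obtain g where g: "bij_betw g (A - S) {card S..<card A}"
    using finite_same_card_bij[of "A - S" "{card S..<card A}"] assms finite_subset[OF assms(2,1)]
    by (auto simp: card_Diff_subset)
  define \<alpha> where "\<alpha> v = (if v \<in> S then f v else g v)" for v
  have "bij_betw \<alpha> (S \<union> (A - S)) ({..<card S} \<union> {card S..<card A})"
    unfolding \<alpha>_def by (rule bij_betw_disjoint_Un[OF f g]) auto
  moreover have "S \<union> (A - S) = A" "{..<card S} \<union> {card S..<card A} = {..<card A}"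
    using assms(2) \<open>card S \<le> card A\<close> by auto
  ultimately have "bij_betw \<alpha> A {..<card A}" by simp
  moreover have "\<alpha> v < card S \<longleftrightarrow> v \<in> S" if "v \<in> A" for v
    using bij_betwE[OF f] bij_betwE[OF g] that by (auto simp: \<alpha>_def not_less)
  ultimately show thesis by (rule that)
qed

definition cyclic_diff :: "nat \<Rightarrow> nat \<Rightarrow> nat \<Rightarrow> nat" where
  "cyclic_diff k i j = (if i \<le> j then j - i else j + k - i)"

lemma cyclic_diff_eq_0_iff: "i < k \<Longrightarrow> cyclic_diff k i j = 0 \<longleftrightarrow> i = j"
  by (auto simp: cyclic_diff_def)

lemma bij_betw_cyclic_diff_right:
  assumes "i < k"
  shows "bij_betw (cyclic_diff k i) {..<k} {..<k}"
  by (rule bij_betw_byWitness[where f' = "\<lambda>x. if i + x < k then i + x else i + x - k"])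
    (use assms in \<open>auto simp: cyclic_diff_def\<close>)

lemma bij_betw_cyclic_diff_left:
  assumes "j < k"
  shows "bij_betw (\<lambda>i. cyclic_diff k i j) {..<k} {..<k}"
  by (rule bij_betw_byWitness[where f' = "\<lambda>x. if x \<le> j then j - x else j + k - x"])
    (use assms in \<open>auto simp: cyclic_diff_def\<close>)

lemma card_bij_betw_between:
  assumes "bij_betw f B {..<k}" "r \<le> k"
  shows "card {v \<in> B. m \<le> f v \<and> f v < r} = r - m"
proof -
  have "f ` {v \<in> B. m \<le> f v \<and> f v < r} = {m..<r}"
  proof
    show "{m..<r} \<subseteq> f ` {v \<in> B. m \<le> f v \<and> f v < r}"
    proof
      fix n assume n: "n \<in> {m..<r}"
      then have "n \<in> f ` B" using assms by (auto simp: bij_betw_def)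
      with n show "n \<in> f ` {v \<in> B. m \<le> f v \<and> f v < r}" by auto
    qed
  qed auto
  moreover have "inj_on f {v \<in> B. m \<le> f v \<and> f v < r}"
    using assms(1) by (auto simp: bij_betw_def intro: inj_on_subset)
  ultimately show ?thesis by (metis card_atLeastLessThan card_image)
qed

definition between :: "'a set \<Rightarrow> 'a set \<Rightarrow> ('a \<Rightarrow> 'a \<Rightarrow> bool) \<Rightarrow> 'a \<Rightarrow> 'a \<Rightarrow> bool" where
  "between A B R u v \<longleftrightarrow> u \<in> A \<and> v \<in> B \<and> R u v \<or> u \<in> B \<and> v \<in> A \<and> R v u"

lemma simple_graph_between:
  assumes "finite A" "finite B" "A \<inter> B = {}"
  shows "simple_graph (A \<union> B) (between A B R)"
  using assms by unfold_locales (auto simp: between_def)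

lemma is_stable_between:
  "A \<inter> B = {} \<Longrightarrow> is_stable (between A B R) A" "A \<inter> B = {} \<Longrightarrow> is_stable (between A B R) B"
  by (auto simp: is_stable_def between_def)

lemma deg_between:
  assumes "A \<inter> B = {}"
  shows "u \<in> A \<Longrightarrow> deg (between A B R) u = card {v \<in> B. R u v}"
    "u \<in> B \<Longrightarrow> deg (between A B R) u = card {v \<in> A. R v u}"
proof -
  have "{v. between A B R u v} = {v \<in> B. R u v}" if "u \<in> A" for u
    using assms that by (auto simp: between_def)
  then show "u \<in> A \<Longrightarrow> deg (between A B R) u = card {v \<in> B. R u v}" by (simp add: deg_def)
  have "{v. between A B R u v} = {v \<in> A. R v u}" if "u \<in> B" for u
    using assms that by (auto simp: between_def)
  then show "u \<in> B \<Longrightarrow> deg (between A B R) u = card {v \<in> A. R v u}" by (simp add: deg_def)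
qed

text \<open>
  A circulant \<open>r\<close>-regular relation, minus a perfect matching between \<open>P\<close> and \<open>Q\<close>.
\<close>

lemma obtain_near_regular_relation:
  assumes fin: "finite A" "finite B" and card: "card A = k" "card B = k" and "r \<le> k"
    and PQ: "P \<subseteq> A" "Q \<subseteq> B" "card P = card Q" "card P > 0 \<Longrightarrow> r > 0"
  obtains R where "\<And>u. u \<in> A \<Longrightarrow> card {v \<in> B. R u v} + of_bool (u \<in> P) = r"
    "\<And>v. v \<in> B \<Longrightarrow> card {u \<in> A. R u v} + of_bool (v \<in> Q) = r"
proof -
  obtain \<alpha> where \<alpha>: "bij_betw \<alpha> A {..<k}" "\<And>u. u \<in> A \<Longrightarrow> \<alpha> u < card P \<longleftrightarrow> u \<in> P"
    using bij_betw_initial_segment[OF fin(1) PQ(1)] card(1) by auto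
  obtain \<beta> where \<beta>: "bij_betw \<beta> B {..<k}" "\<And>v. v \<in> B \<Longrightarrow> \<beta> v < card P \<longleftrightarrow> v \<in> Q"
    using bij_betw_initial_segment[OF fin(2) PQ(2)] card(2) PQ(3) by auto
  have \<alpha>_less: "\<alpha> u < k" if "u \<in> A" for u using bij_betwE[OF \<alpha>(1)] that by simp
  have \<beta>_less: "\<beta> v < k" if "v \<in> B" for v using bij_betwE[OF \<beta>(1)] that by simp
  define d where "d = (\<lambda>u v. cyclic_diff k (\<alpha> u) (\<beta> v))"
  define R where "R u v \<longleftrightarrow> of_bool (u \<in> P) \<le> d u v \<and> d u v < r" for u v
  have R_iff: "R u v \<longleftrightarrow> of_bool (v \<in> Q) \<le> d u v \<and> d u v < r" if "u \<in> A" "v \<in> B" for u v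
  proof (cases "d u v = 0")
    case True
    then have "\<alpha> u = \<beta> v" using cyclic_diff_eq_0_iff \<alpha>_less[OF that(1)] by (simp add: d_def)
    then show ?thesis using \<alpha>(2)[OF that(1)] \<beta>(2)[OF that(2)] by (simp add: R_def)
  qed (simp add: R_def of_bool_def)
  have finite_PQ: "finite P" "finite Q" using PQ(1,2) fin by (auto intro: finite_subset)
  have "card P > 0" if "P \<noteq> {} \<or> Q \<noteq> {}" using that finite_PQ PQ(3) by (auto simp: card_gt_0_iff)
  then have pos: "u \<in> P \<Longrightarrow> r > 0" "v \<in> Q \<Longrightarrow> r > 0" for u v using PQ(4) by blast+
  show thesis
  proof (rule that)
    fix u assume u: "u \<in> A"
    have "bij_betw (d u) B {..<k}"
      using bij_betw_trans[OF \<beta>(1) bij_betw_cyclic_diff_right[OF \<alpha>_less[OF u]]]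
      by (simp add: d_def comp_def)
    then have "card {v \<in> B. R u v} = r - of_bool (u \<in> P)"
      unfolding R_def by (rule card_bij_betw_between[OF _ \<open>r \<le> k\<close>])
    then show "card {v \<in> B. R u v} + of_bool (u \<in> P) = r" using pos by (auto simp: of_bool_def)
  next
    fix v assume v: "v \<in> B"
    have "bij_betw (\<lambda>u. d u v) A {..<k}"
      using bij_betw_trans[OF \<alpha>(1) bij_betw_cyclic_diff_left[OF \<beta>_less[OF v]]]
      by (simp add: d_def comp_def)
    then have "card {u \<in> A. of_bool (v \<in> Q) \<le> d u v \<and> d u v < r} = r - of_bool (v \<in> Q)"
      by (rule card_bij_betw_between[OF _ \<open>r \<le> k\<close>])
    moreover have "{u \<in> A. R u v} = {u \<in> A. of_bool (v \<in> Q) \<le> d u v \<and> d u v < r}"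
      using R_iff v by auto
    ultimately show "card {u \<in> A. R u v} + of_bool (v \<in> Q) = r"
      using pos by (auto simp: of_bool_def)
  qed
qed

lemma obtain_near_regular_bipartite:
  assumes "finite A" "finite B" and disjoint: "A \<inter> B = {}" and "card A = k" "card B = k" "r \<le> k"
    and PQ: "P \<subseteq> A" "Q \<subseteq> B" "card P = card Q" "card P > 0 \<Longrightarrow> r > 0"
  obtains F where "simple_graph (A \<union> B) F" "is_stable F A" "is_stable F B"
    "\<And>v. v \<in> A \<union> B \<Longrightarrow> deg F v + of_bool (v \<in> P \<union> Q) = r"
proof -
  obtain R where R: "\<And>u. u \<in> A \<Longrightarrow> card {v \<in> B. R u v} + of_bool (u \<in> P) = r"
    "\<And>v. v \<in> B \<Longrightarrow> card {u \<in> A. R u v} + of_bool (v \<in> Q) = r"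
    using obtain_near_regular_relation[OF assms(1,2,4-6) PQ] by metis
  have "deg (between A B R) v + of_bool (v \<in> P \<union> Q) = r" if "v \<in> A \<union> B" for v
  proof (cases "v \<in> A")
    case True
    then have "v \<notin> Q" using PQ(2) disjoint by blast
    then show ?thesis using True R(1) deg_between(1)[OF disjoint] by simp
  next
    case False
    then have "v \<in> B" "v \<notin> P" using that PQ(1) by blast+
    then show ?thesis using R(2) deg_between(2)[OF disjoint] by simp
  qed
  then show thesis
    using that simple_graph_between[OF assms(1,2) disjoint] is_stable_between[OF disjoint] by blast
qed

subsection \<open>Attaching a vertex\<close>

definition attach :: "'a \<Rightarrow> 'a set \<Rightarrow> ('a \<Rightarrow> 'a \<Rightarrow> bool) \<Rightarrow> 'a \<Rightarrow> 'a \<Rightarrow> bool" where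
  "attach x N E u v \<longleftrightarrow> E u v \<or> u = x \<and> v \<in> N \<or> v = x \<and> u \<in> N"

lemma is_stable_attach: "is_stable E A \<Longrightarrow> x \<notin> A \<Longrightarrow> is_stable (attach x N E) A"
  by (auto simp: is_stable_def attach_def)

context simple_graph
begin

lemma simple_graph_attach:
  assumes "x \<notin> V" "N \<subseteq> V"
  shows "simple_graph (insert x V) (attach x N E)"
proof
  show "u \<in> insert x V" if "attach x N E u v" for u v
    using that adj_left assms(2) unfolding attach_def by blast
  show "\<not> attach x N E v v" for v
    using adj_irrefl assms unfolding attach_def by blast
  show "attach x N E v u" if "attach x N E u v" for u v
    using that adj_sym[of u v] unfolding attach_def by blast
qed (simp add: finite_V)

lemma deg_attach_new:
  assumes "x \<notin> V" shows "deg (attach x N E) x = card N"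
proof -
  have "{w. attach x N E x w} = N"
    using assms adj_left unfolding attach_def by blast
  then show ?thesis by (simp add: deg_def)
qed

lemma deg_attach_old:
  assumes "x \<notin> V" "v \<noteq> x"
  shows "deg (attach x N E) v = deg E v + of_bool (v \<in> N)"
proof -
  have "{w. attach x N E v w} = (if v \<in> N then insert x {w. E v w} else {w. E v w})"
    using assms(2) unfolding attach_def by auto
  moreover have "x \<notin> {w. E v w}" using assms(1) adj_right by blast
  ultimately show ?thesis using finite_nbrs by (simp add: deg_def)
qed

lemma is_stable_insert_attach:
  assumes "is_stable E A" "x \<notin> V" "A \<inter> N = {}" "x \<notin> N"
  shows "is_stable (attach x N E) (insert x A)"
  using assms adj_left adj_right unfolding is_stable_def attach_def by blast

lemma even_sum_deg: "even (\<Sum>v\<in>V. deg E v)"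
proof -
  let ?X = "{(u, v). E u v}"
  have X: "?X = (SIGMA v:V. {w. E v w})" using adj_left by auto
  have "(\<Sum>p\<in>?X. 1 :: bit) = 0"
  proof (rule sum_involution_eq_0)
    show "prod.swap p \<in> ?X" if "p \<in> ?X" for p using that by (auto intro: adj_sym)
    show "prod.swap p \<noteq> p" if "p \<in> ?X" for p using that adj_irrefl by (cases p) auto
  qed simp_all
  then have "of_nat (card ?X) = (0 :: bit)" by simp
  then have "even (card ?X)" by (metis dvd_0_right even_of_nat_iff)
  then show ?thesis unfolding X using finite_V finite_nbrs by (simp add: deg_def)
qed

end

subsection \<open>Realizing a near-regular degree sequence\<close>

definition apex_perfect_on :: "'a set \<Rightarrow> ('a \<Rightarrow> 'a \<Rightarrow> bool) \<Rightarrow> bool" where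
  "apex_perfect_on V E \<longleftrightarrow> (\<exists>v\<in>V. perfect_on (V - {v}) E)"

definition apex_perfect_with_compl :: "'a set \<Rightarrow> ('a \<Rightarrow> 'a \<Rightarrow> bool) \<Rightarrow> bool" where
  "apex_perfect_with_compl V E \<longleftrightarrow> (\<exists>v\<in>V. perfect_with_compl V E (V - {v}))"

lemma (in unigraph_on) apex_perfect_with_compl_if_realizes:
  assumes "realizes V E F" and v: "v \<in> V" "perfect_with_compl V F (V - {v})"
  shows "apex_perfect_with_compl V E"
proof -
  obtain f where "graph_isomorphism V F V E f" using realizes_isomorphic[OF assms(1)] by blast
  then interpret g: graph_isomorphism V E V F "the_inv_into V f"
    by (rule graph_isomorphism.graph_isomorphism_inv)
  interpret gc: graph_isomorphism V "compl_on V E" V "compl_on V F" "the_inv_into V f"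
    by (rule g.graph_isomorphism_compl)
  obtain w where w: "w \<in> V" "the_inv_into V f w = v" by (rule g.obtain_preimage[OF v(1)])
  have inj: "inj_on (the_inv_into V f) (V - {w})"
    using g.bij by (auto simp: bij_betw_def intro: inj_on_subset)
  have image: "the_inv_into V f ` (V - {w}) \<subseteq> V - {v}"
    using g.image_in g.eq_iff w by auto
  have "perfect_on (V - {w}) E"
    by (rule perfect_on_embedding[OF _ inj image])
      (use v(2) g.adj_iff in \<open>auto simp: perfect_with_compl_def\<close>)
  moreover have "perfect_on (V - {w}) (compl_on V E)"
    by (rule perfect_on_embedding[OF _ inj image])
      (use v(2) gc.adj_iff in \<open>auto simp: perfect_with_compl_def\<close>)
  ultimately show ?thesis
    using w(1) by (auto simp: apex_perfect_with_compl_def perfect_with_compl_def)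
qed

locale near_regular_unigraph = unigraph_on +
  fixes y t
  assumes y_in_V: "y \<in> V" and deg_eq: "v \<in> V \<Longrightarrow> v \<noteq> y \<Longrightarrow> deg E v = t"
begin

lemma near_regular_unigraph_compl: "near_regular_unigraph V (compl_on V E) y (card V - 1 - t)"
proof -
  interpret C: unigraph_on V "compl_on V E" by (rule unigraph_on_compl)
  show ?thesis
  proof
    show "deg (compl_on V E) v = card V - 1 - t" if "v \<in> V" "v \<noteq> y" for v
      using deg_compl[OF that(1)] deg_eq[OF that] by linarith
  qed (rule y_in_V)
qed

lemma even_deg_sum: "even (deg E y + (card V - 1) * t)"
proof -
  have "(\<Sum>v\<in>V. deg E v) = deg E y + (\<Sum>v\<in>V - {y}. deg E v)"
    using finite_V y_in_V by (rule sum.remove)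
  also have "(\<Sum>v\<in>V - {y}. deg E v) = (card V - 1) * t"
    using deg_eq finite_V y_in_V by simp
  finally show ?thesis using even_sum_deg by simp
qed

lemma t_pos_if_deg_pos: "deg E y > 0 \<Longrightarrow> t > 0"
  using deg_pos_iff deg_eq adj_sym adj_right adj_irrefl by metis

lemma apex_perfect_with_compl_if_equipartition:
  assumes V_eq: "V = insert y (A \<union> B)" and y: "y \<notin> A \<union> B" and disjoint: "A \<inter> B = {}"
    and card: "card A = k" "card B = k" and "t \<le> k"
  shows "apex_perfect_with_compl V E"
proof -
  have fin: "finite A" "finite B" using finite_V V_eq by auto
  then have card_V: "card V = 2 * k + 1" using V_eq y disjoint card by (simp add: card_Un_disjoint)
  then have "even (deg E y)" using even_deg_sum by simp
  then obtain c where c: "deg E y = 2 * c" by (elim evenE)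
  then have "c \<le> k" using deg_less_card[OF y_in_V] card_V by simp
  obtain P where P: "P \<subseteq> A" "card P = c" "finite P"
    using obtain_subset_with_card_n[of c A] \<open>c \<le> k\<close> card by auto
  obtain Q where Q: "Q \<subseteq> B" "card Q = c" "finite Q"
    using obtain_subset_with_card_n[of c B] \<open>c \<le> k\<close> card by auto
  have "t > 0" if "card P > 0" using that t_pos_if_deg_pos c P(2) by simp
  then obtain F where F: "simple_graph (A \<union> B) F" "is_stable F A" "is_stable F B"
    "\<And>v. v \<in> A \<union> B \<Longrightarrow> deg F v + of_bool (v \<in> P \<union> Q) = t"
    using obtain_near_regular_bipartite[OF fin disjoint card \<open>t \<le> k\<close> P(1) Q(1)] P(2) Q(2) by metis
  interpret F: simple_graph "A \<union> B" F by fact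
  let ?G = "attach y (P \<union> Q) F"
  have "P \<union> Q \<subseteq> A \<union> B" "P \<inter> Q = {}" using P(1) Q(1) disjoint by auto
  interpret G: simple_graph V ?G
    unfolding V_eq by (rule F.simple_graph_attach[OF y \<open>P \<union> Q \<subseteq> A \<union> B\<close>])
  have "deg ?G v = deg E v" if v: "v \<in> V" for v
  proof (cases "v = y")
    case True
    then show ?thesis
      using F.deg_attach_new[OF y] P Q \<open>P \<inter> Q = {}\<close> c by (simp add: card_Un_disjoint)
  next
    case False
    then have "v \<in> A \<union> B" using v V_eq by blast
    then show ?thesis using F.deg_attach_old[OF y False] F(4) deg_eq[OF v False] by simp
  qed
  then have "realizes V E ?G" using G.simple_graph_axioms by (intro realizesI)
  moreover have "perfect_with_compl V ?G (A \<union> B)"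
    using V_eq y F(2,3) disjoint by (intro G.perfect_with_compl_bipartite is_stable_attach) auto
  moreover have "V - {y} = A \<union> B" using V_eq y by auto
  ultimately show ?thesis using apex_perfect_with_compl_if_realizes y_in_V by simp
qed

lemma apex_perfect_with_compl_even:
  assumes card: "card V = 2 * k + 1" and "t \<le> k"
  shows "apex_perfect_with_compl V E"
proof -
  have card_Diff: "card (V - {y}) = k + k" using card finite_V y_in_V by simp
  obtain A where A: "A \<subseteq> V - {y}" "card A = k" "finite A"
    using obtain_subset_with_card_n[of k "V - {y}"] card_Diff by auto
  then have "card (V - {y} - A) = k" using card_Diff finite_V by (simp add: card_Diff_subset)
  then show ?thesis
    using A y_in_V \<open>t \<le> k\<close>
    by (intro apex_perfect_with_compl_if_equipartition[of A "V - {y} - A" k]) auto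
qed

end

text \<open>
  If the number of the other vertices is odd, a further vertex \<open>x\<close> is left over besides \<open>y\<close>. The
  degree of \<open>y\<close> decides which of the two is deleted.
\<close>

locale near_regular_odd_unigraph = near_regular_unigraph +
  fixes k A B x
  assumes V_eq: "V = insert y (insert x (A \<union> B))"
    and new: "x \<notin> A \<union> B" "y \<notin> A \<union> B" "x \<noteq> y" and disjoint: "A \<inter> B = {}"
    and card_A: "card A = k" and card_B: "card B = k" and t_le: "t \<le> k"
begin

lemma finite_A_B: "finite A" "finite B"
  using finite_V V_eq by auto

lemma card_V: "card V = 2 * k + 2"
  using V_eq new disjoint finite_A_B card_A card_B by (simp add: card_Un_disjoint)

lemma x_in_V: "x \<in> V"
  using V_eq by blast

lemma obtain_half_deg_sum:
  obtains m where "deg E y + t = 2 * m"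
proof -
  have "even (deg E y + t)" using even_deg_sum card_V by (simp add: add_mult_distrib)
  then show thesis using that by (elim evenE)
qed

lemma obtain_realization:
  assumes PQ: "r \<le> k" "P \<subseteq> A" "Q \<subseteq> B" "card P = card Q" "card P > 0 \<Longrightarrow> r > 0"
    and X: "X \<subseteq> A \<union> B" and Y: "Y \<subseteq> insert x (A \<union> B)"
    and deg_A_B: "\<And>v. v \<in> A \<union> B \<Longrightarrow>
      r + of_bool (v \<in> X) + of_bool (v \<in> Y) = t + of_bool (v \<in> P \<union> Q)"
    and deg_x: "card X + of_bool (x \<in> Y) = t" and deg_y: "card Y = deg E y"
  obtains F where "simple_graph (A \<union> B) F" "is_stable F A" "is_stable F B"
    "realizes V E (attach y Y (attach x X F))"
proof -
  obtain F where F: "simple_graph (A \<union> B) F" "is_stable F A" "is_stable F B"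
    "\<And>v. v \<in> A \<union> B \<Longrightarrow> deg F v + of_bool (v \<in> P \<union> Q) = r"
    by (rule obtain_near_regular_bipartite[OF finite_A_B disjoint card_A card_B PQ]) auto
  interpret F: simple_graph "A \<union> B" F by fact
  let ?G = "attach x X F"
  interpret G: simple_graph "insert x (A \<union> B)" ?G by (rule F.simple_graph_attach[OF new(1) X])
  have y_new: "y \<notin> insert x (A \<union> B)" using new by blast
  have "deg (attach y Y ?G) v = deg E v" if v: "v \<in> V" for v
  proof -
    consider (eq_y) "v = y" | (eq_x) "v = x" | (old) "v \<in> A \<union> B" "v \<noteq> x" "v \<noteq> y"
      using v new unfolding V_eq by blast
    then show ?thesis
    proof cases
      case eq_y
      then show ?thesis using G.deg_attach_new[OF y_new] deg_y by simp
    next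
      case eq_x
      then show ?thesis
        using G.deg_attach_old[OF y_new, of x Y] F.deg_attach_new[OF new(1)] deg_x deg_eq[OF v]
          new(3) by simp
    next
      case old
      then show ?thesis
        using G.deg_attach_old[OF y_new old(3)] F.deg_attach_old[OF new(1) old(2)] deg_A_B F(4)
          deg_eq[OF v] by fastforce
    qed
  qed
  then have "realizes V E (attach y Y ?G)"
    using G.simple_graph_attach[OF y_new Y] V_eq by (intro realizesI) auto
  with F that show thesis by blast
qed

lemma is_stable_A_B_attach:
  assumes "is_stable F A" "is_stable F B"
  shows "is_stable (attach x X F) A" "is_stable (attach x X F) B"
    "is_stable (attach y Y (attach x X F)) A" "is_stable (attach y Y (attach x X F)) B"
  using assms new by (auto intro!: is_stable_attach)

lemma apex_perfect_with_compl_if_le: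
  assumes "deg E y \<le> t"
  shows "apex_perfect_with_compl V E"
proof -
  obtain i where i: "deg E y + t = 2 * i" by (rule obtain_half_deg_sum)
  define j where "j = i - deg E y"
  have ij: "i + j = t" "i = j + deg E y" using i assms by (simp_all add: j_def)
  then have "i \<le> k" using t_le by simp
  obtain P where P: "P \<subseteq> A" "card P = i" "finite P"
    using obtain_subset_with_card_n[of i A] card_A \<open>i \<le> k\<close> by auto
  obtain Q where Q: "Q \<subseteq> B" "card Q = i" "finite Q"
    using obtain_subset_with_card_n[of i B] card_B \<open>i \<le> k\<close> by auto
  obtain Q' where Q': "Q' \<subseteq> Q" "card Q' = j" "finite Q'"
    using obtain_subset_with_card_n[of j Q] Q(2) ij by auto
  let ?X = "P \<union> Q'" and ?Y = "Q - Q'"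
  have XY: "?X \<subseteq> A \<union> B" "?Y \<subseteq> insert x (A \<union> B)" using P(1) Q(1) Q'(1) by auto
  have deg: "t + of_bool (v \<in> ?X) + of_bool (v \<in> ?Y) = t + of_bool (v \<in> P \<union> Q)" for v
    using P(1) Q(1) Q'(1) disjoint by (auto simp: of_bool_def)
  have deg_x: "card ?X + of_bool (x \<in> ?Y) = t"
    using P Q(1) Q' disjoint new ij(1) by (subst card_Un_disjoint) auto
  have deg_y: "card ?Y = deg E y" using Q Q' ij by (simp add: card_Diff_subset)
  obtain F where F: "simple_graph (A \<union> B) F" "is_stable F A" "is_stable F B"
    "realizes V E (attach y ?Y (attach x ?X F))"
    by (rule obtain_realization[OF t_le P(1) Q(1) _ _ XY deg deg_x deg_y])
      (use P(2) Q(2) ij(1) in simp_all)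
  let ?G = "attach y ?Y (attach x ?X F)"
  interpret F: simple_graph "A \<union> B" F by fact
  interpret Fx: simple_graph "insert x (A \<union> B)" "attach x ?X F"
    by (rule F.simple_graph_attach[OF new(1) XY(1)])
  interpret G: simple_graph V ?G using F(4) by (simp add: realizes_def)
  note stable = is_stable_A_B_attach[OF F(2,3)]
  have "is_stable ?G (insert y A)"
    using Q(1) disjoint new by (intro Fx.is_stable_insert_attach[OF stable(1)]) auto
  then have "perfect_with_compl V ?G (insert y A \<union> B)"
    using stable(4) V_eq disjoint new by (intro G.perfect_with_compl_bipartite) auto
  moreover have "V - {x} = insert y A \<union> B" using V_eq new by auto
  ultimately show ?thesis using apex_perfect_with_compl_if_realizes[OF F(4) x_in_V] by simp
qed

lemma apex_perfect_with_compl_if_greater: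
  assumes "t < deg E y" "deg E y + t \<le> 2 * k"
  shows "apex_perfect_with_compl V E"
proof -
  obtain m where m: "deg E y + t = 2 * m" by (rule obtain_half_deg_sum)
  then have "m \<le> k" "t \<le> m" using assms by simp_all
  have "t > 0" using t_pos_if_deg_pos assms(1) by simp
  obtain P where P: "P \<subseteq> A" "card P = m" "finite P"
    using obtain_subset_with_card_n[of m A] card_A \<open>m \<le> k\<close> by auto
  obtain P' where P': "P' \<subseteq> P" "card P' = t" "finite P'"
    using obtain_subset_with_card_n[of t P] P(2) \<open>t \<le> m\<close> by auto
  obtain Q where Q: "Q \<subseteq> B" "card Q = m" "finite Q"
    using obtain_subset_with_card_n[of m B] card_B \<open>m \<le> k\<close> by auto
  let ?Y = "(P - P') \<union> Q"
  have XY: "P' \<subseteq> A \<union> B" "?Y \<subseteq> insert x (A \<union> B)" using P(1) P'(1) Q(1) by auto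
  have deg: "t + of_bool (v \<in> P') + of_bool (v \<in> ?Y) = t + of_bool (v \<in> P \<union> Q)" for v
    using P(1) P'(1) Q(1) disjoint by (auto simp: of_bool_def)
  have deg_x: "card P' + of_bool (x \<in> ?Y) = t" using P(1) P' Q(1) new by auto
  have deg_y: "card ?Y = deg E y"
    using P P' Q disjoint m \<open>t \<le> m\<close> by (subst card_Un_disjoint) (auto simp: card_Diff_subset)
  obtain F where F: "simple_graph (A \<union> B) F" "is_stable F A" "is_stable F B"
    "realizes V E (attach y ?Y (attach x P' F))"
    by (rule obtain_realization[OF t_le P(1) Q(1) _ \<open>t > 0\<close> XY deg deg_x deg_y])
      (use P(2) Q(2) in simp_all)
  let ?G = "attach y ?Y (attach x P' F)"
  interpret F: simple_graph "A \<union> B" F by fact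
  interpret G: simple_graph V ?G using F(4) by (simp add: realizes_def)
  have "is_stable (attach x P' F) (insert x B)"
    using P(1) P'(1) disjoint new by (intro F.is_stable_insert_attach[OF F(3)]) auto
  then have "is_stable ?G (insert x B)" by (rule is_stable_attach) (use new in auto)
  then have "perfect_with_compl V ?G (A \<union> insert x B)"
    using is_stable_A_B_attach(3)[OF F(2,3)] V_eq disjoint new
    by (intro G.perfect_with_compl_bipartite) auto
  moreover have "V - {y} = A \<union> insert x B" using V_eq new by auto
  ultimately show ?thesis using apex_perfect_with_compl_if_realizes[OF F(4) y_in_V] by simp
qed

lemma apex_perfect_with_compl_if_large:
  assumes "2 * k < deg E y + t"
  shows "apex_perfect_with_compl V E"
proof -
  define l where "l = 2 * k + 1 - deg E y"
  have l: "l + deg E y = 2 * k + 1" using deg_less_card[OF y_in_V] card_V by (simp add: l_def)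
  obtain m where m: "deg E y + t = 2 * m" by (rule obtain_half_deg_sum)
  define j where "j = m - (k + 1)"
  have j: "t = j + l + j + 1" using m l assms by (simp add: j_def)
  then have "l \<le> k" "t - 1 \<le> k" using t_le by simp_all
  obtain P where P: "P \<subseteq> A" "card P = j + l" "finite P"
    using obtain_subset_with_card_n[of "j + l" A] card_A j t_le by auto
  obtain P' where P': "P' \<subseteq> P" "card P' = j" "finite P'"
    using obtain_subset_with_card_n[of j P] P(2) by auto
  obtain Q where Q: "Q \<subseteq> B" "card Q = j" "finite Q"
    using obtain_subset_with_card_n[of j B] card_B j t_le by auto
  let ?X = "P \<union> Q" and ?Z = "(A - (P - P')) \<union> B"
  let ?Y = "insert x ?Z"
  have XY: "?X \<subseteq> A \<union> B" "?Y \<subseteq> insert x (A \<union> B)" using P(1) Q(1) by auto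
  have deg: "t - 1 + of_bool (v \<in> ?X) + of_bool (v \<in> ?Y) = t + of_bool (v \<in> P' \<union> Q)"
    if "v \<in> A \<union> B" for v
    using that P(1) P'(1) Q(1) disjoint new j by (auto simp: of_bool_def)
  have deg_x: "card ?X + of_bool (x \<in> ?Y) = t"
    using P Q disjoint j by (subst card_Un_disjoint) auto
  have "card (A - (P - P')) = k - l"
    using P P' finite_A_B card_A by (subst card_Diff_subset) (auto simp: card_Diff_subset)
  moreover have "card ?Z = card (A - (P - P')) + card B"
    using finite_A_B disjoint by (intro card_Un_disjoint) auto
  moreover have "x \<notin> ?Z" "finite ?Z" using new finite_A_B by auto
  ultimately have deg_y: "card ?Y = deg E y" using card_B l \<open>l \<le> k\<close> by simp
  obtain F where F: "simple_graph (A \<union> B) F" "is_stable F A" "is_stable F B"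
    "realizes V E (attach y ?Y (attach x ?X F))"
    by (rule obtain_realization[OF \<open>t - 1 \<le> k\<close> subset_trans[OF P'(1) P(1)] Q(1) _ _ XY
          deg deg_x deg_y])
      (use P'(2) Q(2) j in simp_all)
  let ?G = "attach y ?Y (attach x ?X F)"
  interpret G: simple_graph V ?G using F(4) by (simp add: realizes_def)
  have "perfect_with_compl V ?G (insert y (A \<union> B))"
    using is_stable_A_B_attach(3,4)[OF F(2,3)] V_eq disjoint
    by (intro G.perfect_with_compl_bipartite_insert) (auto simp: attach_def)
  moreover have "V - {x} = insert y (A \<union> B)" using V_eq new by auto
  ultimately show ?thesis using apex_perfect_with_compl_if_realizes[OF F(4) x_in_V] by simp
qed

lemma apex_perfect_with_compl_V: "apex_perfect_with_compl V E"
  using apex_perfect_with_compl_if_le apex_perfect_with_compl_if_greater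
    apex_perfect_with_compl_if_large by linarith

end

context near_regular_unigraph
begin

lemma apex_perfect_with_compl_odd:
  assumes card: "card V = 2 * k + 2" and "t \<le> k"
  shows "apex_perfect_with_compl V E"
proof -
  have card': "card (V - {y}) = 2 * k + 1" using card finite_V y_in_V by simp
  obtain A where A: "A \<subseteq> V - {y}" "card A = k" "finite A"
    using obtain_subset_with_card_n[of k "V - {y}"] card' by auto
  have "card (V - {y} - A) = k + 1" using A card' finite_V by (simp add: card_Diff_subset)
  then obtain x B where "V - {y} - A = insert x B" "x \<notin> B" "card B = k"
    by (metis Suc_eq_plus1 card_eq_SucD)
  then interpret near_regular_odd_unigraph V E y t k A B x
    using A y_in_V \<open>t \<le> k\<close> by unfold_locales auto
  show ?thesis by (rule apex_perfect_with_compl_V)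
qed

lemma apex_perfect_with_compl_sparse:
  assumes "t \<le> (card V - 1) div 2"
  shows "apex_perfect_with_compl V E"
proof -
  define k where "k = (card V - 1) div 2"
  have "t \<le> k" using assms by (simp add: k_def)
  have "card V > 0" using deg_less_card[OF y_in_V] by linarith
  then consider (even) "card V = 2 * k + 1" | (odd) "card V = 2 * k + 2" unfolding k_def by linarith
  then show ?thesis
  proof cases
    case even
    then show ?thesis using \<open>t \<le> k\<close> by (rule apex_perfect_with_compl_even)
  next
    case odd
    then show ?thesis using \<open>t \<le> k\<close> by (rule apex_perfect_with_compl_odd)
  qed
qed

lemma near_regular_apex_perfect_on: "apex_perfect_on V E"
proof (cases "t \<le> (card V - 1) div 2")
  case True
  then show ?thesis
    using apex_perfect_with_compl_sparse
    by (auto simp: apex_perfect_on_def apex_perfect_with_compl_def perfect_with_compl_def)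
next
  case False
  interpret C: near_regular_unigraph V "compl_on V E" y "card V - 1 - t"
    by (rule near_regular_unigraph_compl)
  have "apex_perfect_with_compl V (compl_on V E)"
    using C.apex_perfect_with_compl_sparse False by simp
  then show ?thesis
    by (auto simp: apex_perfect_on_def apex_perfect_with_compl_def perfect_with_compl_def
        compl_on_compl_on)
qed

end

section \<open>Apex-perfection of unigraphs\<close>

lemma (in unmixed_unigraph) perfect_on_V: "perfect_on V E"
proof -
  obtain A where A: "A \<subseteq> V" "is_clique E A" "is_stable E (V - A)" by (rule split_partition)
  have "perfect_on (A \<union> (V - A) \<union> {}) E"
    using A perfect_on_empty by (intro perfect_on_join) auto
  moreover have "A \<union> (V - A) \<union> {} = V" using A(1) by blast
  ultimately show ?thesis by simp
qed

context unigraph_on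
begin

lemma apex_perfect_on_if_mixed:
  assumes "mixed V E t"
  shows "apex_perfect_on V E"
proof -
  obtain C y k where core: "deg_class V E t \<subseteq> C" "near_regular_core V E C y k"
    by (rule obtain_near_regular_core[OF assms])
  then have C: "C \<subseteq> V" "module_of V E C" by (simp_all add: near_regular_core_def)
  interpret C: unigraph_on C "restrict_on C E"
    by (rule unigraph_on_restrict_on[OF C(1)]) (use core(2) in \<open>auto simp: near_regular_core_def\<close>)
  interpret C: near_regular_unigraph C "restrict_on C E" y k
    using core(2) by unfold_locales (auto simp: near_regular_core_def)
  obtain v where v: "v \<in> C" "perfect_on (C - {v}) (restrict_on C E)"
    using C.near_regular_apex_perfect_on by (auto simp: apex_perfect_on_def)
  moreover have "perfect_on (C - {v}) (restrict_on C E) \<longleftrightarrow> perfect_on (C - {v}) E"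
    by (rule perfect_on_cong) (auto simp: restrict_on_def)
  ultimately have perfect_C: "perfect_on (C - {v}) E" by blast
  let ?A = "{x \<in> V - C. \<forall>v\<in>C. E x v}" and ?B = "{x \<in> V - C. \<forall>v\<in>C. \<not> E x v}"
  have "perfect_on (?A \<union> ?B \<union> (C - {v})) E"
    using C(1) perfect_C clique_and_stable_outside[OF assms core(1)] by (intro perfect_on_join) auto
  moreover have "?A \<union> ?B \<union> (C - {v}) = V - {v}"
    using C v(1) unfolding module_of_def by blast
  ultimately show ?thesis using v(1) C(1) by (auto simp: apex_perfect_on_def)
qed

lemma apex_perfect_on_V:
  assumes "V \<noteq> {}"
  shows "apex_perfect_on V E"
proof (cases "\<exists>t. mixed V E t")
  case True
  then show ?thesis using apex_perfect_on_if_mixed by blast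
next
  case False
  then interpret unmixed_unigraph V E by unfold_locales blast
  show ?thesis using perfect_on_V perfect_on_subset assms unfolding apex_perfect_on_def by blast
qed

end

lemma apex_perfect_on_embedding:
  assumes "apex_perfect_on V E" "U \<noteq> {}" and inj: "inj_on f U" and image: "f ` U \<subseteq> V"
    and adj: "\<And>x y. x \<in> U \<Longrightarrow> y \<in> U \<Longrightarrow> F x y \<longleftrightarrow> E (f x) (f y)"
  shows "apex_perfect_on U F"
proof -
  obtain w where w: "perfect_on (V - {w}) E" using assms(1) by (auto simp: apex_perfect_on_def)
  obtain v where v: "v \<in> U" "w \<in> f ` U \<Longrightarrow> f v = w" using assms(2) by blast
  have "f ` (U - {v}) \<subseteq> V - {w}" using image inj v by (auto simp: inj_on_def)
  then have "perfect_on (U - {v}) F"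
    using adj by (intro perfect_on_embedding[OF w inj_on_subset[OF inj]]) auto
  then show ?thesis using v(1) by (auto simp: apex_perfect_on_def)
qed

section \<open>Graphs as symmetric digraphs\<close>

lemma dominates_iff: "dominates G u v \<longleftrightarrow> (\<exists>e\<in>arcs G. tail G e = u \<and> head G e = v)"
  by (auto simp: arcs_ends_conv)

lemma simple_graph_dominates:
  assumes "graph G"
  shows "simple_graph (verts G) (dominates G)"
proof -
  interpret graph G by fact
  show ?thesis
    using finite_verts adj_in_verts adj_not_same arcs_ends_symmetric[OF sym_arcs]
    by unfold_locales blast+
qed

lemma deg_dominates:
  assumes "graph G"
  shows "deg (dominates G) v = out_degree G v"
proof -
  interpret graph G by fact
  have "{w. dominates G v w} = head G ` out_arcs G v"
    by (auto simp: dominates_iff)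
  moreover have "inj_on (head G) (out_arcs G v)"
    by (rule inj_onI) (auto simp: arc_to_ends_def intro: no_multi_arcs)
  ultimately show ?thesis by (simp add: deg_def out_degree_def card_image)
qed

lemma graph_isomorphism_digraph_iso:
  assumes "graph G" "graph H" "digraph_iso G H"
  obtains f where "graph_isomorphism (verts G) (dominates G) (verts H) (dominates H) f"
proof -
  interpret G: graph G by fact
  obtain i where i: "G.digraph_isomorphism i" "H = app_iso i G"
    using assms(3) by (auto simp: digraph_iso_def)
  have ends: "iso_tail i (iso_arcs i a) = iso_verts i (tail G a)"
    "iso_head i (iso_arcs i a) = iso_verts i (head G a)" if "a \<in> arcs G" for a
    using G.iso_verts_tail[OF i(1) that] G.iso_verts_head[OF i(1) that] by simp_all
  have "graph_isomorphism (verts G) (dominates G) (verts H) (dominates H) (iso_verts i)"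
  proof (intro graph_isomorphism.intro graph_isomorphism_axioms.intro)
    show "bij_betw (iso_verts i) (verts G) (verts H)"
      using G.digraph_isomorphism_inj_on_verts[OF i(1)] i(2) by (simp add: bij_betw_def)
    fix u v assume uv: "u \<in> verts G" "v \<in> verts G"
    have "dominates H (iso_verts i u) (iso_verts i v) \<longleftrightarrow>
        (\<exists>a\<in>arcs G. iso_verts i (tail G a) = iso_verts i u \<and>
          iso_verts i (head G a) = iso_verts i v)"
      unfolding dominates_iff i(2) using ends by auto
    also have "\<dots> \<longleftrightarrow> (\<exists>a\<in>arcs G. tail G a = u \<and> head G a = v)"
      using G.iso_verts_eq_iff[OF i(1)] uv G.tail_in_verts G.head_in_verts by metis
    finally show "dominates G u v \<longleftrightarrow> dominates H (iso_verts i u) (iso_verts i v)"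
      by (simp add: dominates_iff)
  qed (use simple_graph_dominates assms in auto)
  then show thesis by (rule that)
qed

lemma (in simple_graph) graph_with_proj:
  "graph (with_proj \<lparr>pverts = V, parcs = {(u, v). E u v}\<rparr>)"
proof -
  let ?G = "\<lparr>pverts = V, parcs = {(u, v). E u v}\<rparr>"
  have arcs: "{(u, v). E u v} \<subseteq> V \<times> V" using adj_left adj_right by auto
  interpret pair_graph ?G
  proof
    show "finite (parcs ?G)" using finite_subset[OF arcs] finite_V by simp
    show "symmetric (with_proj ?G)" using adj_sym by (auto simp: symmetric_def sym_def)
  qed (use finite_V adj_left adj_right adj_irrefl in auto)
  show ?thesis by (rule graph_axioms)
qed

lemma unigraph_on_dominates:
  assumes "unigraph U"
  shows "unigraph_on (verts U) (dominates U)"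
proof (intro unigraph_on.intro unigraph_on_axioms.intro)
  have U: "graph U" using assms by (simp add: unigraph_def)
  show "simple_graph (verts U) (dominates U)" by (rule simple_graph_dominates[OF U])
  fix E assume E: "realizes (verts U) (dominates U) E"
  let ?H = "with_proj \<lparr>pverts = verts U, parcs = {(u, v). E u v}\<rparr>"
  have H: "graph ?H"
    using E simple_graph.graph_with_proj by (auto simp: realizes_def)
  have E_eq: "dominates ?H = E" by simp
  have "out_degree ?H = out_degree U"
    using E deg_dominates[OF H] deg_dominates[OF U] E_eq by (simp add: realizes_def fun_eq_iff)
  then have "degree_sequence ?H = degree_sequence U" by (simp add: degree_sequence_eq_iff)
  then have "digraph_iso ?H U" by (rule unigraph_iso_any_type[OF assms H])
  then show "\<exists>f. graph_isomorphism (verts U) E (verts U) (dominates U) f"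
    using graph_isomorphism_digraph_iso[OF H U] unfolding E_eq by auto
qed

lemma dominates_induced_subgraph:
  assumes "induced_subgraph H G" "u \<in> verts H" "v \<in> verts H"
  shows "dominates H u v \<longleftrightarrow> dominates G u v"
proof -
  have "tail H = tail G" "head H = head G"
    using assms(1) by (auto simp: induced_subgraph_def subgraph_def compatible_def)
  then show ?thesis using assms by (auto simp: dominates_iff induced_subgraph_def)
qed

lemma graph_induced_subgraph:
  assumes "graph G" "induced_subgraph H G"
  shows "graph H"
proof -
  interpret graph G by fact
  interpret H: digraph H by (rule digraphI_induced[OF assms(2)])
  show ?thesis by (rule H.graphI[OF induced_graph_imp_symmetric[OF sym_arcs assms(2)]])
qed

lemma (in wf_digraph) induced_subgraph_del_vert: "induced_subgraph (del_vert v) G"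
  using subgraph_del_vert unfolding induced_subgraph_def
  by (auto simp: del_vert_simps tail_in_verts head_in_verts)

subsection \<open>Clique number and chromatic number\<close>

lemma clique_iff: "clique G K \<longleftrightarrow> K \<subseteq> verts G \<and> is_clique (dominates G) K"
  by (simp add: clique_def is_clique_def)

lemma finite_cliques: "finite (verts G) \<Longrightarrow> finite {K. clique G K}"
  by (rule finite_subset[of _ "Pow (verts G)"]) (auto simp: clique_def)

lemma card_le_clique_number: "finite (verts G) \<Longrightarrow> clique G K \<Longrightarrow> card K \<le> clique_number G"
  unfolding clique_number_def using finite_cliques by (intro Max_ge) auto

lemma clique_number_attained:
  assumes "finite (verts G)"
  obtains K where "clique G K" "card K = clique_number G"
proof -
  have "clique G {}" by (simp add: clique_def)
  then obtain K where "K \<in> {K. clique G K}" "Max (card ` {K. clique G K}) = card K"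
    using obtains_MAX[of "{K. clique G K}" card] finite_cliques[OF assms] by blast
  then show thesis using that by (simp add: clique_number_def)
qed

lemma clique_number_induced_subgraph_le:
  assumes "finite (verts G)" "induced_subgraph H G"
  shows "clique_number H \<le> clique_number G"
proof -
  have H: "verts H \<subseteq> verts G" using assms(2) by (auto simp: induced_subgraph_def subgraph_def)
  obtain K where K: "clique H K" "card K = clique_number H"
    using clique_number_attained[of H] finite_subset[OF H assms(1)] by blast
  then have "clique G K"
    using H dominates_induced_subgraph[OF assms(2)] unfolding clique_def by blast
  then show ?thesis using card_le_clique_number[OF assms(1)] K(2) by metis
qed

lemma chromatic_number_le: "proper_colouring G k c \<Longrightarrow> chromatic_number G \<le> k"
  unfolding chromatic_number_def by (rule Least_le) blast

context graph
begin

lemma proper_colouring_chromatic_number: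
  obtains c where "proper_colouring G (chromatic_number G) c"
proof -
  obtain c and n :: nat where c: "c ` verts G = {i. i < n}" "inj_on c (verts G)"
    using finite_imp_inj_to_nat_seg[OF finite_verts] by blast
  have "proper_colouring G n c"
    unfolding proper_colouring_def
    using c adj_in_verts adj_not_same by (auto simp: inj_on_eq_iff)
  then have "\<exists>n c. proper_colouring G n c" by blast
  then have "\<exists>c. proper_colouring G (chromatic_number G) c"
    unfolding chromatic_number_def by (rule LeastI_ex)
  with that show thesis by blast
qed

lemma clique_number_le_chromatic_number: "clique_number G \<le> chromatic_number G"
proof -
  obtain c where c: "proper_colouring G (chromatic_number G) c"
    by (rule proper_colouring_chromatic_number)
  obtain K where K: "clique G K" "card K = clique_number G"
    by (rule clique_number_attained[OF finite_verts])
  have "inj_on c K" "c ` K \<subseteq> {..<chromatic_number G}"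
    using K(1) c unfolding inj_on_def clique_def proper_colouring_def by blast+
  then show ?thesis using K(2) card_inj_on_le[of c K "{..<chromatic_number G}"] by simp
qed

lemma chromatic_number_eq_clique_number:
  assumes "clique_colourable (verts G) (dominates G)"
  shows "chromatic_number G = clique_number G"
proof (rule antisym[OF _ clique_number_le_chromatic_number])
  obtain K f where K: "K \<subseteq> verts G" "is_clique (dominates G) K"
    "colouring (dominates G) (verts G) (card K) f"
    using assms by (rule clique_colourableE)
  have "proper_colouring G (card K) f"
    using K(3) adj_in_verts unfolding colouring_def proper_colouring_def by blast
  then have "chromatic_number G \<le> card K" by (rule chromatic_number_le)
  also have "\<dots> \<le> clique_number G"
    using K(1,2) by (intro card_le_clique_number) (simp_all add: clique_iff)
  finally show "chromatic_number G \<le> clique_number G" .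
qed

lemma chromatic_number_le_Suc_del_vert: "chromatic_number G \<le> chromatic_number (del_vert v) + 1"
proof -
  let ?D = "del_vert v" and ?k = "chromatic_number (del_vert v)"
  interpret D: graph ?D
    by (rule graph_induced_subgraph[OF graph_axioms induced_subgraph_del_vert])
  obtain c where c: "proper_colouring ?D ?k c" by (rule D.proper_colouring_chromatic_number)
  have dominates_D: "dominates ?D x y" if "dominates G x y" "x \<noteq> v" "y \<noteq> v" for x y
    using that dominates_induced_subgraph[OF induced_subgraph_del_vert, of x v y] adj_in_verts
    by (simp add: verts_del_vert)
  have "proper_colouring G (?k + 1) (c(v := ?k))"
    unfolding proper_colouring_def
  proof (intro conjI ballI allI impI)
    have less: "c x < ?k" if "x \<in> verts G" "x \<noteq> v" for x
      using c that by (simp add: proper_colouring_def verts_del_vert)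
    then show "(c(v := ?k)) x < ?k + 1" if "x \<in> verts G" for x
      using that by (cases "x = v") (simp_all add: less_SucI)
    fix x y assume xy: "dominates G x y"
    then have V: "x \<in> verts G" "y \<in> verts G" "x \<noteq> y" using adj_in_verts adj_not_same by blast+
    show "(c(v := ?k)) x \<noteq> (c(v := ?k)) y"
    proof (cases "x = v \<or> y = v")
      case True
      then show ?thesis using V less[of x] less[of y] by auto
    next
      case False
      then show ?thesis using c dominates_D[OF xy] by (simp add: proper_colouring_def)
    qed
  qed
  then show ?thesis by (rule chromatic_number_le)
qed

lemma perfect_graph_if_perfect_on:
  assumes "perfect_on (verts G) (dominates G)"
  shows "perfect_graph G"
  unfolding perfect_graph_def
proof (intro conjI allI impI)
  fix H assume H: "induced_subgraph H G"
  interpret H: graph H by (rule graph_induced_subgraph[OF graph_axioms H])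
  have "verts H \<subseteq> verts G" using H by (auto simp: induced_subgraph_def subgraph_def)
  then have "perfect_on (verts H) (dominates G)" by (rule perfect_on_subset[OF assms])
  moreover have "perfect_on (verts H) (dominates H) \<longleftrightarrow> perfect_on (verts H) (dominates G)"
    by (rule perfect_on_cong) (rule dominates_induced_subgraph[OF H])
  ultimately have "perfect_on (verts H) (dominates H)" by blast
  then show "chromatic_number H = clique_number H"
    by (intro H.chromatic_number_eq_clique_number) (simp add: perfect_on_def)
qed (rule graph_axioms)

lemma apex_perfect_if_apex_perfect_on:
  assumes "apex_perfect_on (verts G) (dominates G)"
  shows "apex_perfect G"
proof -
  obtain v where v: "v \<in> verts G" "perfect_on (verts G - {v}) (dominates G)"
    using assms by (auto simp: apex_perfect_on_def)
  interpret D: graph "del_vert v"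
    by (rule graph_induced_subgraph[OF graph_axioms induced_subgraph_del_vert])
  have "perfect_on (verts (del_vert v)) (dominates (del_vert v)) \<longleftrightarrow>
      perfect_on (verts (del_vert v)) (dominates G)"
    by (rule perfect_on_cong) (rule dominates_induced_subgraph[OF induced_subgraph_del_vert])
  then have "perfect_on (verts (del_vert v)) (dominates (del_vert v))"
    using v(2) by (simp add: verts_del_vert)
  then have "perfect_graph (del_vert v)" by (rule D.perfect_graph_if_perfect_on)
  then show ?thesis using v(1) graph_axioms by (auto simp: apex_perfect_def)
qed

lemma chromatic_number_le_if_apex_perfect:
  assumes "apex_perfect G"
  shows "chromatic_number G \<le> clique_number G + 1"
proof -
  obtain v where "perfect_graph (del_vert v)" using assms by (auto simp: apex_perfect_def)
  then have "chromatic_number (del_vert v) = clique_number (del_vert v)"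
    using wf_digraph.induced_subgraph_refl[OF wf_digraph_del_vert] by (simp add: perfect_graph_def)
  then show ?thesis
    using chromatic_number_le_Suc_del_vert[of v]
      clique_number_induced_subgraph_le[OF finite_verts induced_subgraph_del_vert, of v] by linarith
qed

end

theorem theorem3p2:
  fixes G :: "('a,'b) pre_digraph" and H U :: "('c,'d) pre_digraph"
  assumes "graph G"
    and "unigraph U" and "induced_subgraph H U" and "digraph_iso G H"
  shows "(verts G \<noteq> {} \<longrightarrow> apex_perfect G) \<and> chromatic_number G \<le> clique_number G + 1"
proof (cases "verts G = {}")
  case True
  then have "clique_colourable (verts G) (dominates G)"
    using perfect_on_empty[of "dominates G"] by (simp add: perfect_on_def)
  then show ?thesis using True graph.chromatic_number_eq_clique_number[OF assms(1)] by simp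
next
  case False
  interpret G: graph G by fact
  interpret U: unigraph_on "verts U" "dominates U" by (rule unigraph_on_dominates[OF assms(2)])
  have H: "graph H" using graph_induced_subgraph[OF _ assms(3)] assms(2) by (simp add: unigraph_def)
  have HU: "verts H \<subseteq> verts U" using assms(3) by (auto simp: induced_subgraph_def subgraph_def)
  obtain f where "graph_isomorphism (verts G) (dominates G) (verts H) (dominates H) f"
    by (rule graph_isomorphism_digraph_iso[OF assms(1) H assms(4)])
  then interpret f: graph_isomorphism "verts G" "dominates G" "verts H" "dominates H" f .
  have "apex_perfect_on (verts G) (dominates G)"
  proof (rule apex_perfect_on_embedding)
    show "apex_perfect_on (verts U) (dominates U)"
      using False f.image_in HU by (intro U.apex_perfect_on_V) blast
    show "inj_on f (verts G)" "f ` verts G \<subseteq> verts U"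
      using f.bij HU by (auto simp: bij_betw_def)
    show "dominates G x y \<longleftrightarrow> dominates U (f x) (f y)" if "x \<in> verts G" "y \<in> verts G" for x y
      using f.adj_iff[OF that] f.image_in that dominates_induced_subgraph[OF assms(3)] by simp
  qed (rule False)
  then have "apex_perfect G" by (rule G.apex_perfect_if_apex_perfect_on)
  then show ?thesis using G.chromatic_number_le_if_apex_perfect by blast
qed

end
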